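(* Let $\omega>0$. Then, as formal power series in $X$, $$1+\sum_{r\ge 1}Z_{\omega}(e_{2}^{r})X^{2r}=\frac{\sin\bigl(\omega^{-1}\arcsin(\pi i\omega X)\bigr)}{\pi i X}\,\exp\left(-\frac{\arcsin^{2}(\pi i\omega X)}{\pi i\omega}\right).$$
   Context: Let $\mathcal{C}=\mathbb{Q}[\hbar,\hbar^{-1}]$, let $\widehat{\mathfrak{H}^{1}}=\mathcal{C}\langle e_{1},g_{1},g_{2},\ldots\rangle$ be the non-commutative polynomial ring, and $e_{k}=g_{k}+\hbar g_{k-1}$ for $k\ge2$; $e_{2}^{r}$ is the $r$-th power for concatenation. Let $\mathcal{A}=\{e_{1}-g_{1}\}\sqcup\{g_{k}\mid k\ge1\}$ (a free generating set), let $\mathfrak{z}$ be the free $\mathcal{C}$-module spanned by $\mathcal{A}$, and let $\widehat{\mathfrak{H}^{0}}\subset\widehat{\mathfrak{H}^{1}}$ be the $\mathcal{C}$-submodule spanned by $1$ and the monomials $u_{1}\cdots u_{r}$ ($u_{i}\in\mathcal{A}$) with $u_{r}\ne e_{1}-g_{1}$. Fix $\omega>0$ and let $\hbar^{\pm1}$ act on $\mathbb{C}$ and on meromorphic functions on $\mathbb{C}$ as multiplication by $(2\pi i\omega)^{\pm1}$. Define the $\mathcal{C}$-linear map $J_{\omega}(\,\cdot\,|\,t)$ from $\mathfrak{z}$ to meromorphic functions of $t$ by $J_{\omega}(e_{1}-g_{1}\,|\,t)=2\pi i\omega$ and $J_{\omega}(g_{k}\,|\,t)=\left(\frac{2\pi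 i\omega\,e^{2\pi i\omega t}}{1-e^{2\pi i\omega t}}\right)^{k}$ for $k\ge1$. The $\mathcal{C}$-linear map $Z_{\omega}:\widehat{\mathfrak{H}^{0}}\to\mathbb{C}$ is defined by $Z_{\omega}(1)=1$ and, for $u_{1},\ldots,u_{r}\in\mathcal{A}$ with $u_{r}\ne e_{1}-g_{1}$, $$Z_{\omega}(u_{1}\cdots u_{r})=\prod_{a=1}^{r}\int_{-\epsilon+i\mathbb{R}}\frac{dt_{a}}{e^{2\pi i t_{a}}-1}\prod_{a=1}^{r}J_{\omega}(u_{a}\,|\,t_{1}+\cdots+t_{a}),$$ where $0<\epsilon<\min\{1,1/(r\omega)\}$ and the lines are oriented upward (the integral converges absolutely and is independent of $\epsilon$). $\arcsin$ and $\sin$ denote Taylor series at $0$. *)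

theory Defs
  imports
    "HOL-Complex_Analysis.Complex_Analysis"
    "HOL-Library.Poly_Mapping"
begin

section \<open>The algebra \<open>\<C>\<langle>e\<^sub>1, g\<^sub>1, g\<^sub>2, \<dots>\<rangle>\<close> over \<open>\<C> = \<rat>[\<hbar>, \<hbar>\<^sup>-\<^sup>1]\<close>\<close>

text \<open>
  Laurent polynomials are the group algebra \<open>\<rat>[\<int>]\<close>: multiplication on \<^typ>\<open>int \<Rightarrow>\<^sub>0 rat\<close> is
  convolution, and the key \<open>k\<close> is the exponent of \<open>\<hbar>\<close>.
\<close>

type_synonym laurent = "int \<Rightarrow>\<^sub>0 rat"

definition hbar :: laurent where
  "hbar = Poly_Mapping.single 1 1"

text \<open>\<open>G j\<close> is the letter for \<open>g\<^bsub>j+1\<^esub>\<close>, so that there is no superfluous generator \<open>g\<^sub>0\<close>.\<close>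

datatype gen = E1 | G nat

text \<open>Words form the free monoid on the letters, written additively as required for keys of
  \<^type>\<open>poly_mapping\<close>; its monoid algebra is the non-commutative polynomial ring.\<close>

datatype word = Word (letters: "gen list")

instantiation word :: monoid_add
begin
definition zero_word :: word where "0 = Word []"
definition plus_word :: "word \<Rightarrow> word \<Rightarrow> word" where
  "v + w = Word (letters v @ letters w)"
instance
  by standard (auto simp: zero_word_def plus_word_def)
end

type_synonym ncpoly = "word \<Rightarrow>\<^sub>0 laurent"

definition cscale :: "laurent \<Rightarrow> ncpoly \<Rightarrow> ncpoly" where
  "cscale c x = Poly_Mapping.single 0 c * x"

definition gvar :: "gen \<Rightarrow> ncpoly" where
  "gvar a = Poly_Mapping.single (Word [a]) 1"

text \<open>The elements \<open>g\<^sub>k\<close> and \<open>e\<^sub>k\<close>; both are meaningful for \<open>k \<ge> 1\<close> only.\<close>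

definition g_elt :: "nat \<Rightarrow> ncpoly" where
  "g_elt k = gvar (G (k - 1))"

definition e_elt :: "nat \<Rightarrow> ncpoly" where
  "e_elt k = (if k = 1 then gvar E1 else g_elt k + cscale hbar (g_elt (k - 1)))"

definition alphabet :: "ncpoly set" where
  "alphabet = {e_elt 1 - g_elt 1} \<union> {g_elt k | k. k \<ge> 1}"

definition z_module :: "ncpoly set" where
  "z_module = module.span cscale alphabet"

definition H0_hat :: "ncpoly set" where
  "H0_hat = module.span cscale
     {prod_list us | us. us \<in> lists alphabet \<and> (us \<noteq> [] \<longrightarrow> last us \<noteq> e_elt 1 - g_elt 1)}"

section \<open>The maps \<open>J\<^sub>\<omega>\<close> and \<open>Z\<^sub>\<omega>\<close>\<close>

text \<open>The action of \<open>\<C>\<close> on complex numbers: \<open>\<hbar>\<close> acts as \<open>2\<pi>i\<omega>\<close>.\<close>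

definition hval :: "real \<Rightarrow> laurent \<Rightarrow> complex" where
  "hval \<omega> c =
     (\<Sum>k\<in>Poly_Mapping.keys c. of_rat (Poly_Mapping.lookup c k) * (2 * pi * \<i> * \<omega>) powi k)"

definition C_linear_on :: "real \<Rightarrow> ncpoly set \<Rightarrow> (ncpoly \<Rightarrow> complex) \<Rightarrow> bool" where
  "C_linear_on \<omega> S f \<longleftrightarrow>
     (\<forall>x\<in>S. \<forall>y\<in>S. f (x + y) = f x + f y) \<and>
     (\<forall>c. \<forall>x\<in>S. f (cscale c x) = hval \<omega> c * f x)"

text \<open>
  Meromorphic functions are represented as total functions; at the poles \<open>t \<in> \<omega>\<^sup>-\<^sup>1\<int>\<close> the value below
  is \<open>0\<close> because of \<open>x / 0 = 0\<close>. The contours of integration do not meet these points.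
\<close>

definition is_J :: "real \<Rightarrow> (ncpoly \<Rightarrow> complex \<Rightarrow> complex) \<Rightarrow> bool" where
  "is_J \<omega> J \<longleftrightarrow>
     (\<forall>t. C_linear_on \<omega> z_module (\<lambda>x. J x t)) \<and>
     (\<forall>t. J (e_elt 1 - g_elt 1) t = 2 * pi * \<i> * \<omega>) \<and>
     (\<forall>k\<ge>1. \<forall>t. J (g_elt k) t =
        (2 * pi * \<i> * \<omega> * exp (2 * pi * \<i> * \<omega> * t) / (1 - exp (2 * pi * \<i> * \<omega> * t))) ^ k)"

text \<open>By \<open>is_J_J_map\<close> and \<open>is_J_unique\<close> below, \<open>J_map \<omega>\<close> is the unique such map on
  \<^const>\<open>z_module\<close>; its values elsewhere are irrelevant.\<close>

definition J_map :: "real \<Rightarrow> ncpoly \<Rightarrow> complex \<Rightarrow> complex" where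
  "J_map \<omega> = (SOME J. is_J \<omega> J)"

text \<open>
  The \<open>r\<close>-fold integral over \<open>-\<epsilon> + i\<real>\<close> for the word \<open>u\<^sub>1\<cdots>u\<^sub>r\<close>, with positions counted from \<open>0\<close>. The
  parametrisation \<open>t\<^sub>a = -\<epsilon> + i y\<^sub>a\<close> contributes \<open>dt\<^sub>a = i dy\<^sub>a\<close>.
\<close>

definition word_integral :: "real \<Rightarrow> real \<Rightarrow> ncpoly list \<Rightarrow> complex" where
  "word_integral \<omega> \<epsilon> us =
     (LINT y | Pi\<^sub>M {..<length us} (\<lambda>_. lborel).
        (\<Prod>a<length us. \<i> / (exp (2 * pi * \<i> * Complex (- \<epsilon>) (y a)) - 1)) *
        (\<Prod>a<length us. J_map \<omega> (us ! a) (\<Sum>b\<le>a. Complex (- \<epsilon>) (y b))))"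

text \<open>\<open>\<epsilon> r\<close> is the distance of the contours from the imaginary axis for words of length \<open>r\<close>.\<close>

definition is_Z :: "real \<Rightarrow> (nat \<Rightarrow> real) \<Rightarrow> (ncpoly \<Rightarrow> complex) \<Rightarrow> bool" where
  "is_Z \<omega> \<epsilon> Z \<longleftrightarrow>
     C_linear_on \<omega> H0_hat Z \<and>
     Z 1 = 1 \<and>
     (\<forall>us\<in>lists alphabet. us \<noteq> [] \<and> last us \<noteq> e_elt 1 - g_elt 1 \<longrightarrow>
        Z (prod_list us) = word_integral \<omega> (\<epsilon> (length us)) us)"

text \<open>By \<open>is_Z_Z_map\<close> and \<open>is_Z_unique\<close> below, \<open>Z_map \<omega> \<epsilon>\<close> is the unique such map on
  \<^const>\<open>H0_hat\<close>; its values elsewhere are irrelevant.\<close>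

definition Z_map :: "real \<Rightarrow> (nat \<Rightarrow> real) \<Rightarrow> ncpoly \<Rightarrow> complex" where
  "Z_map \<omega> \<epsilon> = (SOME Z. is_Z \<omega> \<epsilon> Z)"

definition fps_Arcsin :: "complex fps" where
  "fps_Arcsin = fps_expansion Arcsin 0"


section \<open>Well-definedness of \<open>J\<^sub>\<omega>\<close> and \<open>Z\<^sub>\<omega>\<close>\<close>

lemma module_cscale: "module cscale"
  by standard (simp_all add: cscale_def distrib_left distrib_right single_add mult_single
      flip: mult.assoc)

lemma poly_mapping_induct [case_names zero single add]:
  fixes p :: "'a \<Rightarrow>\<^sub>0 'b::comm_monoid_add"
  assumes "P 0" "\<And>k v. P (Poly_Mapping.single k v)" "\<And>p q. P p \<Longrightarrow> P q \<Longrightarrow> P (p + q)"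
  shows "P p"
proof (induction p rule: update_induct)
  case (update p a b)
  have "Poly_Mapping.update a b p = Poly_Mapping.single a b + p"
    using update(1)
    by (auto intro!: poly_mapping_eqI
        simp: lookup_update lookup_add lookup_single when_def in_keys_iff)
  then show ?case
    using assms(2,3) update.IH by metis
qed (use assms in auto)

lemma hval_0 [simp]: "hval \<omega> 0 = 0"
  by (simp add: hval_def)

lemma hval_add: "hval \<omega> (c + d) = hval \<omega> c + hval \<omega> d"
  unfolding hval_def by (rule setsum_keys_plus_distrib) (auto simp: of_rat_add algebra_simps)

lemma hval_single: "hval \<omega> (Poly_Mapping.single k q) = of_rat q * (2 * pi * \<i> * \<omega>) powi k"
  by (simp add: hval_def)

lemma hval_1 [simp]: "hval \<omega> 1 = 1"
  using hval_single[of \<omega> 0 1] by simp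

lemma hval_uminus: "hval \<omega> (- c) = - hval \<omega> c"
  using hval_add[of \<omega> c "- c"] by (simp add: eq_neg_iff_add_eq_0 add.commute)

lemma hval_mult:
  assumes "\<omega> \<noteq> 0"
  shows "hval \<omega> (c * d) = hval \<omega> c * hval \<omega> d"
proof (induction c rule: poly_mapping_induct)
  case (single k q)
  show ?case
    by (induction d rule: poly_mapping_induct)
      (use assms in \<open>auto simp: mult_single hval_single hval_add of_rat_mult power_int_add
        algebra_simps\<close>)
qed (auto simp: hval_add algebra_simps)

text \<open>For any prescribed values \<open>F us\<close> on the words in \<^const>\<open>alphabet\<close>, \<open>lift_words \<omega> F\<close> is the
  \<open>\<C>\<close>-linear functional attaining them: rewrite \<open>e\<^sub>1\<close> as \<open>(e\<^sub>1 - g\<^sub>1) + g\<^sub>1\<close> and expand.\<close>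

fun expand_word :: "gen list \<Rightarrow> (ncpoly list \<Rightarrow> complex) \<Rightarrow> complex" where
  "expand_word [] F = F []"
| "expand_word (G k # v) F = expand_word v (\<lambda>us. F (gvar (G k) # us))"
| "expand_word (E1 # v) F =
     expand_word v (\<lambda>us. F ((gvar E1 - gvar (G 0)) # us)) +
     expand_word v (\<lambda>us. F (gvar (G 0) # us))"

definition lift_words :: "real \<Rightarrow> (ncpoly list \<Rightarrow> complex) \<Rightarrow> ncpoly \<Rightarrow> complex" where
  "lift_words \<omega> F x =
     (\<Sum>w\<in>Poly_Mapping.keys x. hval \<omega> (Poly_Mapping.lookup x w) * expand_word (letters w) F)"

lemma lift_words_0 [simp]: "lift_words \<omega> F 0 = 0"
  by (simp add: lift_words_def)

lemma lift_words_add: "lift_words \<omega> F (x + y) = lift_words \<omega> F x + lift_words \<omega> F y"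
  unfolding lift_words_def
  by (rule setsum_keys_plus_distrib) (auto simp: hval_add algebra_simps)

lemma lift_words_diff: "lift_words \<omega> F (x - y) = lift_words \<omega> F x - lift_words \<omega> F y"
  using lift_words_add[of \<omega> F "x - y" y] by simp

lemma lift_words_single:
  "lift_words \<omega> F (Poly_Mapping.single w c) = hval \<omega> c * expand_word (letters w) F"
  by (simp add: lift_words_def)

lemma lift_words_cscale:
  assumes "\<omega> \<noteq> 0"
  shows "lift_words \<omega> F (cscale c x) = hval \<omega> c * lift_words \<omega> F x"
  by (induction x rule: poly_mapping_induct)
    (use assms in \<open>auto simp: cscale_def mult_single lift_words_single lift_words_add hval_mult
      algebra_simps\<close>)

lemma C_linear_on_lift_words: "\<omega> \<noteq> 0 \<Longrightarrow> C_linear_on \<omega> S (lift_words \<omega> F)"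
  by (simp add: C_linear_on_def lift_words_add lift_words_cscale)

lemma lift_words_gvar_G:
  "lift_words \<omega> F (gvar (G k) * x) = lift_words \<omega> (\<lambda>us. F (gvar (G k) # us)) x"
  by (induction x rule: poly_mapping_induct)
    (auto simp: gvar_def mult_single lift_words_single lift_words_add algebra_simps plus_word_def)

lemma lift_words_gvar_E1:
  "lift_words \<omega> F (gvar E1 * x) =
     lift_words \<omega> (\<lambda>us. F ((gvar E1 - gvar (G 0)) # us)) x +
     lift_words \<omega> (\<lambda>us. F (gvar (G 0) # us)) x"
  by (induction x rule: poly_mapping_induct)
    (auto simp: gvar_def mult_single lift_words_single lift_words_add algebra_simps plus_word_def)

lemma alphabet_cases:
  assumes "u \<in> alphabet"
  obtains "u = gvar E1 - gvar (G 0)" | k where "u = gvar (G k)"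
  using assms by (auto simp: alphabet_def e_elt_def g_elt_def)

lemma lift_words_prod_list:
  assumes "us \<in> lists alphabet"
  shows "lift_words \<omega> F (prod_list us) = F us"
  using assms
proof (induction us arbitrary: F)
  case Nil
  have "lift_words \<omega> F 1 = hval \<omega> 1 * expand_word (letters 0) F"
    using lift_words_single[of \<omega> F 0 1] by simp
  then show ?case by (simp add: zero_word_def)
next
  case (Cons u us)
  have IH: "lift_words \<omega> F (prod_list us) = F us" for F
    using Cons by auto
  have "u \<in> alphabet"
    using Cons by auto
  then show ?case
    by (cases rule: alphabet_cases)
      (auto simp: left_diff_distrib lift_words_diff lift_words_gvar_G lift_words_gvar_E1 IH)
qed

lemma gvar_eq_iff: "gvar a = gvar b \<longleftrightarrow> a = b"
  by (metis gvar_def keys_single zero_neq_one singleton_inject word.inject list.inject)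

lemma gvar_diff_neq: "gvar E1 - gvar (G 0) \<noteq> gvar (G k)"
proof
  assume "gvar E1 - gvar (G 0) = gvar (G k)"
  then have "Poly_Mapping.lookup (gvar E1 - gvar (G 0)) (Word [E1]) =
      Poly_Mapping.lookup (gvar (G k)) (Word [E1])"
    by simp
  then show False
    by (simp add: gvar_def lookup_minus lookup_single)
qed

lemma g_elt_eq_iff: "k \<ge> 1 \<Longrightarrow> l \<ge> 1 \<Longrightarrow> g_elt k = g_elt l \<longleftrightarrow> k = l"
  by (auto simp: g_elt_def gvar_eq_iff)

lemma ex_is_J:
  assumes "\<omega> \<noteq> 0"
  shows "\<exists>J. is_J \<omega> J"
proof -
  define v where "v = (\<lambda>t u. if u = e_elt 1 - g_elt 1 then 2 * pi * \<i> * \<omega> else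
    (2 * pi * \<i> * \<omega> * exp (2 * pi * \<i> * \<omega> * t) / (1 - exp (2 * pi * \<i> * \<omega> * t))) ^
      (THE k. k \<ge> 1 \<and> u = g_elt k))"
  define J where "J = (\<lambda>x t. lift_words \<omega> (\<lambda>us. v t (hd us)) x)"
  have J: "J u t = v t u" if "u \<in> alphabet" for u t
    using lift_words_prod_list[of "[u]"] that by (simp add: J_def)
  have "(THE l. l \<ge> 1 \<and> g_elt k = g_elt l) = k" if "k \<ge> 1" for k
    by (rule the_equality) (use that g_elt_eq_iff in auto)
  moreover have "g_elt k \<noteq> e_elt 1 - g_elt 1" for k
    using gvar_diff_neq[of "k - 1"] by (auto simp: g_elt_def e_elt_def)
  moreover have "g_elt k \<in> alphabet" if "k \<ge> 1" for k
    using that by (auto simp: alphabet_def)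
  moreover have "e_elt 1 - g_elt 1 \<in> alphabet"
    by (auto simp: alphabet_def)
  ultimately have "is_J \<omega> J"
    unfolding is_J_def using assms
    by (auto simp: J v_def) (auto simp: J_def C_linear_on_lift_words)
  then show ?thesis by blast
qed

lemma is_J_J_map: "\<omega> \<noteq> 0 \<Longrightarrow> is_J \<omega> (J_map \<omega>)"
  unfolding J_map_def using ex_is_J someI_ex by metis

lemma ex_is_Z:
  assumes "\<omega> \<noteq> 0"
  shows "\<exists>Z. is_Z \<omega> \<epsilon> Z"
proof -
  define Z where
    "Z = lift_words \<omega> (\<lambda>us. if us = [] then 1 else word_integral \<omega> (\<epsilon> (length us)) us)"
  have "is_Z \<omega> \<epsilon> Z"
    unfolding is_Z_def Z_def
    using assms lift_words_prod_list[of "[]" \<omega>]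
    by (auto simp: C_linear_on_lift_words lift_words_prod_list)
  then show ?thesis by blast
qed

lemma is_Z_Z_map: "\<omega> \<noteq> 0 \<Longrightarrow> is_Z \<omega> \<epsilon> (Z_map \<omega> \<epsilon>)"
  unfolding Z_map_def using ex_is_Z someI_ex by metis

lemma C_linear_on_span_unique:
  assumes f: "C_linear_on \<omega> (module.span cscale B) f"
    and g: "C_linear_on \<omega> (module.span cscale B) g"
    and eq: "\<And>b. b \<in> B \<Longrightarrow> f b = g b" and x: "x \<in> module.span cscale B"
  shows "f x = g x"
proof -
  interpret module cscale by (rule module_cscale)
  have 0: "f 0 = 0" "g 0 = 0"
    using f g span_zero[of B] unfolding C_linear_on_def by (metis add_cancel_right_left add_0)+
  have "x \<in> span B \<and> f x = g x"
    using x
  proof (induction rule: span_induct_alt)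
    case (step c b y)
    have b: "b \<in> span B" "cscale c b \<in> span B"
      using step(1) span_base span_scale by blast+
    have lin: "h (cscale c b + y) = hval \<omega> c * h b + h y" if "C_linear_on \<omega> (span B) h" for h
      using that b step(2) unfolding C_linear_on_def by simp
    then show ?case
      using eq step b(2) by (simp add: lin[OF f] lin[OF g] span_add)
  qed (use 0 span_zero in auto)
  then show ?thesis by blast
qed

lemma is_J_unique:
  assumes "is_J \<omega> J" "is_J \<omega> J'" "x \<in> z_module"
  shows "J x t = J' x t"
proof -
  have "J u t = J' u t" if "u \<in> alphabet" for u
    using assms(1,2) that unfolding is_J_def alphabet_def by auto
  then show ?thesis
    using C_linear_on_span_unique[of \<omega> alphabet "\<lambda>x. J x t" "\<lambda>x. J' x t" x] assms
    unfolding is_J_def z_module_def by blast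
qed

lemma is_Z_unique:
  assumes Z: "is_Z \<omega> \<epsilon> Z" and Z': "is_Z \<omega> \<epsilon> Z'" and x: "x \<in> H0_hat"
  shows "Z x = Z' x"
proof (rule C_linear_on_span_unique[OF _ _ _ x[unfolded H0_hat_def]])
  fix b
  assume "b \<in> {prod_list us | us. us \<in> lists alphabet \<and>
    (us \<noteq> [] \<longrightarrow> last us \<noteq> e_elt 1 - g_elt 1)}"
  then obtain us where b: "b = prod_list us" and us: "us \<in> lists alphabet"
    and last: "us \<noteq> [] \<longrightarrow> last us \<noteq> e_elt 1 - g_elt 1"
    by blast
  show "Z b = Z' b"
  proof (cases "us = []")
    case True
    then show ?thesis using Z Z' by (simp add: is_Z_def b)
  next
    case False
    then have "Z b = word_integral \<omega> (\<epsilon> (length us)) us"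
      and "Z' b = word_integral \<omega> (\<epsilon> (length us)) us"
      using Z Z' us last unfolding is_Z_def b by blast+
    then show ?thesis by simp
  qed
qed (use Z Z' in \<open>unfold is_Z_def H0_hat_def, blast+\<close>)

end

theory Submission
  imports Defs
begin

unbundle no vec_syntax

text \<open>
  Write \<open>w(s) = J\<^sub>\<omega>(e\<^sub>2 | s) = (\<pi>\<omega> / sin (\<pi>\<omega>s))\<^sup>2\<close>. In the variables \<open>s\<^sub>a = t\<^sub>1 + \<dots> + t\<^sub>a\<close> the integral
  \<open>Z\<^sub>\<omega>(e\<^sub>2\<^sup>r)\<close> is the \<open>r\<close>-th iterate of the operator
  \<open>(T f)(s) = \<integral> w(z) f(z) dz / (exp (2\<pi>\<i>(z - s)) - 1)\<close>, applied to \<open>1\<close> and evaluated at \<open>0\<close>. By the residue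
  theorem \<open>T f\<close> is the unique decaying solution \<open>g\<close> of \<open>g(s + 1) - g(s) = w(s) f(s)\<close>. So the generating
  series \<open>G(s)\<close> of the iterates is the solution of \<open>G(s + 1) = (1 + X\<^sup>2 w(s)) G(s)\<close>, which is the exponential
  of \<open>\<Sum> (-1)\<^sup>k\<^sup>-\<^sup>1 X\<^sup>2\<^sup>k c\<^sub>k(s) / k\<close> with \<open>c\<^sub>k(s) = \<integral> w(z)\<^sup>k dz / (exp (2\<pi>\<i>(z - s)) - 1)\<close>. At \<open>s = 0\<close> the
  kernel is \<open>-1/2\<close> plus an odd function while \<open>w\<close> is even, hence \<open>c\<^sub>k(0)\<close> is a residue at \<open>0\<close> plus an integral
  of \<open>w\<^sup>k\<close>, and both are coefficients of explicit series in \<open>arcsin (\<pi>\<i>\<omega>X)\<close>.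
\<close>

section \<open>Integrals along vertical lines\<close>

text \<open>Decay is one-sided throughout. The kernel tends to 0 at the lower end of a vertical line
  and to -1 at the upper end, so T f vanishes as Im s \<rightarrow> \<infinity> but tends to minus
  the integral of w f as Im s \<rightarrow> -\<infinity>. The bound C / (1 + exp (\<beta> Im s))
  records this, and it suffices: in g(z) kern(z - s) the factor g decays upwards and the kernel
  downwards. Uniqueness then takes an explicit form without a Liouville argument: a function with
  this decay is recovered from its difference g(z + 1) - g(z) by an integral. The iterates are not
  estimated by iterating T. They are defined as coefficients of the exponential, hence as
  polynomials in the c_k, from which they inherit holomorphy and bounds; the difference equation
  then identifies them with the iterated integrals. The strip -1/\<omega> < Re s < 1 is forced by
  three demands: the partial sums run on the lines Re = -a \<epsilon> inside (-1/\<omega>, 0), where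
  w is holomorphic; s + 1 must be admissible for every such s; and the evaluation takes place at
  0.\<close>

definition vint :: "real \<Rightarrow> (complex \<Rightarrow> complex) \<Rightarrow> complex" where
  "vint c f = \<i> * (LINT y | lborel. f (Complex c y))"

definition vintegrable :: "real \<Rightarrow> (complex \<Rightarrow> complex) \<Rightarrow> bool" where
  "vintegrable c f \<longleftrightarrow> integrable lborel (\<lambda>y. f (Complex c y))"

lemma integral_symmetric_interval:
  fixes f :: "real \<Rightarrow> 'a::euclidean_space"
  assumes "integrable lborel f"
  shows "integral {-N..N} f = (LINT y | lborel. indicator {-N..N} y *\<^sub>R f y)"
    "integrable lborel (\<lambda>y. indicator {-N..N} y *\<^sub>R f y)"
proof -
  show int: "integrable lborel (\<lambda>y. indicator {-N..N} y *\<^sub>R f y)"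
    using integrable_mult_indicator[OF _ assms, of "{-N..N}"] by simp
  then have "set_integrable lborel {-N..N} f" by (simp add: set_integrable_def)
  from set_borel_integral_eq_integral(2)[OF this]
  show "integral {-N..N} f = (LINT y | lborel. indicator {-N..N} y *\<^sub>R f y)"
    by (simp add: set_lebesgue_integral_def)
qed

text \<open>Contour integrals along segments and the fundamental theorem of calculus yield integrals
  over bounded intervals; dominated convergence passes from them to the Lebesgue integral over the
  line.\<close>

lemma tendsto_integral_symmetric_interval:
  fixes f :: "real \<Rightarrow> 'a::euclidean_space"
  assumes "integrable lborel f"
  shows "((\<lambda>N. integral {-N..N} f) \<longlongrightarrow> (LINT y | lborel. f y)) at_top"
proof -
  have "((\<lambda>N. LINT y | lborel. indicator {-N..N} y *\<^sub>R f y) \<longlongrightarrow> (LINT y | lborel. f y)) at_top"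
  proof (rule integral_dominated_convergence_at_top[where w = "\<lambda>y. norm (f y)"])
    show "AE y in lborel. ((\<lambda>N. indicator {-N..N} y *\<^sub>R f y) \<longlongrightarrow> f y) at_top"
    proof (rule AE_I2, rule tendsto_eventually)
      fix y :: real
      show "eventually (\<lambda>N. indicator {-N..N} y *\<^sub>R f y = f y) at_top"
        using eventually_ge_at_top[of "\<bar>y\<bar>"] by eventually_elim (auto simp: indicator_def)
    qed
  qed (use assms in \<open>auto simp: indicator_def split: if_splits intro!: always_eventually\<close>)
  then show ?thesis using integral_symmetric_interval(1)[OF assms] by simp
qed

text \<open>The right-hand side depends on the majorant \<open>h\<close> only, so the truncation
  error is uniform in any parameter of \<open>f\<close>. This makes the limit in
  \<open>holomorphic_on_vint\<close> locally uniform.\<close>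

lemma integral_tail_bound:
  fixes f :: "real \<Rightarrow> complex" and h :: "real \<Rightarrow> real"
  assumes "integrable lborel f" "integrable lborel h" "\<And>y. norm (f y) \<le> h y"
  shows "norm ((LINT y | lborel. f y) - integral {-N..N} f) \<le> (LINT y | lborel. h y) - integral {-N..N} h"
proof -
  note f = integral_symmetric_interval[OF assms(1), of N]
  note h = integral_symmetric_interval[OF assms(2), of N]
  have "(LINT y | lborel. f y) - integral {-N..N} f =
      (LINT y | lborel. f y - indicator {-N..N} y *\<^sub>R f y)"
    using f assms by (simp add: Bochner_Integration.integral_diff)
  also have "norm \<dots> \<le> (LINT y | lborel. h y - indicator {-N..N} y *\<^sub>R h y)"
    using assms f h
    by (intro Bochner_Integration.integral_norm_bound_integral Bochner_Integration.integrable_diff)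
      (auto simp: indicator_def)
  also have "\<dots> = (LINT y | lborel. h y) - integral {-N..N} h"
    using h assms by (simp add: Bochner_Integration.integral_diff)
  finally show ?thesis .
qed

text \<open>Residue theorem on the rectangle with vertical sides on \<open>c1\<close> and
  \<open>c2\<close> and horizontal sides at height N and -N, then N \<rightarrow> \<infinity>. The
  wider strip from \<open>l\<close> to \<open>u\<close> supplies an open set around the rectangle,
  and \<open>lim\<close> removes the horizontal sides.\<close>

lemma vint_diff_eq_residues:
  assumes c: "l < c1" "c1 < c2" "c2 < u" and "finite P"
    and P: "\<And>p. p \<in> P \<Longrightarrow> c1 < Re p \<and> Re p < c2"
    and hol: "f holomorphic_on {s. l < Re s \<and> Re s < u} - P"
    and int: "vintegrable c1 f" "vintegrable c2 f"
    and lim: "\<And>e. e > 0 \<Longrightarrow> \<exists>N. \<forall>s. c1 \<le> Re s \<and> Re s \<le> c2 \<and> \<bar>Im s\<bar> \<ge> N \<longrightarrow> norm (f s) \<le> e"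
  shows "vint c2 f - vint c1 f = 2 * pi * \<i> * (\<Sum>p\<in>P. residue f p)"
proof -
  define R where "R = 2 * pi * \<i> * (\<Sum>p\<in>P. residue f p)"
  define U where "U = {s. l < Re s \<and> Re s < u}"
  \<comment> \<open>From this height on the rectangle encloses every pole, so all winding numbers
    are 1.\<close>
  obtain N0 where N0: "N0 > 0" "\<And>p. p \<in> P \<Longrightarrow> \<bar>Im p\<bar> < N0"
  proof -
    have "bounded (Im ` P)" using \<open>finite P\<close> by (simp add: finite_imp_bounded)
    then obtain B where "B > 0" "\<forall>x\<in>Im ` P. norm x \<le> B" unfolding bounded_pos by blast
    then show ?thesis by (intro that[of "B + 1"]) force+
  qed
  have U: "open U" "connected U"
  proof -
    have "U = {s. Re s > l} \<inter> {s. Re s < u}" by (auto simp: U_def)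
    then show "open U" "connected U"
      by (auto intro!: open_Int open_halfspace_Re_gt open_halfspace_Re_lt
        convex_connected convex_Int convex_halfspace_Re_gt convex_halfspace_Re_lt)
  qed
  have cont: "continuous_on (U - P) f"
    using hol by (auto simp: U_def intro: holomorphic_on_imp_continuous_on)
  define V where "V = (\<lambda>c N. \<i> * integral {-N..N} (\<lambda>y. f (Complex c y)))"
  \<comment> \<open>The error comes from the two horizontal sides, each of length
    \<open>c2 - c1\<close>, on which \<open>f\<close> is bounded by \<open>e\<close>.\<close>
  have key: "norm (V c2 N - V c1 N - R) \<le> 2 * e * (c2 - c1)"
    if N: "N \<ge> N0" and e: "\<And>s. c1 \<le> Re s \<Longrightarrow> Re s \<le> c2 \<Longrightarrow> \<bar>Im s\<bar> \<ge> N \<Longrightarrow> norm (f s) \<le> e"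
    for N e
  proof -
    have Npos: "N > 0" using N N0 by simp
    define a b where "a = Complex c1 (-N)" and "b = Complex c2 N"
    define a' b' where "a' = Complex c2 (-N)" and "b' = Complex c1 N"
    have subU: "cbox a b \<subseteq> U"
      using c by (auto simp: a_def b_def U_def in_cbox_complex_iff)
    have Pbox: "p \<in> box a b" if "p \<in> P" for p
      using P[OF that] N0(2)[OF that] N by (auto simp: a_def b_def in_box_complex_iff)
    have img: "path_image (rectpath a b) \<subseteq> U - P"
      using subU Pbox path_image_rectpath_cbox_minus_box[of a b] c Npos
      by (auto simp: a_def b_def)
    have imgs: "path_image (rectpath a b) = closed_segment a a' \<union> closed_segment a' b \<union>
        closed_segment b b' \<union> closed_segment b' a"
      by (simp_all add: rectpath_def Let_def path_image_join a_def b_def a'_def b'_def Un_assoc)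
    have ci: "f contour_integrable_on linepath x y" if "closed_segment x y \<subseteq> U - P" for x y
      using cont continuous_on_subset that by (intro contour_integrable_continuous_linepath) blast
    have ints: "f contour_integrable_on linepath a a'" "f contour_integrable_on linepath a' b"
      "f contour_integrable_on linepath b b'" "f contour_integrable_on linepath b' a"
      "f contour_integrable_on linepath b' b" "f contour_integrable_on linepath a b'"
      using img imgs by (auto intro!: ci simp: closed_segment_commute)
    have "contour_integral (rectpath a b) f =
        2 * pi * \<i> * (\<Sum>p\<in>P. winding_number (rectpath a b) p * residue f p)"
    proof (rule Residue_theorem[OF U \<open>finite P\<close> _ _ _ img])
      show "\<forall>z. z \<notin> U \<longrightarrow> winding_number (rectpath a b) z = 0"
        using subU c Npos by (intro allI impI winding_number_rectpath_outside)
          (auto simp: a_def b_def)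
    qed (use hol in \<open>auto simp: U_def\<close>)
    also have "\<dots> = R"
      unfolding R_def by (intro arg_cong2[of _ _ _ _ "(*)"] sum.cong refl)
        (simp add: winding_number_rectpath Pbox)
    finally have 1: "contour_integral (rectpath a b) f = R" .
    have 2: "contour_integral (rectpath a b) f =
        contour_integral (linepath a a') f + contour_integral (linepath a' b) f +
        contour_integral (linepath b b') f + contour_integral (linepath b' a) f"
      using ints by (simp add: rectpath_def Let_def a'_def[symmetric] b'_def[symmetric]
        a_def b_def contour_integrable_joinI)
    have 3: "contour_integral (linepath a' b) f = V c2 N"
      unfolding V_def using Npos
      by (intro contour_integral_linepath_same_Re) (auto simp: a'_def b_def)
    have "contour_integral (linepath a b') f = V c1 N"
      unfolding V_def using Npos
      by (intro contour_integral_linepath_same_Re) (auto simp: a_def b'_def)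
    then have 4: "contour_integral (linepath b' a) f = - V c1 N"
      using contour_integral_reverse_linepath[of b' a f] img imgs continuous_on_subset[OF cont]
      by (metis (no_types, lifting) Un_subset_iff contour_integral_reversepath
          reversepath_linepath valid_path_linepath)
    have e0: "e \<ge> 0" using e[of b] c Npos order_trans[OF norm_ge_zero] by (simp add: b_def)
    have 5: "norm (contour_integral (linepath a a') f) \<le> e * norm (a' - a)"
      using e0 ints(1) c Npos
      by (intro contour_integral_bound_linepath e)
        (auto simp: a_def a'_def closed_segment_same_Im closed_segment_eq_real_ivl)
    have 6: "norm (contour_integral (linepath b b') f) \<le> e * norm (b' - b)"
      using e0 ints(3) c Npos
      by (intro contour_integral_bound_linepath e)
        (auto simp: b_def b'_def closed_segment_same_Im closed_segment_eq_real_ivl)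
    have 7: "norm (a' - a) = c2 - c1" "norm (b' - b) = c2 - c1"
      using c by (auto simp: a_def a'_def b_def b'_def cmod_def)
    have "V c2 N - V c1 N - R =
        - (contour_integral (linepath a a') f + contour_integral (linepath b b') f)"
      using 1 2 3 4 by (simp add: algebra_simps)
    also have "norm \<dots> \<le> e * (c2 - c1) + e * (c2 - c1)"
      unfolding norm_minus_cancel using 5 6 7 by (intro order_trans[OF norm_triangle_ineq]) auto
    finally show ?thesis by simp
  qed
  have "((\<lambda>N. V c2 N - V c1 N - R) \<longlongrightarrow> vint c2 f - vint c1 f - R) at_top"
    unfolding V_def vint_def using int unfolding vintegrable_def
    by (intro tendsto_intros tendsto_integral_symmetric_interval)
  moreover have "((\<lambda>N. V c2 N - V c1 N - R) \<longlongrightarrow> 0) at_top"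
  proof (rule tendstoI)
    fix \<epsilon> :: real assume "\<epsilon> > 0"
    \<comment> \<open>Makes the error \<open>2 * e * (c2 - c1)\<close> equal to half of
      \<epsilon>.\<close>
    define e where "e = \<epsilon> / (4 * (c2 - c1))"
    have "e > 0" using \<open>\<epsilon> > 0\<close> c by (simp add: e_def)
    from lim[OF this] obtain N1 where N1:
      "\<forall>s. c1 \<le> Re s \<and> Re s \<le> c2 \<and> N1 \<le> \<bar>Im s\<bar> \<longrightarrow> norm (f s) \<le> e" by blast
    have "2 * e * (c2 - c1) < \<epsilon>" using \<open>\<epsilon> > 0\<close> c by (simp add: e_def divide_simps)
    then have "dist (V c2 N - V c1 N - R) 0 < \<epsilon>" if "N \<ge> max N0 N1" for N
      using key[of N e] N1 that by (force simp: dist_norm)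
    then show "eventually (\<lambda>N. dist (V c2 N - V c1 N - R) 0 < \<epsilon>) at_top"
      using eventually_at_top_linorder by blast
  qed
  ultimately have "vint c2 f - vint c1 f - R = 0"
    by (rule tendsto_unique[rotated]) simp
  then show ?thesis by (simp add: R_def)
qed

section \<open>The kernel 1 / (exp (2 pi \<i> t) - 1): growth, poles and residues\<close>

definition kern :: "complex \<Rightarrow> complex" where
  "kern t = 1 / (exp (2 * pi * \<i> * t) - 1)"

lemma measurable_kern [measurable]: "kern \<in> borel_measurable borel"
  unfolding kern_def by measurable

lemma measurable_Complex [measurable]: "Complex c \<in> borel_measurable borel"
  unfolding Complex_eq by measurable

lemma kern_plus_1 [simp]: "kern (t + 1) = kern t"
  by (simp add: kern_def algebra_simps exp_add)

lemma kern_minus_1 [simp]: "kern (t - 1) = kern t"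
  using kern_plus_1[of "t - 1"] by simp

lemma exp_2pi_i_eq_1_iff: "exp (2 * pi * \<i> * t) = 1 \<longleftrightarrow> t \<in> \<int>"
proof -
  have "exp (2 * pi * \<i> * t) = 1 \<longleftrightarrow> Im t = 0 \<and> (\<exists>n::int. Re t = n)"
    unfolding exp_eq_1 by (simp add: mult.assoc)
  also have "\<dots> \<longleftrightarrow> (\<exists>n::int. t = of_int n)"
    by (auto simp: complex_eq_iff)
  finally show ?thesis by (auto elim: Ints_cases)
qed

lemma not_Ints_if_Re: "Re t \<notin> \<int> \<Longrightarrow> t \<notin> \<int>"
  by (auto elim!: Ints_cases)

lemma not_Ints_between: "real_of_int n < x \<Longrightarrow> x < real_of_int n + 1 \<Longrightarrow> x \<notin> \<int>"
  by (auto elim!: Ints_cases)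

text \<open>With E = |exp (2 pi \<i> t)| and \<sigma> = sin^2 (pi Re t), the identity |exp (2 pi
  \<i> t) - 1|^2 = \<sigma> (1 + E)^2 + (1 - \<sigma>) (1 - E)^2 has a nonnegative second summand.
  Keeping the factor 1 + E preserves the decay at the lower end of a line.\<close>

lemma norm_kern_le_sin:
  assumes "Re t \<notin> \<int>"
  shows "norm (kern t) \<le> 1 / \<bar>sin (pi * Re t)\<bar> / (1 + exp (- (2 * pi * Im t)))"
proof -
  define E where "E = exp (- (2 * pi * Im t))"
  define \<sigma> where "\<sigma> = (sin (pi * Re t))\<^sup>2"
  have E: "E > 0" by (simp add: E_def)
  have sin: "sin (pi * Re t) \<noteq> 0"
    using assms sin_times_pi_eq_0[of "Re t"] by (simp add: mult.commute)
  have cos: "cos (2 * pi * Re t) = 1 - 2 * \<sigma>"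
    using cos_double_sin[of "pi * Re t"] by (simp add: \<sigma>_def mult.assoc)
  have "(sin (2 * pi * Re t))\<^sup>2 = 1 - (1 - 2 * \<sigma>)\<^sup>2"
    unfolding cos[symmetric] by (simp add: sin_squared_eq)
  then have "(norm (exp (2 * pi * \<i> * t) - 1))\<^sup>2 = (E * (1 - 2 * \<sigma>) - 1)\<^sup>2 + E\<^sup>2 * (1 - (1 - 2 * \<sigma>)\<^sup>2)"
    by (simp add: cmod_power2 Re_exp Im_exp cos power_mult_distrib flip: E_def)
  also have "\<dots> = (\<bar>sin (pi * Re t)\<bar> * (1 + E))\<^sup>2 + (1 - \<sigma>) * (1 - E)\<^sup>2"
    by (simp add: \<sigma>_def[symmetric] power_mult_distrib) (simp add: power2_eq_square algebra_simps)
  also have "\<dots> \<ge> (\<bar>sin (pi * Re t)\<bar> * (1 + E))\<^sup>2"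
    by (simp add: \<sigma>_def abs_square_le_1)
  finally have "norm (exp (2 * pi * \<i> * t) - 1) \<ge> \<bar>sin (pi * Re t)\<bar> * (1 + E)"
    by (rule power2_le_imp_le) simp
  moreover have "\<bar>sin (pi * Re t)\<bar> * (1 + E) > 0" using sin E by simp
  ultimately have "1 / norm (exp (2 * pi * \<i> * t) - 1) \<le> 1 / (\<bar>sin (pi * Re t)\<bar> * (1 + E))"
    by (intro divide_left_mono) (auto intro: mult_pos_pos less_le_trans)
  then show ?thesis by (simp add: kern_def norm_divide flip: E_def)
qed

text \<open>Valid above and below the poles too, where the horizontal sides of rectangles have to
  pass. As \<open>exp (2 * pi)\<close> is at least 3, the modulus E of the exponential is at most
  1/3 or at least 3, whence |E - 1| \<ge> (1 + E) / 2.\<close>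

lemma norm_kern_le_far:
  assumes "\<bar>Im t\<bar> \<ge> 1"
  shows "norm (kern t) \<le> 2 / (1 + exp (- (2 * pi * Im t)))"
proof -
  define E where "E = exp (- (2 * pi * Im t))"
  have "E > 0" by (simp add: E_def)
  have e3: "exp (2 * pi) \<ge> 3" using exp_ge_add_one_self[of "2 * pi"] pi_gt3 by linarith
  have "norm (exp (2 * pi * \<i> * t) - 1) \<ge> \<bar>E - 1\<bar>"
    using norm_triangle_ineq3[of "exp (2 * pi * \<i> * t)" 1] by (simp add: E_def)
  moreover have "\<bar>E - 1\<bar> \<ge> (1 + E) / 2"
  proof (cases "Im t \<ge> 1")
    case True
    have "E * exp (2 * pi * Im t) = 1" by (simp add: E_def flip: exp_add)
    moreover have "exp (2 * pi) \<le> exp (2 * pi * Im t)" using True by simp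
    ultimately have "E * 3 \<le> 1"
      using e3 mult_left_mono[of 3 "exp (2 * pi * Im t)" E] \<open>E > 0\<close> by linarith
    then show ?thesis by (simp add: abs_if)
  next
    case False
    then have "exp (2 * pi) \<le> E" using assms mult_left_mono[of 1 "- Im t" "2 * pi"]
      by (simp add: E_def)
    then show ?thesis using e3 by (simp add: abs_if)
  qed
  ultimately have "1 / norm (exp (2 * pi * \<i> * t) - 1) \<le> 1 / ((1 + E) / 2)"
    using \<open>E > 0\<close> by (intro divide_left_mono) (auto intro!: mult_pos_pos)
  then show ?thesis by (simp add: kern_def norm_divide flip: E_def)
qed

text \<open>On a compact interval free of integers |sin (pi x)| has a positive minimum, which makes
  the constant of \<open>norm_kern_le_sin\<close> uniform.\<close>

lemma kern_bound:
  assumes "\<And>x. a \<le> x \<Longrightarrow> x \<le> b \<Longrightarrow> x \<notin> \<int>"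
  obtains C where "C > 0"
    "\<And>t. a \<le> Re t \<Longrightarrow> Re t \<le> b \<Longrightarrow> norm (kern t) \<le> C / (1 + exp (- (2 * pi * Im t)))"
proof (cases "a \<le> b")
  case True
  obtain x0 where x0: "x0 \<in> {a..b}" "\<And>x. x \<in> {a..b} \<Longrightarrow> \<bar>sin (pi * x0)\<bar> \<le> \<bar>sin (pi * x)\<bar>"
    using continuous_attains_inf[of "{a..b}" "\<lambda>x. \<bar>sin (pi * x)\<bar>"] True
    by (force intro!: continuous_intros)
  have pos: "\<bar>sin (pi * x)\<bar> > 0" if "x \<in> {a..b}" for x
    using assms that sin_times_pi_eq_0[of x] by (simp add: mult.commute)
  show ?thesis
  proof (rule that[of "1 / \<bar>sin (pi * x0)\<bar>"])
    fix t assume t: "a \<le> Re t" "Re t \<le> b"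
    have "norm (kern t) \<le> 1 / \<bar>sin (pi * Re t)\<bar> / (1 + exp (- (2 * pi * Im t)))"
      using assms t by (intro norm_kern_le_sin) auto
    also have "\<dots> \<le> 1 / \<bar>sin (pi * x0)\<bar> / (1 + exp (- (2 * pi * Im t)))"
      using x0 pos t by (intro divide_right_mono divide_left_mono mult_pos_pos)
        (auto intro: add_nonneg_nonneg)
    finally show "norm (kern t) \<le> \<dots>" .
  qed (use pos x0 in auto)
qed (use that[of 1] in auto)

lemma holomorphic_on_kern [holomorphic_intros]:
  assumes "f holomorphic_on S" "\<And>s. s \<in> S \<Longrightarrow> f s \<notin> \<int>"
  shows "(\<lambda>s. kern (f s)) holomorphic_on S"
  unfolding kern_def using assms exp_2pi_i_eq_1_iff by (auto intro!: holomorphic_intros)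

lemma kern_uminus: "t \<notin> \<int> \<Longrightarrow> kern (- t) = - 1 - kern t"
  using exp_2pi_i_eq_1_iff[of t] exp_2pi_i_eq_1_iff[of "- t"]
  by (simp add: kern_def exp_minus field_simps)

text \<open>The pole is simple, as exp (2 pi \<i> (z - s)) - 1 has derivative 2 pi \<i> at
  \<open>s\<close>. The denominator cancels the factor of the residue theorem, so crossing
  \<open>s\<close> changes an integral by exactly \<open>f s\<close>.\<close>

lemma residue_kern:
  assumes "open S" "s \<in> S" "f holomorphic_on S"
  shows "residue (\<lambda>z. f z * kern (z - s)) s = f s / (2 * pi * \<i>)"
proof -
  have deriv: "((\<lambda>z. exp (2 * pi * \<i> * (z - s)) - 1) has_field_derivative 2 * pi * \<i>) (at s)"
    by (auto intro!: derivative_eq_intros)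
  then have "((\<lambda>z. (exp (2 * pi * \<i> * (z - s)) - 1) / (z - s)) \<longlongrightarrow> 2 * pi * \<i>) (at s)"
    by (simp add: has_field_derivative_iff)
  then have "((\<lambda>z. f z / ((exp (2 * pi * \<i> * (z - s)) - 1) / (z - s))) \<longlongrightarrow> f s / (2 * pi * \<i>)) (at s)"
    using assms continuous_on_eq_continuous_at[of S f] holomorphic_on_imp_continuous_on[of f S]
    by (intro tendsto_divide) (auto simp: isCont_def)
  then have lim: "((\<lambda>z. f z * kern (z - s) * (z - s)) \<longlongrightarrow> f s / (2 * pi * \<i>)) (at s)"
    by (simp add: kern_def)
  obtain r where r: "r > 0" "ball s r \<subseteq> S" using assms(1,2) openE by blast
  \<comment> \<open>The radius is at most 1, so that none of the other poles s + n is met.\<close>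
  define S' where "S' = ball s (min r 1)"
  have notint: "z - s \<notin> \<int>" if "z \<in> S' - {s}" for z
  proof
    assume "z - s \<in> \<int>"
    then obtain n :: int where n: "z - s = of_int n" by (auto elim: Ints_cases)
    have "norm (z - s) < 1" using that by (auto simp: S'_def dist_norm norm_minus_commute)
    then have "n = 0" by (simp add: n)
    then show False using that n by simp
  qed
  have "S' \<subseteq> S" using r by (auto simp: S'_def)
  then show ?thesis
    using r notint assms(3)
    by (intro residue_simple'[OF _ _ _ lim, of S'] holomorphic_intros)
      (auto simp: S'_def intro: holomorphic_on_subset)
qed

lemma integrable_exp_minus_abs:
  assumes "a > 0"
  shows "integrable lborel (\<lambda>y::real. exp (- (a * \<bar>y\<bar>)))"
proof -
  have 1: "(\<lambda>y::real. exp (- (a * \<bar>y\<bar>))) absolutely_integrable_on {0..}"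
  proof (rule nonnegative_absolutely_integrable_1)
    have "(\<lambda>y::real. exp (- a * y)) integrable_on {0..}"
      using integrable_on_exp_minus_to_infinity assms by blast
    then show "(\<lambda>y::real. exp (- (a * \<bar>y\<bar>))) integrable_on {0..}"
      by (rule integrable_eq) auto
  qed auto
  then have 2: "integrable lborel (\<lambda>y::real. indicator {0..} y *\<^sub>R exp (- (a * \<bar>y\<bar>)))"
    unfolding set_integrable_def by (subst (asm) integrable_completion) auto
  from lborel_integrable_real_affine[OF this, of "-1" 0]
  have 3: "integrable lborel (\<lambda>y::real. indicator {0..} (- y) *\<^sub>R exp (- (a * \<bar>y\<bar>)))"
    by simp
  show ?thesis
    by (rule Bochner_Integration.integrable_bound[OF Bochner_Integration.integrable_add[OF 2 3]])
      (auto simp: indicator_def)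
qed

lemma integrable_exp_bound:
  fixes f :: "real \<Rightarrow> complex"
  assumes "a > 0" "f \<in> borel_measurable borel" "\<And>y. norm (f y) \<le> C * exp (- (a * \<bar>y\<bar>))"
  shows "integrable lborel f"
proof (rule Bochner_Integration.integrable_bound[of lborel "\<lambda>y. C * exp (- (a * \<bar>y\<bar>))"])
  show "AE x in lborel. norm (f x) \<le> norm (C * exp (- (a * \<bar>x\<bar>)))"
    using assms(3) by (auto intro: order_trans[OF _ abs_ge_self])
qed (use assms integrable_exp_minus_abs in auto)

section \<open>A Cauchy transform on a vertical strip\<close>

definition vstrip :: "real \<Rightarrow> real \<Rightarrow> complex set" where
  "vstrip l u = {s. l < Re s \<and> Re s < u}"

lemma open_vstrip [simp, intro]: "open (vstrip l u)"
proof -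
  have "vstrip l u = {s. Re s > l} \<inter> {s. Re s < u}" by (auto simp: vstrip_def)
  then show ?thesis by (auto intro!: open_Int open_halfspace_Re_gt open_halfspace_Re_lt)
qed

lemma convex_vstrip [simp, intro]: "convex (vstrip l u)"
proof -
  have "vstrip l u = {s. Re s > l} \<inter> {s. Re s < u}" by (auto simp: vstrip_def)
  then show ?thesis
    by (auto intro!: convex_Int convex_halfspace_Re_gt convex_halfspace_Re_lt)
qed

lemma borel_measurable_vline:
  assumes "f holomorphic_on vstrip l u" "l < c" "c < u"
  shows "(\<lambda>y. f (Complex c y)) \<in> borel_measurable borel"
proof (rule borel_measurable_continuous_onI)
  have "continuous_on (vstrip l u) f"
    using assms(1) by (rule holomorphic_on_imp_continuous_on)
  moreover have "continuous_on UNIV (Complex c)"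
    unfolding Complex_eq by (intro continuous_intros)
  ultimately show "continuous_on UNIV (\<lambda>y. f (Complex c y))"
    by (rule continuous_on_compose2) (use assms in \<open>auto simp: vstrip_def\<close>)
qed

lemma vint_cong: "(\<And>s. Re s = c \<Longrightarrow> f s = g s) \<Longrightarrow> vint c f = vint c g"
  by (simp add: vint_def)

lemma small_exp_bound:
  fixes a C e :: real
  assumes "a > 0" "e > 0"
  shows "\<exists>N. \<forall>y. \<bar>y\<bar> \<ge> N \<longrightarrow> C * exp (- (a * \<bar>y\<bar>)) \<le> e"
proof -
  have "((\<lambda>x. C * exp (- (a * x))) \<longlongrightarrow> C * 0) at_top"
    using assms by real_asymp
  then have "eventually (\<lambda>x. C * exp (- (a * x)) < e) at_top"
    using assms by (intro order_tendstoD) auto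
  then show ?thesis unfolding eventually_at_top_linorder by (force intro: less_imp_le)
qed

lemma divide_one_plus_exp_le: "C \<ge> 0 \<Longrightarrow> C / (1 + exp x) \<le> (C :: real)"
  by (simp add: divide_le_eq add_pos_pos mult_le_cancel_left1 order_less_imp_not_less)

lemma norm_mult_kern_le_far:
  assumes "C \<ge> 0" and "\<And>s. a \<le> Re s \<Longrightarrow> Re s \<le> b \<Longrightarrow> norm (f s) \<le> C * exp (- (\<alpha> * \<bar>Im s\<bar>))"
    and "\<alpha> > 0" "e > 0"
  shows "\<exists>N. \<forall>z. a \<le> Re z \<and> Re z \<le> b \<and> \<bar>Im z\<bar> \<ge> N \<longrightarrow> norm (f z * kern (z - s)) \<le> e"
proof -
  obtain N where N: "\<And>y. \<bar>y\<bar> \<ge> N \<Longrightarrow> C * 2 * exp (- (\<alpha> * \<bar>y\<bar>)) \<le> e"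
    using small_exp_bound[OF assms(3,4), of "C * 2"] by blast
  have "norm (f z * kern (z - s)) \<le> e"
    if z: "a \<le> Re z" "Re z \<le> b" "\<bar>Im z\<bar> \<ge> max N (\<bar>Im s\<bar> + 1)" for z
  proof -
    have "norm (kern (z - s)) \<le> 2 / (1 + exp (- (2 * pi * Im (z - s))))"
      using z by (intro norm_kern_le_far) auto
    also have "\<dots> \<le> 2" by (simp add: divide_le_eq add_pos_pos)
    finally have "norm (f z * kern (z - s)) \<le> C * exp (- (\<alpha> * \<bar>Im z\<bar>)) * 2"
      unfolding norm_mult using assms z by (intro mult_mono) auto
    also have "\<dots> \<le> e" using N[of "Im z"] z by (simp add: mult_ac)
    finally show ?thesis .
  qed
  then show ?thesis by blast
qed

text \<open>Applied with L = 1/\<omega>, \<alpha> = 2 pi \<omega> and \<open>u\<close> a positive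
  power of the weight. The constant depends on the closed substrip because the weight has poles on
  both edges of the strip.\<close>

locale cauchy_transform =
  fixes L \<alpha> :: real and u :: "complex \<Rightarrow> complex"
  assumes L_pos: "L > 0" and \<alpha>_pos: "\<alpha> > 0"
    and holo_u: "u holomorphic_on vstrip (- L) 0"
    and bound_u: "\<And>a b. - L < a \<Longrightarrow> b < 0 \<Longrightarrow>
      \<exists>C. \<forall>s. a \<le> Re s \<and> Re s \<le> b \<longrightarrow> norm (u s) \<le> C * exp (- (\<alpha> * \<bar>Im s\<bar>))"
begin

lemma bound_u':
  assumes "- L < a" "b < 0"
  obtains C where "C \<ge> 0"
    "\<And>s. a \<le> Re s \<Longrightarrow> Re s \<le> b \<Longrightarrow> norm (u s) \<le> C * exp (- (\<alpha> * \<bar>Im s\<bar>))"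
proof -
  obtain C where C: "\<And>s. a \<le> Re s \<and> Re s \<le> b \<Longrightarrow> norm (u s) \<le> C * exp (- (\<alpha> * \<bar>Im s\<bar>))"
    using bound_u[OF assms] by blast
  have "norm (u s) \<le> \<bar>C\<bar> * exp (- (\<alpha> * \<bar>Im s\<bar>))" if "a \<le> Re s \<and> Re s \<le> b" for s
    using C[OF that] by (rule order_trans) (simp add: mult_right_mono)
  then show ?thesis by (intro that[of "\<bar>C\<bar>"]) auto
qed

text \<open>The affine function \<open>base\<close> maps \<open>(- L, 1)\<close> onto \<open>(- L, 0)\<close> and satisfies \<open>0 < x - base x < 1\<close>, so
  the line \<open>Re z = base (Re s)\<close> avoids the poles of \<open>u z * kern (z - s)\<close> for every \<open>s\<close> in the strip.\<close>

definition base :: "real \<Rightarrow> real" where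
  "base x = L * (x - 1) / (L + 1)"

definition transform :: "complex \<Rightarrow> complex" where
  "transform s = vint (base (Re s)) (\<lambda>z. u z * kern (z - s))"

lemma base_bounds:
  assumes "- L < x" "x < 1"
  shows "- L < base x" "base x < 0" "base x < x" "x < base x + 1"
proof -
  show "base x < 0" using assms L_pos by (simp add: base_def divide_less_0_iff mult_less_0_iff)
  show "- L < base x" using assms L_pos mult_strict_left_mono[of "- L" x L]
    by (simp add: base_def field_simps)
  show "base x < x" "x < base x + 1" using assms L_pos by (simp_all add: base_def field_simps)
qed

lemma base_mono: "x \<le> y \<Longrightarrow> base x \<le> base y"
  using L_pos by (simp add: base_def divide_right_mono mult_left_mono)

text \<open>Together with \<open>base_mono\<close> this confines the line and its offset from
  \<open>s\<close> to compact ranges while \<open>Re s\<close> varies in an interval, so the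
  constants of \<open>transform_bound\<close> are uniform.\<close>

lemma shift_mono: "x \<le> y \<Longrightarrow> x - base x \<le> y - base y"
proof -
  have "x - base x = (x + L) / (L + 1)" for x using L_pos by (simp add: base_def field_simps)
  then show "x \<le> y \<Longrightarrow> x - base x \<le> y - base y" using L_pos by (simp add: divide_right_mono)
qed

lemma holo_u_kern:
  assumes "\<And>z. z \<in> A \<Longrightarrow> - L < Re z \<and> Re z < 0 \<and> z - s \<notin> \<int>"
  shows "(\<lambda>z. u z * kern (z - s)) holomorphic_on A"
  using assms by (intro holomorphic_intros holomorphic_on_subset[OF holo_u]) (auto simp: vstrip_def)

lemma vintegrable_u_kern:
  assumes "- L < c" "c < 0" "c - Re s \<notin> \<int>"
  shows "vintegrable c (\<lambda>z. u z * kern (z - s))"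
proof -
  obtain C where C': "C \<ge> 0"
    "\<And>s. c \<le> Re s \<Longrightarrow> Re s \<le> c \<Longrightarrow> norm (u s) \<le> C * exp (- (\<alpha> * \<bar>Im s\<bar>))"
    using bound_u'[OF assms(1,2)] by blast
  have C: "C \<ge> 0" "norm (u (Complex c y)) \<le> C * exp (- (\<alpha> * \<bar>y\<bar>))" for y
    using C'(1) C'(2)[of "Complex c y"] by auto
  obtain K where K: "K > 0" "\<And>t. c - Re s \<le> Re t \<Longrightarrow> Re t \<le> c - Re s \<Longrightarrow>
      norm (kern t) \<le> K / (1 + exp (- (2 * pi * Im t)))"
    by (rule kern_bound[of "c - Re s" "c - Re s"]) (use assms(3) in \<open>auto dest: antisym\<close>)
  have K': "norm (kern (Complex c y - s)) \<le> K" for y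
    using K(2)[of "Complex c y - s"] divide_one_plus_exp_le[OF less_imp_le[OF K(1)]]
    by (auto intro: order_trans)
  show ?thesis
    unfolding vintegrable_def
  proof (rule integrable_exp_bound[OF \<alpha>_pos, where C = "C * K"])
    show "(\<lambda>y. u (Complex c y) * kern (Complex c y - s)) \<in> borel_measurable borel"
      using borel_measurable_vline[OF holo_u assms(1,2)] by measurable
    show "norm (u (Complex c y) * kern (Complex c y - s)) \<le> C * K * exp (- (\<alpha> * \<bar>y\<bar>))" for y
      using mult_mono[OF C(2)[of y] K'[of y]] C(1) by (simp add: norm_mult mult_ac)
  qed
qed

text \<open>\<open>P\<close> is empty or \<open>{s}\<close>, so one statement covers a shift of the
  line with and without crossing \<open>s\<close>. The bounds \<open>Re s - 1 < c1\<close> and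
  \<open>c2 < Re s + 1\<close> keep the other poles s + n out of reach.\<close>

lemma vint_shift:
  assumes "- L < c1" "c1 < c2" "c2 < 0" "P \<subseteq> {s}" "Re s - 1 < c1" "c2 < Re s + 1"
    and "c1 \<noteq> Re s" "c2 \<noteq> Re s" and P: "s \<in> P \<longleftrightarrow> c1 < Re s \<and> Re s < c2"
  shows "vint c2 (\<lambda>z. u z * kern (z - s)) - vint c1 (\<lambda>z. u z * kern (z - s)) = (\<Sum>p\<in>P. u p)"
proof -
  obtain C where C: "C \<ge> 0"
    "\<And>s. c1 \<le> Re s \<Longrightarrow> Re s \<le> c2 \<Longrightarrow> norm (u s) \<le> C * exp (- (\<alpha> * \<bar>Im s\<bar>))"
    using bound_u' assms by blast
  have fin: "finite P" using assms(4) finite_subset by blast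
  \<comment> \<open>The strip from \<open>l\<close> to \<open>r\<close> is a neighbourhood of the
    region between the two lines, inside the domain of \<open>u\<close>; it contains no pole except
    \<open>s\<close>, and \<open>s\<close> only if that lies between the lines.\<close>
  define l where "l = (if c1 < Re s then max (- L) (Re s - 1) else max (- L) (Re s))"
  define r where "r = (if c2 < Re s then min 0 (Re s) else min 0 (Re s + 1))"
  have lr: "l < x \<Longrightarrow> - L < x" "x < r \<Longrightarrow> x < 0" for x by (auto simp: l_def r_def split: if_splits)
  have nonint: "z - s \<notin> \<int>" if z: "l < Re z" "Re z < r" "z \<notin> P" for z
  proof
    assume "z - s \<in> \<int>"
    then obtain n :: int where n: "z = s + of_int n" by (auto elim!: Ints_cases simp: algebra_simps)
    then have Re: "Re z = Re s + real_of_int n" by simp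
    consider "c2 < Re s" | "Re s < c1" | "c1 < Re s" "Re s < c2" using assms by linarith
    then show False
    proof cases
      case 1
      then have "real_of_int n > - 1" "n < 0" using z Re assms by (auto simp: l_def r_def)
      then show False by linarith
    next
      case 2
      then have "real_of_int n < 1" "n > 0" using z Re assms by (auto simp: l_def r_def)
      then show False by linarith
    next
      case 3
      then have "real_of_int n > - 1" "real_of_int n < 1"
        using z Re assms by (auto simp: l_def r_def)
      then have "n = 0" by linarith
      then show False using z n P 3 by simp
    qed
  qed
  have "vint c2 (\<lambda>z. u z * kern (z - s)) - vint c1 (\<lambda>z. u z * kern (z - s)) =
      2 * pi * \<i> * (\<Sum>p\<in>P. residue (\<lambda>z. u z * kern (z - s)) p)"
  proof (rule vint_diff_eq_residues[of l c1 c2 r])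
    show "l < c1" "c2 < r" using assms by (auto simp: l_def r_def)
    show "c1 < Re p \<and> Re p < c2" if "p \<in> P" for p using that assms by auto
    show "(\<lambda>z. u z * kern (z - s)) holomorphic_on {s. l < Re s \<and> Re s < r} - P"
      using nonint by (intro holo_u_kern) (auto simp: lr)
    have "c1 - Re s \<notin> \<int>" "c2 - Re s \<notin> \<int>"
      using assms not_Ints_between[of "- 1" "c1 - Re s"] not_Ints_between[of 0 "c1 - Re s"]
        not_Ints_between[of "- 1" "c2 - Re s"] not_Ints_between[of 0 "c2 - Re s"] by force+
    then show "vintegrable c1 (\<lambda>z. u z * kern (z - s))" "vintegrable c2 (\<lambda>z. u z * kern (z - s))"
      using assms by (auto intro!: vintegrable_u_kern)
    show "\<exists>N. \<forall>z. c1 \<le> Re z \<and> Re z \<le> c2 \<and> N \<le> \<bar>Im z\<bar> \<longrightarrow>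
        norm (u z * kern (z - s)) \<le> e" if "e > 0" for e
      using norm_mult_kern_le_far[OF C(1) C(2) \<alpha>_pos that] by blast
  qed (use assms fin in auto)
  also have "(\<Sum>p\<in>P. residue (\<lambda>z. u z * kern (z - s)) p) = (\<Sum>p\<in>P. u p / (2 * pi * \<i>))"
  proof (rule sum.cong)
    fix p assume p: "p \<in> P"
    then have "p = s" using assms(4) by auto
    moreover have "s \<in> vstrip (- L) 0" using P p \<open>p = s\<close> assms by (auto simp: vstrip_def)
    ultimately show "residue (\<lambda>z. u z * kern (z - s)) p = u p / (2 * pi * \<i>)"
      using residue_kern[OF open_vstrip _ holo_u] by simp
  qed simp
  finally show ?thesis by (simp flip: sum_divide_distrib)
qed

text \<open>Both \<open>c\<close> and \<open>base (Re s)\<close> lie to the left of \<open>s\<close>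
  at distance less than 1, so no pole separates them. The line may thus be frozen while
  \<open>s\<close> varies.\<close>

lemma transform_eq:
  assumes "- L < c" "c < 0" "c < Re s" "Re s < c + 1"
  shows "transform s = vint c (\<lambda>z. u z * kern (z - s))"
proof -
  define b where "b = base (Re s)"
  have b: "- L < b" "b < 0" "b < Re s" "Re s < b + 1"
    using base_bounds[of "Re s"] assms by (auto simp: b_def)
  consider "b = c" | "b < c" | "c < b" by linarith
  then show ?thesis
  proof cases
    case 2
    then show ?thesis using vint_shift[of b c "{}" s] assms b by (simp add: transform_def b_def)
  next
    case 3
    then show ?thesis using vint_shift[of c b "{}" s] assms b by (simp add: transform_def b_def)
  qed (simp add: transform_def b_def)
qed

text \<open>By periodicity of the kernel, the value at s + 1 is an integral of the same integrand
  along a line to the right of \<open>s\<close>; moving that line back to the left crosses the pole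
  at \<open>s\<close>.\<close>

lemma transform_plus_1:
  assumes "- L < Re s" "Re s < 0"
  shows "transform (s + 1) = transform s + u s"
proof -
  define c1 where "c1 = (max (- L) (Re s - 1) + Re s) / 2"
  have c1: "- L < c1" "Re s - 1 < c1" "c1 < Re s" using assms by (auto simp: c1_def)
  define c2 where "c2 = (min 0 (Re s + 1) + Re s) / 2"
  have c2: "Re s < c2" "c2 < 0" "c2 < Re s + 1" using assms by (auto simp: c2_def)
  have "transform (s + 1) = vint c2 (\<lambda>z. u z * kern (z - s))"
    using transform_eq[of c2 "s + 1"] c1 c2 by (simp flip: diff_diff_eq)
  also have "\<dots> = vint c1 (\<lambda>z. u z * kern (z - s)) + u s"
    using vint_shift[of c1 c2 "{s}" s] c1 c2 by (simp add: algebra_simps)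
  also have "vint c1 (\<lambda>z. u z * kern (z - s)) = transform s"
    using transform_eq[of c1 s] c1 c2 by simp
  finally show ?thesis .
qed

end

text \<open>With x = Im z and y = Im s this converts the decay of the kernel in Im (s - z) into
  decay in Im s, at the price of a factor exp (b |Im z|).\<close>

lemma one_plus_exp_le:
  fixes b c x y :: real
  assumes "0 \<le> b" "b \<le> c"
  shows "1 + exp (b * y) \<le> 2 * exp (b * \<bar>x\<bar>) * (1 + exp (c * (y - x)))"
proof -
  have 1: "exp (b * y) = exp (b * x) * exp (b * (y - x))"
    by (simp add: right_diff_distrib flip: exp_add)
  have "exp (b * (y - x)) \<le> 1 + exp (c * (y - x))"
  proof (cases "y \<ge> x")
    case True
    then have "exp (b * (y - x)) \<le> exp (c * (y - x))" using assms by (simp add: mult_right_mono)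
    then show ?thesis by linarith
  next
    case False
    then have "exp (b * (y - x)) \<le> 1" using assms by (simp add: mult_nonneg_nonpos)
    then show ?thesis by (simp add: add_increasing2)
  qed
  moreover have 2: "exp (b * x) \<le> exp (b * \<bar>x\<bar>)" using assms by (simp add: mult_left_mono)
  ultimately have "exp (b * y) \<le> exp (b * \<bar>x\<bar>) * (1 + exp (c * (y - x)))"
    unfolding 1 by (intro mult_mono) auto
  moreover have "1 * 1 \<le> exp (b * \<bar>x\<bar>) * (1 + exp (c * (y - x)))"
    using assms by (intro mult_mono) auto
  ultimately show ?thesis by simp
qed

text \<open>One factor decays for x \<rightarrow> \<infinity>, the other for x \<rightarrow>
  -\<infinity>, and the product at both ends. This makes a function with one-sided decay integrable
  against the kernel.\<close>

lemma divide_exp_product_le: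
  fixes b c x y :: real
  assumes "0 < b" "b \<le> c" "b \<le> d"
  shows "1 / (1 + exp (d * x)) * (1 / (1 + exp (- (c * (x - y))))) \<le> exp (c * \<bar>y\<bar>) * exp (- (b * \<bar>x\<bar>))"
proof -
  have inv: "1 / (1 + exp z) \<le> exp (- z)" "1 / (1 + exp z) \<le> 1" for z :: real
    by (auto simp: exp_minus field_simps add_pos_pos)
  have c: "c > 0" using assms by simp
  show ?thesis
  proof (cases "x \<ge> 0")
    case True
    have "1 / (1 + exp (d * x)) \<le> exp (- (d * x))" using inv by blast
    also have "\<dots> \<le> exp (- (b * \<bar>x\<bar>))" using True assms by (simp add: mult_right_mono)
    finally have "1 / (1 + exp (d * x)) * (1 / (1 + exp (- (c * (x - y))))) \<le> exp (- (b * \<bar>x\<bar>)) * 1"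
      using inv by (intro mult_mono) (auto intro: add_nonneg_nonneg)
    also have "\<dots> \<le> exp (- (b * \<bar>x\<bar>)) * exp (c * \<bar>y\<bar>)"
      using c by (intro mult_left_mono) auto
    finally show ?thesis by (simp add: mult.commute)
  next
    case False
    have "1 / (1 + exp (- (c * (x - y)))) \<le> exp (c * (x - y))" using inv[of "- (c * (x - y))"] by simp
    also have "\<dots> \<le> exp (c * \<bar>y\<bar> + - (b * \<bar>x\<bar>))"
    proof -
      have "\<bar>x\<bar> = - x" "c * x \<le> b * x" using False assms mult_right_mono_neg[of b c x] by auto
      moreover have "- (c * y) \<le> c * \<bar>y\<bar>" using c mult_left_mono[of "- y" "\<bar>y\<bar>" c] by simp
      ultimately have "c * (x - y) \<le> c * \<bar>y\<bar> + - (b * \<bar>x\<bar>)"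
        by (simp add: right_diff_distrib del: mult_le_cancel_left mult_le_cancel_right)
      then show ?thesis by simp
    qed
    finally have "1 / (1 + exp (d * x)) * (1 / (1 + exp (- (c * (x - y))))) \<le>
        1 * exp (c * \<bar>y\<bar> + - (b * \<bar>x\<bar>))"
      using inv by (intro mult_mono) (auto intro: add_nonneg_nonneg)
    then show ?thesis by (simp only: exp_add mult_1)
  qed
qed

lemma kern_bound_neg:
  assumes "- 1 < a" "b < 0"
  obtains C where "C > 0"
    "\<And>t. a \<le> Re t \<Longrightarrow> Re t \<le> b \<Longrightarrow> norm (kern t) \<le> C / (1 + exp (- (2 * pi * Im t)))"
proof (rule kern_bound[of a b])
  show "x \<notin> \<int>" if "a \<le> x" "x \<le> b" for x
    using not_Ints_between[of "- 1" x] that assms by simp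
qed (use that in blast)

lemma DERIV_kern:
  assumes "t \<notin> \<int>"
  shows "(kern has_field_derivative
    - (2 * pi * \<i> * exp (2 * pi * \<i> * t)) / (exp (2 * pi * \<i> * t) - 1)\<^sup>2) (at t within A)"
  unfolding kern_def [abs_def] using assms exp_2pi_i_eq_1_iff[of t]
  by (auto intro!: derivative_eq_intros simp: power2_eq_square)

context cauchy_transform
begin

text \<open>The kernel decays at rate 2 pi. Of the decay rate \<alpha> of \<open>u\<close> only half
  is spent on absorbing exp (\<beta> |Im z|); the other half keeps the integrand integrable.\<close>

definition \<beta> :: real where "\<beta> = min (2 * pi) (\<alpha> / 2)"

lemma \<beta>: "0 < \<beta>" "\<beta> \<le> 2 * pi" "\<beta> \<le> \<alpha> / 2"
  using \<alpha>_pos by (auto simp: \<beta>_def)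

lemma transform_bound:
  assumes "- L < a" "b < 1"
  shows "\<exists>C. \<forall>s. a \<le> Re s \<and> Re s \<le> b \<longrightarrow> norm (transform s) \<le> C / (1 + exp (\<beta> * Im s))"
proof (cases "a \<le> b")
  case True
  obtain C where C: "C \<ge> 0" "\<And>s. base a \<le> Re s \<Longrightarrow> Re s \<le> base b \<Longrightarrow>
      norm (u s) \<le> C * exp (- (\<alpha> * \<bar>Im s\<bar>))"
    using bound_u'[of "base a" "base b"] base_bounds[of a] base_bounds[of b] assms True by auto
  obtain K where K: "K > 0" "\<And>t. base b - b \<le> Re t \<Longrightarrow> Re t \<le> base a - a \<Longrightarrow>
      norm (kern t) \<le> K / (1 + exp (- (2 * pi * Im t)))"
    using base_bounds[of a] base_bounds[of b] assms True
    by (rule_tac kern_bound_neg[of "base b - b" "base a - a"]) auto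
  define I where "I = (LINT y | lborel. exp (- (\<alpha> / 2 * \<bar>y\<bar>)))"
  have "norm (transform s) \<le> 2 * C * K * I / (1 + exp (\<beta> * Im s))" if s: "a \<le> Re s" "Re s \<le> b" for s
  proof -
    define c where "c = base (Re s)"
    have c: "- L < c" "c < 0" "c < Re s" "Re s < c + 1" "base a \<le> c" "c \<le> base b"
      "base b - b \<le> c - Re s" "c - Re s \<le> base a - a"
      using s assms base_bounds[of "Re s"] base_mono[of a "Re s"] base_mono[of "Re s" b]
        shift_mono[of a "Re s"] shift_mono[of "Re s" b] by (auto simp: c_def)
    have "vintegrable c (\<lambda>z. u z * kern (z - s))"
      using c by (intro vintegrable_u_kern not_Ints_between[of "- 1"]) auto
    then have "norm (LINT y | lborel. u (Complex c y) * kern (Complex c y - s)) \<le>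
        (LINT y | lborel. 2 * C * K / (1 + exp (\<beta> * Im s)) * exp (- (\<alpha> / 2 * \<bar>y\<bar>)))"
    proof (intro Bochner_Integration.integral_norm_bound_integral)
      fix y :: real
      define D where "D = 1 + exp (- (2 * pi * (y - Im s)))"
      have D: "D > 0" by (simp add: D_def add_pos_pos)
      have 1: "exp (- (\<alpha> * \<bar>y\<bar>)) \<le> exp (- (\<alpha> / 2 * \<bar>y\<bar>)) * exp (- (\<beta> * \<bar>y\<bar>))"
        using \<beta> mult_right_mono[of \<beta> "\<alpha> / 2" "\<bar>y\<bar>"] by (simp flip: exp_add)
      have "1 + exp (\<beta> * Im s) \<le> 2 * exp (\<beta> * \<bar>y\<bar>) * D"
        using one_plus_exp_le[of \<beta> "2 * pi" "Im s" y] \<beta> by (simp add: D_def algebra_simps)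
      then have 2: "exp (- (\<beta> * \<bar>y\<bar>)) / D \<le> 2 / (1 + exp (\<beta> * Im s))"
        using D by (simp add: exp_minus field_simps add_pos_pos)
      have "norm (u (Complex c y) * kern (Complex c y - s)) \<le> C * exp (- (\<alpha> * \<bar>y\<bar>)) * (K / D)"
        unfolding norm_mult D_def using C(2)[of "Complex c y"] K(2)[of "Complex c y - s"] c C(1)
        by (intro mult_mono) auto
      also have "\<dots> \<le> C * (exp (- (\<alpha> / 2 * \<bar>y\<bar>)) * exp (- (\<beta> * \<bar>y\<bar>))) * (K / D)"
        using 1 C(1) K(1) D by (intro mult_right_mono mult_left_mono) auto
      also have "\<dots> = C * K * exp (- (\<alpha> / 2 * \<bar>y\<bar>)) * (exp (- (\<beta> * \<bar>y\<bar>)) / D)"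
        by simp
      also have "\<dots> \<le> C * K * exp (- (\<alpha> / 2 * \<bar>y\<bar>)) * (2 / (1 + exp (\<beta> * Im s)))"
        using C(1) K(1) by (intro mult_left_mono[OF 2]) auto
      finally show "norm (u (Complex c y) * kern (Complex c y - s)) \<le>
          2 * C * K / (1 + exp (\<beta> * Im s)) * exp (- (\<alpha> / 2 * \<bar>y\<bar>))"
        by (simp add: mult_ac)
    qed (use integrable_exp_minus_abs[of "\<alpha> / 2"] \<alpha>_pos in \<open>auto simp: vintegrable_def\<close>)
    then show ?thesis
      by (simp add: transform_def vint_def norm_mult I_def flip: c_def)
  qed
  then show ?thesis by blast
qed auto

text \<open>The integrals over [-n, n] are holomorphic by differentiation under the integral sign,
  and they converge locally uniformly by \<open>integral_tail_bound\<close>.\<close>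

lemma holomorphic_on_vint:
  assumes c: "- L < c" "c < 0"
  shows "(\<lambda>s. vint c (\<lambda>z. u z * kern (z - s))) holomorphic_on vstrip c (c + 1)"
proof (rule holomorphic_uniform_sequence)
  define f where "f = (\<lambda>n s. \<i> * integral {- real n..real n} (\<lambda>y. u (Complex c y) * kern (Complex c y - s)))"
  define d where "d = (\<lambda>t. - (2 * pi * \<i> * exp (2 * pi * \<i> * t)) / (exp (2 * pi * \<i> * t) - 1)\<^sup>2)"
  have int: "c - Re s \<notin> \<int>" if "s \<in> vstrip c (c + 1)" for s
    using that by (intro not_Ints_between[of "- 1"]) (auto simp: vstrip_def)
  have notint: "Complex c y - s \<notin> \<int>" if "s \<in> vstrip c (c + 1)" for s y
    using int[OF that] by (intro not_Ints_if_Re) simp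
  have cont_u: "continuous_on UNIV (\<lambda>y. u (Complex c y))"
    by (rule continuous_on_compose2[OF holomorphic_on_imp_continuous_on[OF holo_u]])
      (use c in \<open>auto simp: vstrip_def Complex_eq intro!: continuous_intros\<close>)
  show "f n holomorphic_on vstrip c (c + 1)" for n
    unfolding f_def
  proof (intro holomorphic_intros, unfold box_real(2)[symmetric], rule leibniz_rule_holomorphic)
    fix s y assume s: "s \<in> vstrip c (c + 1)"
    have "((\<lambda>s. kern (Complex c y - s)) has_field_derivative d (Complex c y - s) * (- 1)) (at s within vstrip c (c + 1))"
      unfolding d_def using notint[OF s]
      by (intro DERIV_chain2[OF DERIV_kern]) (auto intro!: derivative_eq_intros)
    then show "((\<lambda>s. u (Complex c y) * kern (Complex c y - s)) has_field_derivative
        u (Complex c y) * (d (Complex c y - s) * (- 1))) (at s within vstrip c (c + 1))"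
      by (rule DERIV_cmult)
  next
    fix s assume s: "s \<in> vstrip c (c + 1)"
    have "continuous_on (cbox (- real n) (real n)) (\<lambda>y. kern (Complex c y - s))"
      using notint[OF s] unfolding kern_def Complex_eq
      by (intro continuous_intros) (auto simp: exp_2pi_i_eq_1_iff[simplified])
    then show "(\<lambda>y. u (Complex c y) * kern (Complex c y - s)) integrable_on cbox (- real n) (real n)"
      using cont_u
      by (intro integrable_continuous continuous_intros) (auto intro: continuous_on_subset)
  next
    have "continuous_on (vstrip c (c + 1) \<times> cbox (- real n) (real n)) (\<lambda>x. u (Complex c (snd x)))"
      by (rule continuous_on_compose2[OF cont_u]) (auto intro!: continuous_intros)
    moreover have "continuous_on (vstrip c (c + 1) \<times> cbox (- real n) (real n))
        (\<lambda>x. d (Complex c (snd x) - fst x))"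
      using notint unfolding d_def Complex_eq
      by (intro continuous_intros) (auto simp: exp_2pi_i_eq_1_iff[simplified])
    ultimately show "continuous_on (vstrip c (c + 1) \<times> cbox (- real n) (real n))
        (\<lambda>(s, y). u (Complex c y) * (d (Complex c y - s) * (- 1)))"
      unfolding case_prod_unfold by (intro continuous_intros)
  qed auto
  fix s0 assume s0: "s0 \<in> vstrip c (c + 1)"
  obtain r where r: "r > 0" "cball s0 r \<subseteq> vstrip c (c + 1)"
    using open_vstrip s0 by (meson open_contains_cball_eq)
  \<comment> \<open>The two real extreme points of the disc show that its real parts stay away from
    \<open>c\<close> and \<open>c + 1\<close>, where the kernel has poles.\<close>
  have "s0 + of_real r \<in> cball s0 r" "s0 - of_real r \<in> cball s0 r" using r by (auto simp: dist_norm)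
  then have "s0 + of_real r \<in> vstrip c (c + 1)" "s0 - of_real r \<in> vstrip c (c + 1)" using r by blast+
  then have r': "c < Re s0 - r" "Re s0 + r < c + 1" by (auto simp: vstrip_def)
  obtain C where C: "C \<ge> 0" "\<And>s. c \<le> Re s \<Longrightarrow> Re s \<le> c \<Longrightarrow> norm (u s) \<le> C * exp (- (\<alpha> * \<bar>Im s\<bar>))"
    using bound_u'[OF c] by blast
  obtain K where K: "K > 0" "\<And>t. c - (Re s0 + r) \<le> Re t \<Longrightarrow> Re t \<le> c - (Re s0 - r) \<Longrightarrow>
      norm (kern t) \<le> K / (1 + exp (- (2 * pi * Im t)))"
    using r' by (rule_tac kern_bound_neg[of "c - (Re s0 + r)" "c - (Re s0 - r)"]) auto
  define h where "h = (\<lambda>y. C * K * exp (- (\<alpha> * \<bar>y\<bar>)))"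
  have h: "integrable lborel h" unfolding h_def using integrable_exp_minus_abs \<alpha>_pos by simp
  have bound: "dist (f n s) (vint c (\<lambda>z. u z * kern (z - s))) \<le>
      (LINT y | lborel. h y) - integral {- real n..real n} h" if s: "s \<in> cball s0 r" for n s
  proof -
    have "\<bar>Re s - Re s0\<bar> \<le> r"
      using abs_Re_le_cmod[of "s - s0"] s by (simp add: dist_norm norm_minus_commute)
    then have "c - (Re s0 + r) \<le> c - Re s" "c - Re s \<le> c - (Re s0 - r)" by (simp_all add: abs_le_iff)
    then have K': "norm (kern (Complex c y - s)) \<le> K" for y
      using order_trans[OF K(2)[of "Complex c y - s"] divide_one_plus_exp_le[OF less_imp_le[OF K(1)]]]
      by simp
    have le: "norm (u (Complex c y) * kern (Complex c y - s)) \<le> h y" for y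
      using mult_mono[OF C(2)[of "Complex c y"] K'[of y]] C(1)
      by (simp add: norm_mult h_def mult_ac)
    have "integrable lborel (\<lambda>y. u (Complex c y) * kern (Complex c y - s))"
      using vintegrable_u_kern[OF c] int s r(2) unfolding vintegrable_def by blast
    from integral_tail_bound[OF this h le, of "real n"]
    have "norm (\<i> * ((LINT y | lborel. u (Complex c y) * kern (Complex c y - s)) -
        integral {- real n..real n} (\<lambda>y. u (Complex c y) * kern (Complex c y - s)))) \<le>
        (LINT y | lborel. h y) - integral {- real n..real n} h" by (simp add: norm_mult)
    then show ?thesis
      by (simp add: dist_norm f_def vint_def norm_minus_commute right_diff_distrib)
  qed
  have "(\<lambda>n. (LINT y | lborel. h y) - integral {- real n..real n} h) \<longlonglongrightarrow> (LINT y | lborel. h y) - (LINT y | lborel. h y)"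
    by (intro tendsto_intros filterlim_compose[OF tendsto_integral_symmetric_interval[OF h] filterlim_real_sequentially])
  then have lim: "(\<lambda>n. (LINT y | lborel. h y) - integral {- real n..real n} h) \<longlonglongrightarrow> 0" by simp
  have "uniform_limit (cball s0 r) f (\<lambda>s. vint c (\<lambda>z. u z * kern (z - s))) sequentially"
  proof (rule uniform_limitI)
    fix e :: real assume "e > 0"
    with lim have "eventually (\<lambda>n. (LINT y | lborel. h y) - integral {- real n..real n} h < e) sequentially"
      by (rule order_tendstoD)
    then show "eventually (\<lambda>n. \<forall>s\<in>cball s0 r. dist (f n s) (vint c (\<lambda>z. u z * kern (z - s))) < e) sequentially"
    proof eventually_elim
      case (elim n)
      show ?case using le_less_trans[OF bound elim] by blast
    qed
  qed
  then show "\<exists>r>0. cball s0 r \<subseteq> vstrip c (c + 1) \<and>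
      uniform_limit (cball s0 r) f (\<lambda>s. vint c (\<lambda>z. u z * kern (z - s))) sequentially"
    using r by blast
qed auto

text \<open>The line in \<open>transform\<close> moves with \<open>Re s\<close>, which hides the
  holomorphy. On each strip between \<open>c\<close> and \<open>c + 1\<close> it can be fixed at
  \<open>c\<close>, and these strips cover the domain.\<close>

lemma holomorphic_on_transform: "transform holomorphic_on vstrip (- L) 1"
proof -
  have "transform holomorphic_on (\<Union>c\<in>{- L<..<0}. vstrip c (c + 1))"
  proof (rule holomorphic_on_UN_open)
    fix c assume "c \<in> {- L<..<0}"
    then show "transform holomorphic_on vstrip c (c + 1)"
      by (intro holomorphic_transform[OF holomorphic_on_vint])
        (auto simp: vstrip_def transform_eq)
  qed auto
  moreover have "vstrip (- L) 1 \<subseteq> (\<Union>c\<in>{- L<..<0}. vstrip c (c + 1))"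
  proof
    fix s assume "s \<in> vstrip (- L) 1"
    then have "s \<in> vstrip (base (Re s)) (base (Re s) + 1)" "base (Re s) \<in> {- L<..<0}"
      using base_bounds[of "Re s"] by (auto simp: vstrip_def)
    then show "s \<in> (\<Union>c\<in>{- L<..<0}. vstrip c (c + 1))" by blast
  qed
  ultimately show ?thesis by (rule holomorphic_on_subset)
qed

end

text \<open>Integrate g(z) kern(z - s) around the strip between \<open>c\<close> and
  \<open>c + 1\<close>: periodicity of the kernel merges the two sides into one integral of the
  difference, and the only pole inside, at \<open>s\<close>, contributes \<open>g s\<close>.\<close>

lemma cauchy_representation:
  fixes g :: "complex \<Rightarrow> complex"
  assumes "\<beta> > 0" and holo: "g holomorphic_on vstrip (- L) 1"
    and bound: "\<And>a b. - L < a \<Longrightarrow> b < 1 \<Longrightarrow>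
      \<exists>C. \<forall>s. a \<le> Re s \<and> Re s \<le> b \<longrightarrow> norm (g s) \<le> C / (1 + exp (\<beta> * Im s))"
    and c: "- L < c" "c < 0" "c < Re s" "Re s < c + 1"
  shows "g s = vint c (\<lambda>z. (g (z + 1) - g z) * kern (z - s))"
    and "vintegrable c (\<lambda>z. (g (z + 1) - g z) * kern (z - s))"
proof -
  \<comment> \<open>Common decay rate at both ends: \<beta> comes from \<open>g\<close> upwards, 2
    pi from the kernel downwards.\<close>
  define b where "b = min \<beta> (2 * pi)"
  define y where "y = Im s"
  obtain C' where C': "\<And>s. c \<le> Re s \<and> Re s \<le> c + 1 \<Longrightarrow> norm (g s) \<le> C' / (1 + exp (\<beta> * Im s))"
    using bound[of c "c + 1"] c by auto
  define C where "C = \<bar>C'\<bar>"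
  have C: "norm (g s) \<le> C / (1 + exp (\<beta> * Im s))" if "c \<le> Re s \<and> Re s \<le> c + 1" for s
    using C'[OF that] by (rule order_trans) (simp add: C_def divide_right_mono add_nonneg_nonneg)
  have C0: "C \<ge> 0" by (simp add: C_def)
  have b: "b > 0" "b \<le> \<beta>" "b \<le> 2 * pi" using assms(1) by (auto simp: b_def)
  have le: "norm (g z * kern (z - s)) \<le> C * K * exp (2 * pi * \<bar>y\<bar>) * exp (- (b * \<bar>Im z\<bar>))"
    if "c \<le> Re z" "Re z \<le> c + 1" "K \<ge> 0"
      "norm (kern (z - s)) \<le> K / (1 + exp (- (2 * pi * Im (z - s))))" for z K
  proof -
    have "norm (g z * kern (z - s)) \<le> C / (1 + exp (\<beta> * Im z)) * (K / (1 + exp (- (2 * pi * (Im z - y)))))"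
      unfolding norm_mult using C[of z] that C0
      by (intro mult_mono) (auto simp: y_def intro: add_nonneg_nonneg)
    also have "\<dots> = C * K * (1 / (1 + exp (\<beta> * Im z)) * (1 / (1 + exp (- (2 * pi * (Im z - y))))))"
      by simp
    also have "\<dots> \<le> C * K * (exp (2 * pi * \<bar>y\<bar>) * exp (- (b * \<bar>Im z\<bar>)))"
      using b C0 that by (intro mult_left_mono divide_exp_product_le) auto
    finally show ?thesis by simp
  qed
  have vint: "vintegrable c' (\<lambda>z. g z * kern (z - s))" if c': "c' = c \<or> c' = c + 1" for c'
  proof -
    have notint: "c' - Re s \<notin> \<int>"
      using c' c not_Ints_between[of "- 1" "c' - Re s"] not_Ints_between[of 0 "c' - Re s"] by auto
    obtain K where K: "K > 0" "\<And>t. c' - Re s \<le> Re t \<Longrightarrow> Re t \<le> c' - Re s \<Longrightarrow>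
        norm (kern t) \<le> K / (1 + exp (- (2 * pi * Im t)))"
      by (rule kern_bound[of "c' - Re s" "c' - Re s"]) (use notint in \<open>auto dest: antisym\<close>)
    have meas: "(\<lambda>y. g (Complex c' y)) \<in> borel_measurable borel"
      using c c' by (intro borel_measurable_vline[OF holo]) auto
    have "norm (g (Complex c' x) * kern (Complex c' x - s)) \<le>
        C * K * exp (2 * pi * \<bar>y\<bar>) * exp (- (b * \<bar>x\<bar>))" for x
      using le[of "Complex c' x" K] K(1) K(2)[of "Complex c' x - s"] c c' by auto
    moreover have "(\<lambda>x. g (Complex c' x) * kern (Complex c' x - s)) \<in> borel_measurable borel"
      using meas by measurable
    ultimately show ?thesis
      unfolding vintegrable_def by (intro integrable_exp_bound[OF b(1)]) auto
  qed
  define l where "l = max (- L) (Re s - 1)"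
  define r where "r = min 1 (Re s + 1)"
  have "vint (c + 1) (\<lambda>z. g z * kern (z - s)) - vint c (\<lambda>z. g z * kern (z - s)) =
      2 * pi * \<i> * (\<Sum>p\<in>{s}. residue (\<lambda>z. g z * kern (z - s)) p)"
  proof (rule vint_diff_eq_residues[of l c "c + 1" r])
    show "(\<lambda>z. g z * kern (z - s)) holomorphic_on {s. l < Re s \<and> Re s < r} - {s}"
    proof (intro holomorphic_intros holomorphic_on_subset[OF holo])
      fix z assume z: "z \<in> {s. l < Re s \<and> Re s < r} - {s}"
      show "z - s \<notin> \<int>"
      proof
        assume "z - s \<in> \<int>"
        then obtain n :: int where n: "z = s + of_int n"
          by (auto elim!: Ints_cases simp: algebra_simps)
        then have "Re z = Re s + real_of_int n" by simp
        then have "real_of_int n > - 1" "real_of_int n < 1" using z by (auto simp: l_def r_def)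
        then have "n = 0" by linarith
        then show False using z n by simp
      qed
    qed (auto simp: vstrip_def l_def r_def)
    fix e :: real assume "e > 0"
    obtain N where N: "\<And>x. \<bar>x\<bar> \<ge> N \<Longrightarrow> C * 2 * exp (2 * pi * \<bar>y\<bar>) * exp (- (b * \<bar>x\<bar>)) \<le> e"
      using small_exp_bound[OF b(1) \<open>e > 0\<close>] by blast
    have "norm (g z * kern (z - s)) \<le> e"
      if z: "c \<le> Re z" "Re z \<le> c + 1" "\<bar>Im z\<bar> \<ge> max N (\<bar>y\<bar> + 1)" for z
    proof -
      have "norm (kern (z - s)) \<le> 2 / (1 + exp (- (2 * pi * Im (z - s))))"
        using z by (intro norm_kern_le_far) (auto simp: y_def)
      from le[OF _ _ _ this] show ?thesis using z N[of "Im z"] by simp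
    qed
    then show "\<exists>N. \<forall>z. c \<le> Re z \<and> Re z \<le> c + 1 \<and> N \<le> \<bar>Im z\<bar> \<longrightarrow> norm (g z * kern (z - s)) \<le> e"
      by blast
  qed (use c vint in \<open>auto simp: l_def r_def\<close>)
  also have "\<dots> = g s"
    using residue_kern[OF open_vstrip _ holo, of s] c by (simp add: vstrip_def)
  finally have 1: "vint (c + 1) (\<lambda>z. g z * kern (z - s)) - vint c (\<lambda>z. g z * kern (z - s)) = g s" .
  have Suc: "Complex (c + 1) y = Complex c y + 1" for y by (simp add: complex_eq_iff)
  have eq: "g (Complex (c + 1) y) * kern (Complex (c + 1) y - s) -
      g (Complex c y) * kern (Complex c y - s) =
      (g (Complex c y + 1) - g (Complex c y)) * kern (Complex c y - s)" for y
    unfolding Suc using kern_plus_1[of "Complex c y - s"] by (simp only: diff_add_eq left_diff_distrib)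
  have int: "integrable lborel (\<lambda>y. g (Complex (c + 1) y) * kern (Complex (c + 1) y - s))"
    "integrable lborel (\<lambda>y. g (Complex c y) * kern (Complex c y - s))"
    using vint[of c] vint[of "c + 1"] by (auto simp: vintegrable_def)
  show "vintegrable c (\<lambda>z. (g (z + 1) - g z) * kern (z - s))"
    using Bochner_Integration.integrable_diff[OF int] by (simp add: vintegrable_def eq)
  show "g s = vint c (\<lambda>z. (g (z + 1) - g z) * kern (z - s))"
    using 1 Bochner_Integration.integral_diff[OF int]
    by (simp add: vint_def eq flip: right_diff_distrib)
qed

section \<open>The generating series at a shifted argument\<close>

text \<open>The exponential of the integral of D/X. Thus \<open>D\<close> is the Euler logarithmic
  derivative X F'/F of the resulting series F.\<close>

definition fps_exp_solution :: "complex fps \<Rightarrow> complex fps" where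
  "fps_exp_solution D = fps_exp 1 oo fps_integral0 (fps_shift 1 D)"

lemma fps_X_times_shift_1: "D $ 0 = 0 \<Longrightarrow> fps_X * fps_shift 1 D = (D :: 'a::comm_ring_1 fps)"
  by (rule fps_ext) (auto simp: fps_X_mult_nth)

lemma fps_exp_solution:
  assumes "D $ 0 = 0"
  shows "fps_X * fps_deriv (fps_exp_solution D) = fps_exp_solution D * D"
    and "fps_exp_solution D $ 0 = 1"
proof -
  have "fps_deriv (fps_exp_solution D) = fps_exp_solution D * fps_shift 1 D"
    unfolding fps_exp_solution_def
    by (subst fps_compose_deriv) (simp_all add: fps_deriv_fps_integral)
  then have "fps_X * fps_deriv (fps_exp_solution D) = fps_exp_solution D * (fps_X * fps_shift 1 D)"
    by (simp add: mult_ac)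
  then show "fps_X * fps_deriv (fps_exp_solution D) = fps_exp_solution D * D"
    using fps_X_times_shift_1[OF assms] by simp
qed (simp add: fps_exp_solution_def)

text \<open>Compare coefficients; the term with i = n drops out because \<open>D $ 0 = 0\<close>.
  For \<open>D\<close> built from power sums these are Newton's identities.\<close>

lemma fps_ode_nth:
  fixes F :: "complex fps"
  assumes "fps_X * fps_deriv F = F * D" "D $ 0 = 0"
  shows "of_nat n * F $ n = (\<Sum>i<n. F $ i * D $ (n - i))"
proof -
  have "of_nat n * F $ n = (fps_X * fps_deriv F) $ n"
    by (cases n) (auto simp: fps_X_mult_nth)
  also have "\<dots> = (\<Sum>i=0..n. F $ i * D $ (n - i))" unfolding assms(1) fps_mult_nth ..
  also have "\<dots> = (\<Sum>i<n. F $ i * D $ (n - i)) + F $ n * D $ 0"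
    by (simp add: atLeast0AtMost flip: lessThan_Suc_atMost)
  finally show ?thesis using assms(2) by simp
qed

text \<open>A series is determined by its constant term and its Euler logarithmic derivative. The
  generating series is matched with the closed form in this way.\<close>

lemma fps_ode_unique:
  fixes F H :: "complex fps"
  assumes "fps_X * fps_deriv F = F * D" "fps_X * fps_deriv H = H * D" "D $ 0 = 0" "F $ 0 = H $ 0"
  shows "F = H"
proof (rule fps_ext)
  fix n show "F $ n = H $ n"
  proof (induction n rule: less_induct)
    case (less n)
    have "of_nat n * F $ n = of_nat n * H $ n"
      unfolding fps_ode_nth[OF assms(1,3)] fps_ode_nth[OF assms(2,3)]
      by (intro sum.cong) (auto simp: less.IH)
    then show ?case using assms(4) by (cases "n = 0") auto
  qed
qed

text \<open>The one-sided bounds for the kernel at \<omega> s and at -\<omega> s multiply to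
  two-sided exponential decay of the weight.\<close>

lemma inverse_one_plus_exp_mult_le:
  "1 / (1 + exp (- x)) * (1 / (1 + exp x)) \<le> exp (- \<bar>x\<bar> :: real)"
proof -
  have "exp \<bar>x\<bar> \<le> (1 + exp (- x)) * (1 + exp x)"
    by (cases "x \<ge> 0") (auto simp: algebra_simps add_pos_pos simp flip: exp_add)
  then show ?thesis by (simp add: exp_minus field_simps add_pos_pos)
qed

section \<open>Powers of the weight and the coefficients \<open>Zfun\<close>\<close>

locale omega =
  fixes \<omega> :: real
  assumes \<omega>_pos: "\<omega> > 0"
begin

text \<open>This is \<open>J\<^sub>\<omega>(e\<^sub>2 | s) = (\<pi>\<omega> / sin (\<pi>\<omega>s))\<^sup>2\<close>, see \<open>weight_eq_J_map\<close> and \<open>weight_eq_sin\<close>.\<close>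

definition weight :: "complex \<Rightarrow> complex" where
  "weight s = of_real ((2 * pi * \<omega>)\<^sup>2) * (kern (of_real \<omega> * s) * kern (- of_real \<omega> * s))"

lemma not_Ints_\<omega>_mult:
  assumes "- 1 / \<omega> < x" "x < 1 / \<omega>" "x \<noteq> 0"
  shows "\<omega> * x \<notin> \<int>"
proof -
  have "- 1 < \<omega> * x" "\<omega> * x < 1" "\<omega> * x \<noteq> 0" using assms \<omega>_pos by (auto simp: field_simps)
  then show ?thesis using not_Ints_between[of "- 1" "\<omega> * x"] not_Ints_between[of 0 "\<omega> * x"] by force
qed

lemma holomorphic_on_weight:
  assumes "\<And>s. s \<in> A \<Longrightarrow> - 1 / \<omega> < Re s \<and> Re s < 1 / \<omega> \<and> Re s \<noteq> 0"
  shows "weight holomorphic_on A"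
  unfolding weight_def
proof (intro holomorphic_intros)
  fix s assume "s \<in> A"
  then have "\<omega> * Re s \<notin> \<int>" using assms not_Ints_\<omega>_mult by blast
  then show "complex_of_real \<omega> * s \<notin> \<int>" "- complex_of_real \<omega> * s \<notin> \<int>"
    by (intro not_Ints_if_Re; simp)+
qed

lemma weight_bound:
  assumes "- 1 / \<omega> < a" "b < 0"
  obtains C where "C \<ge> 0"
    "\<And>s. a \<le> Re s \<Longrightarrow> Re s \<le> b \<Longrightarrow> norm (weight s) \<le> C * exp (- (2 * pi * \<omega> * \<bar>Im s\<bar>))"
proof -
  have ab: "- 1 < \<omega> * a" "\<omega> * b < 0" using assms \<omega>_pos by (auto simp: field_simps mult_pos_neg)
  obtain K where K: "K > 0" "\<And>t. \<omega> * a \<le> Re t \<Longrightarrow> Re t \<le> \<omega> * b \<Longrightarrow>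
      norm (kern t) \<le> K / (1 + exp (- (2 * pi * Im t)))"
    using kern_bound_neg[OF ab] by blast
  obtain K' where K': "K' > 0" "\<And>t. - \<omega> * b \<le> Re t \<Longrightarrow> Re t \<le> - \<omega> * a \<Longrightarrow>
      norm (kern t) \<le> K' / (1 + exp (- (2 * pi * Im t)))"
  proof (rule kern_bound[of "- \<omega> * b" "- \<omega> * a"])
    show "x \<notin> \<int>" if "- \<omega> * b \<le> x" "x \<le> - \<omega> * a" for x
      using not_Ints_between[of 0 x] that ab by simp
  qed blast
  show ?thesis
  proof (rule that[of "(2 * pi * \<omega>)\<^sup>2 * (K * K')"])
    fix s assume s: "a \<le> Re s" "Re s \<le> b"
    define x where "x = 2 * pi * \<omega> * Im s"
    have 1: "norm (kern (of_real \<omega> * s)) \<le> K / (1 + exp (- x))"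
      using K(2)[of "of_real \<omega> * s"] s \<omega>_pos by (simp add: x_def mult.assoc)
    have 2: "norm (kern (- of_real \<omega> * s)) \<le> K' / (1 + exp x)"
      using K'(2)[of "- of_real \<omega> * s"] s \<omega>_pos by (simp add: x_def mult.assoc)
    note 3 = inverse_one_plus_exp_mult_le[of x]
    have "norm (weight s) = (2 * pi * \<omega>)\<^sup>2 * (norm (kern (of_real \<omega> * s)) * norm (kern (- of_real \<omega> * s)))"
      using \<omega>_pos by (simp add: weight_def norm_mult norm_power)
    also have "\<dots> \<le> (2 * pi * \<omega>)\<^sup>2 * (K / (1 + exp (- x)) * (K' / (1 + exp x)))"
      using K(1) by (intro mult_left_mono mult_mono 1 2) (auto intro!: divide_nonneg_nonneg add_nonneg_nonneg)
    also have "\<dots> = (2 * pi * \<omega>)\<^sup>2 * (K * K') * (1 / (1 + exp (- x)) * (1 / (1 + exp x)))"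
      by simp
    also have "\<dots> \<le> (2 * pi * \<omega>)\<^sup>2 * (K * K') * exp (- \<bar>x\<bar>)"
      using K(1) K'(1) by (intro mult_left_mono 3) auto
    also have "\<bar>x\<bar> = 2 * pi * \<omega> * \<bar>Im s\<bar>" using \<omega>_pos by (simp add: x_def abs_mult)
    finally show "norm (weight s) \<le> (2 * pi * \<omega>)\<^sup>2 * (K * K') * exp (- (2 * pi * \<omega> * \<bar>Im s\<bar>))" .
  qed (use K K' in auto)
qed

text \<open>The k-th power decays at least as fast as the weight itself, so one rate serves all k
  \<ge> 1. Hence \<open>rate\<close> does not depend on k.\<close>

lemma cauchy_transform_weight:
  assumes "k \<ge> 1"
  shows "cauchy_transform (1 / \<omega>) (2 * pi * \<omega>) (\<lambda>s. weight s ^ k)"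
proof
  show "(\<lambda>s. weight s ^ k) holomorphic_on vstrip (- (1 / \<omega>)) 0"
    by (intro holomorphic_intros holomorphic_on_weight) (use \<omega>_pos in \<open>auto simp: vstrip_def intro: less_trans\<close>)
  fix a b assume "- (1 / \<omega>) < a" "b < (0::real)"
  then obtain C where C: "C \<ge> 0"
    "\<And>s. a \<le> Re s \<Longrightarrow> Re s \<le> b \<Longrightarrow> norm (weight s) \<le> C * exp (- (2 * pi * \<omega> * \<bar>Im s\<bar>))"
    using weight_bound[of a b] by auto
  have "norm (weight s ^ k) \<le> C ^ k * exp (- (2 * pi * \<omega> * \<bar>Im s\<bar>))" if "a \<le> Re s" "Re s \<le> b" for s
  proof -
    have "norm (weight s ^ k) \<le> (C * exp (- (2 * pi * \<omega> * \<bar>Im s\<bar>))) ^ k"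
      unfolding norm_power using C(2) that by (intro power_mono) auto
    also have "\<dots> = C ^ k * exp (- (2 * pi * \<omega> * \<bar>Im s\<bar>)) ^ k" by (rule power_mult_distrib)
    also have "exp (- (2 * pi * \<omega> * \<bar>Im s\<bar>)) ^ k \<le> exp (- (2 * pi * \<omega> * \<bar>Im s\<bar>)) ^ 1"
      using assms \<omega>_pos by (intro power_decreasing) auto
    finally show ?thesis using C(1) by (simp add: mult_left_mono)
  qed
  then show "\<exists>C. \<forall>s. a \<le> Re s \<and> Re s \<le> b \<longrightarrow> norm (weight s ^ k) \<le> C * exp (- (2 * pi * \<omega> * \<bar>Im s\<bar>))"
    by blast
qed (use \<omega>_pos in auto)

definition pow_transform :: "nat \<Rightarrow> complex \<Rightarrow> complex" where
  "pow_transform k = cauchy_transform.transform (1 / \<omega>) (\<lambda>s. weight s ^ k)"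

definition rate :: real where "rate = cauchy_transform.\<beta> (2 * pi * \<omega>)"

text \<open>As for elementary symmetric functions and power sums, \<open>log_coeffs\<close> is the Euler derivative
  \<open>Y d/dY\<close> of the logarithm of the series with the coefficients \<open>Zfun r s\<close>.\<close>

definition log_coeffs :: "complex \<Rightarrow> complex fps" where
  "log_coeffs s = Abs_fps (\<lambda>k. if k = 0 then 0 else (- 1) ^ (k + 1) * pow_transform k s)"

definition Zfun :: "nat \<Rightarrow> complex \<Rightarrow> complex" where
  "Zfun r s = fps_exp_solution (log_coeffs s) $ r"

lemma Zfun_0 [simp]: "Zfun 0 s = 1"
  by (simp add: Zfun_def fps_exp_solution log_coeffs_def)

text \<open>Newton's identity. It exhibits \<open>Zfun r\<close> as a polynomial in the functions
  \<open>pow_transform k\<close>, from which holomorphy and bounds follow by induction.\<close>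

lemma Zfun_rec:
  assumes "r > 0"
  shows "Zfun r s = (\<Sum>i<r. Zfun i s * ((- 1) ^ (r - i + 1) * pow_transform (r - i) s)) / of_nat r"
proof -
  have "of_nat r * Zfun r s = (\<Sum>i<r. Zfun i s * log_coeffs s $ (r - i))"
    unfolding Zfun_def by (rule fps_ode_nth) (auto intro!: fps_exp_solution simp: log_coeffs_def)
  also have "\<dots> = (\<Sum>i<r. Zfun i s * ((- 1) ^ (r - i + 1) * pow_transform (r - i) s))"
    by (intro sum.cong) (auto simp: log_coeffs_def)
  finally show ?thesis using assms by (simp add: field_simps)
qed

lemma rate_pos: "rate > 0"
  unfolding rate_def by (rule cauchy_transform.\<beta>(1)[OF cauchy_transform_weight[of 1]]) simp

lemma pow_transform:
  assumes "k \<ge> 1"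
  shows "pow_transform k holomorphic_on vstrip (- 1 / \<omega>) 1"
    and "- 1 / \<omega> < Re s \<Longrightarrow> Re s < 0 \<Longrightarrow> pow_transform k (s + 1) = pow_transform k s + weight s ^ k"
    and "- 1 / \<omega> < a \<Longrightarrow> b < 1 \<Longrightarrow>
      \<exists>C. \<forall>s. a \<le> Re s \<and> Re s \<le> b \<longrightarrow> norm (pow_transform k s) \<le> C / (1 + exp (rate * Im s))"
    and "- 1 / \<omega> < c \<Longrightarrow> c < 0 \<Longrightarrow> c < Re s \<Longrightarrow> Re s < c + 1 \<Longrightarrow>
      pow_transform k s = vint c (\<lambda>z. weight z ^ k * kern (z - s))"
proof -
  interpret cauchy_transform "1 / \<omega>" "2 * pi * \<omega>" "\<lambda>s. weight s ^ k"
    using assms by (rule cauchy_transform_weight)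
  show "pow_transform k holomorphic_on vstrip (- 1 / \<omega>) 1"
    using holomorphic_on_transform by (simp add: pow_transform_def)
  show "- 1 / \<omega> < Re s \<Longrightarrow> Re s < 0 \<Longrightarrow> pow_transform k (s + 1) = pow_transform k s + weight s ^ k"
    using transform_plus_1[of s] by (simp add: pow_transform_def)
  show "- 1 / \<omega> < a \<Longrightarrow> b < 1 \<Longrightarrow>
      \<exists>C. \<forall>s. a \<le> Re s \<and> Re s \<le> b \<longrightarrow> norm (pow_transform k s) \<le> C / (1 + exp (rate * Im s))"
    using transform_bound[of a b] by (simp add: pow_transform_def rate_def)
  show "- 1 / \<omega> < c \<Longrightarrow> c < 0 \<Longrightarrow> c < Re s \<Longrightarrow> Re s < c + 1 \<Longrightarrow>
      pow_transform k s = vint c (\<lambda>z. weight z ^ k * kern (z - s))"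
    using transform_eq[of c s] by (simp add: pow_transform_def)
qed

lemma holomorphic_on_Zfun: "Zfun r holomorphic_on vstrip (- 1 / \<omega>) 1"
proof (induction r rule: less_induct)
  case (less r)
  show ?case
  proof (cases "r = 0")
    case False
    have "(\<lambda>s. (\<Sum>i<r. Zfun i s * ((- 1) ^ (r - i + 1) * pow_transform (r - i) s)) / of_nat r)
        holomorphic_on vstrip (- 1 / \<omega>) 1"
      by (intro holomorphic_intros less.IH pow_transform) (use False in auto)
    then show ?thesis using Zfun_rec False by simp
  qed (simp add: Zfun_0[abs_def])
qed

text \<open>\<open>Zfun 0\<close> is the constant 1 and merely bounded, whereas for r > 0 every
  summand of the recursion carries a decaying factor \<open>pow_transform\<close>. The plain bound
  serves for the other factor of the summand.\<close>

lemma Zfun_bound: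
  assumes "- 1 / \<omega> < a" "b < 1"
  shows "\<exists>C\<ge>0. \<forall>s. a \<le> Re s \<and> Re s \<le> b \<longrightarrow> norm (Zfun r s) \<le> C"
    and "r > 0 \<Longrightarrow> \<exists>C. \<forall>s. a \<le> Re s \<and> Re s \<le> b \<longrightarrow> norm (Zfun r s) \<le> C / (1 + exp (rate * Im s))"
proof -
  have "(\<exists>C\<ge>0. \<forall>s. a \<le> Re s \<and> Re s \<le> b \<longrightarrow> norm (Zfun r s) \<le> C) \<and>
      (r > 0 \<longrightarrow> (\<exists>C\<ge>0. \<forall>s. a \<le> Re s \<and> Re s \<le> b \<longrightarrow> norm (Zfun r s) \<le> C / (1 + exp (rate * Im s))))"
  proof (induction r rule: less_induct)
    case (less r)
    show ?case
    proof (cases "r = 0")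
      case False
      have "\<exists>B\<ge>0. \<forall>s. a \<le> Re s \<and> Re s \<le> b \<longrightarrow>
        norm (Zfun i s * ((- 1) ^ (r - i + 1) * pow_transform (r - i) s)) \<le> B / (1 + exp (rate * Im s))"
        if i: "i < r" for i
      proof -
        obtain C where C: "C \<ge> 0" "\<And>s. a \<le> Re s \<and> Re s \<le> b \<Longrightarrow> norm (Zfun i s) \<le> C"
          using less.IH[OF i] by blast
        obtain B where B: "\<And>s. a \<le> Re s \<and> Re s \<le> b \<Longrightarrow>
            norm (pow_transform (r - i) s) \<le> B / (1 + exp (rate * Im s))"
          using pow_transform(3)[OF _ assms, of "r - i"] i by (metis Suc_leI One_nat_def zero_less_diff)
        have "norm (Zfun i s * ((- 1) ^ (r - i + 1) * pow_transform (r - i) s)) \<le>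
            C * \<bar>B\<bar> / (1 + exp (rate * Im s))" if s: "a \<le> Re s \<and> Re s \<le> b" for s
        proof -
          have "norm (pow_transform (r - i) s) \<le> \<bar>B\<bar> / (1 + exp (rate * Im s))"
            by (rule order_trans[OF B[OF s]]) (simp add: divide_right_mono add_nonneg_nonneg)
          from mult_mono[OF C(2)[OF s] this] show ?thesis
            using C(1) by (simp add: norm_mult norm_power)
        qed
        then show ?thesis using C(1) by (intro exI[of _ "C * \<bar>B\<bar>"]) auto
      qed
      then obtain B where B: "\<And>i. i < r \<Longrightarrow> B i \<ge> 0" "\<And>i s. i < r \<Longrightarrow> a \<le> Re s \<and> Re s \<le> b \<Longrightarrow>
        norm (Zfun i s * ((- 1) ^ (r - i + 1) * pow_transform (r - i) s)) \<le> B i / (1 + exp (rate * Im s))"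
        by metis
      define C where "C = (\<Sum>i<r. B i) / of_nat r"
      have C0: "C \<ge> 0" using B(1) by (auto simp: C_def intro!: divide_nonneg_nonneg sum_nonneg)
      have le: "norm (Zfun r s) \<le> C / (1 + exp (rate * Im s))" if s: "a \<le> Re s \<and> Re s \<le> b" for s
      proof -
        have "norm (Zfun r s) = norm (\<Sum>i<r. Zfun i s * ((- 1) ^ (r - i + 1) * pow_transform (r - i) s)) / of_nat r"
          using False by (subst Zfun_rec) (auto simp: norm_divide)
        also have "\<dots> \<le> (\<Sum>i<r. B i / (1 + exp (rate * Im s))) / of_nat r"
          using B(2) s by (intro divide_right_mono sum_norm_le) auto
        also have "\<dots> = C / (1 + exp (rate * Im s))"
          by (simp add: C_def flip: sum_divide_distrib)
        finally show ?thesis .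
      qed
      moreover have "norm (Zfun r s) \<le> C" if "a \<le> Re s \<and> Re s \<le> b" for s
        using le[OF that] divide_one_plus_exp_le[OF C0] by (rule order_trans)
      ultimately show ?thesis using C0 by blast
    qed (auto intro: exI[of _ 1])
  qed
  then show "\<exists>C\<ge>0. \<forall>s. a \<le> Re s \<and> Re s \<le> b \<longrightarrow> norm (Zfun r s) \<le> C"
    "r > 0 \<Longrightarrow> \<exists>C. \<forall>s. a \<le> Re s \<and> Re s \<le> b \<longrightarrow> norm (Zfun r s) \<le> C / (1 + exp (rate * Im s))"
    by blast+
qed

text \<open>Passing from s to s + 1 adds the geometric series \<open>M\<close> to the Euler
  logarithmic derivative. As \<open>MV\<close> shows, \<open>M\<close> is the Euler logarithmic
  derivative of 1 + w Y, so the generating series is multiplied by 1 + w Y.\<close>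

lemma Zfun_plus_1:
  assumes "- 1 / \<omega> < Re s" "Re s < 0"
  shows "Zfun (Suc r) (s + 1) = Zfun (Suc r) s + weight s * Zfun r s"
proof -
  define w where "w = weight s"
  define V where "V = 1 + fps_const w * fps_X"
  define M where "M = Abs_fps (\<lambda>k. if k = 0 then 0 else (- 1) ^ (k + 1) * w ^ k)"
  have V0: "V $ 0 = 1" by (simp add: V_def)
  have MV: "M * V = fps_const w * fps_X"
  proof (rule fps_ext)
    fix n
    have "M * V = M + fps_const w * (fps_X * M)" by (simp add: V_def algebra_simps)
    moreover have "(M + fps_const w * (fps_X * M)) $ n = (fps_const w * fps_X) $ n"
      by (cases n rule: nat.exhaust; cases "n - 1") (auto simp: M_def fps_X_mult_nth)
    ultimately show "(M * V) $ n = (fps_const w * fps_X) $ n" by simp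
  qed
  have L: "log_coeffs (s + 1) = log_coeffs s + M"
    by (rule fps_ext)
      (auto simp: log_coeffs_def M_def w_def pow_transform(2)[OF _ assms] distrib_left)
  have L0: "log_coeffs s $ 0 = 0" for s by (simp add: log_coeffs_def)
  define E where "E = fps_exp_solution (log_coeffs s)"
  have "fps_exp_solution (log_coeffs (s + 1)) = E * V"
  proof (rule fps_ode_unique)
    show "fps_X * fps_deriv (fps_exp_solution (log_coeffs (s + 1))) =
        fps_exp_solution (log_coeffs (s + 1)) * log_coeffs (s + 1)"
      by (rule fps_exp_solution(1)[OF L0])
    have "fps_X * fps_deriv (E * V) = fps_X * fps_deriv E * V + E * (fps_const w * fps_X)"
      by (simp add: V_def algebra_simps)
    also have "\<dots> = E * V * log_coeffs s + E * (M * V)"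
      by (simp add: MV E_def fps_exp_solution(1)[OF L0] mult_ac)
    also have "\<dots> = E * V * log_coeffs (s + 1)" unfolding L by (simp add: distrib_left mult_ac)
    finally show "fps_X * fps_deriv (E * V) = E * V * log_coeffs (s + 1)" .
  qed (use fps_exp_solution(2)[OF L0] V0 L0 in \<open>auto simp: E_def\<close>)
  moreover have "(E * V) $ Suc r = E $ Suc r + w * E $ r"
    by (simp add: V_def distrib_left mult.left_commute[of E] fps_mult_left_const_nth mult.commute[of E fps_X])
  ultimately show ?thesis by (simp add: Zfun_def E_def w_def)
qed

text \<open>\<open>cauchy_representation\<close> recovers the function from its unit difference; the
  decay it asks for is available because the index is positive.\<close>

lemma Zfun_Suc:
  assumes c: "- 1 / \<omega> < c" "c < 0" "c < Re s" "Re s < c + 1"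
  shows "Zfun (Suc r) s = vint c (\<lambda>z. weight z * Zfun r z * kern (z - s))"
proof -
  have "Zfun (Suc r) s = vint c (\<lambda>z. (Zfun (Suc r) (z + 1) - Zfun (Suc r) z) * kern (z - s))"
    using holomorphic_on_Zfun[of "Suc r"] Zfun_bound(2)[of _ _ "Suc r"] c
    by (intro cauchy_representation[OF rate_pos, of _ "1 / \<omega>"]) auto
  also have "\<dots> = vint c (\<lambda>z. weight z * Zfun r z * kern (z - s))"
    by (rule vint_cong) (use c Zfun_plus_1 in auto)
  finally show ?thesis .
qed

end

section \<open>Evaluation of the iterated integrals\<close>

text \<open>The variable \<open>y b\<close> occurs in the n - b partial sums with b \<le> a <
  n.\<close>

lemma sum_partial_sums:
  fixes y :: "nat \<Rightarrow> real"
  shows "(\<Sum>a<n. \<Sum>b\<le>a. y b) = (\<Sum>b<n. real (n - b) * y b)"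
proof (induction n)
  case (Suc n)
  have "(\<Sum>b<Suc n. real (Suc n - b) * y b) = (\<Sum>b<n. real (n - b) * y b + y b) + y n"
    by (auto simp: Suc_diff_le algebra_simps intro!: sum.cong)
  then show ?case
    using Suc by (simp add: sum.distrib flip: lessThan_Suc_atMost)
qed simp

lemma sum_Complex_const: "(\<Sum>b\<in>B. Complex x (y b)) = Complex (real (card B) * x) (\<Sum>b\<in>B. y b)"
  by (simp add: complex_eq_iff)

text \<open>The bound \<open>1 / (1 + exp (\<gamma> Y)) \<le> exp (- \<delta> Y)\<close> with a small \<open>\<delta> > 0\<close> turns the dependence on partial
  sums into a product of functions of the single variables.\<close>

lemma integrable_iterated:
  fixes \<psi> :: "nat \<Rightarrow> complex \<Rightarrow> complex"
  assumes \<epsilon>: "0 < \<epsilon>" "\<epsilon> < 1" and \<gamma>: "\<gamma> > 0"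
    and meas: "\<And>a. a < n \<Longrightarrow> (\<lambda>y. \<psi> a (Complex (- (real (Suc a) * \<epsilon>)) y)) \<in> borel_measurable borel"
    and bound: "\<And>a y. a < n \<Longrightarrow> norm (\<psi> a (Complex (- (real (Suc a) * \<epsilon>)) y)) \<le> C a / (1 + exp (\<gamma> * y))"
  shows "integrable (Pi\<^sub>M {..<n} (\<lambda>_. lborel))
    (\<lambda>y. (\<Prod>a<n. \<i> * kern (Complex (- \<epsilon>) (y a))) * (\<Prod>a<n. \<psi> a (\<Sum>b\<le>a. Complex (- \<epsilon>) (y b))))"
proof -
  define S :: "nat \<Rightarrow> (nat \<Rightarrow> real) \<Rightarrow> real" where "S = (\<lambda>a y. \<Sum>b\<le>a. y b)"
  define c where "c = (\<lambda>a. - (real (Suc a) * \<epsilon>))"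
  have S: "(\<Sum>b\<le>a. Complex (- \<epsilon>) (y b)) = Complex (c a) (S a y)" for a and y :: "nat \<Rightarrow> real"
    by (simp add: sum_Complex_const S_def c_def)
  \<comment> \<open>In the product of all exp (-\<delta> S_a) each variable gets a rate of at most
    \<delta> n \<le> pi, safely below the rate 2 pi at which the kernel decays downwards.\<close>
  define \<delta> where "\<delta> = min \<gamma> (pi / real (Suc n))"
  have \<delta>: "\<delta> > 0" "\<delta> \<le> \<gamma>" using \<gamma> by (auto simp: \<delta>_def)
  have \<delta>n: "\<delta> * real (n - b) \<le> pi" for b
  proof -
    have "\<delta> * real (n - b) \<le> pi / real (Suc n) * real (Suc n)"
      by (intro mult_mono) (auto simp: \<delta>_def)
    then show ?thesis by simp
  qed
  obtain K where K: "K > 0" "\<And>t. - \<epsilon> \<le> Re t \<Longrightarrow> Re t \<le> - \<epsilon> \<Longrightarrow>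
      norm (kern t) \<le> K / (1 + exp (- (2 * pi * Im t)))"
    using kern_bound_neg[of "- \<epsilon>" "- \<epsilon>"] \<epsilon> by auto
  interpret product_sigma_finite "\<lambda>_. lborel :: real measure" by standard
  define g where "g = (\<lambda>a y. \<bar>C a\<bar> * K * exp (- (\<delta> * real (n - a) * \<bar>y\<bar>)))"
  have "integrable (Pi\<^sub>M {..<n} (\<lambda>_. lborel)) (\<lambda>y. \<Prod>a<n. g a (y a))"
    using \<delta> unfolding g_def
    by (intro product_integrable_prod integrable_mult_right integrable_exp_minus_abs) auto
  then show ?thesis
  proof (rule Bochner_Integration.integrable_bound)
    show "(\<lambda>y. (\<Prod>a<n. \<i> * kern (Complex (- \<epsilon>) (y a))) * (\<Prod>a<n. \<psi> a (\<Sum>b\<le>a. Complex (- \<epsilon>) (y b))))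
        \<in> borel_measurable (Pi\<^sub>M {..<n} (\<lambda>_. lborel))"
      unfolding S
    proof (intro borel_measurable_times borel_measurable_prod)
      fix a assume a: "a \<in> {..<n}"
      then show "(\<lambda>y. kern (Complex (- \<epsilon>) (y a))) \<in> borel_measurable (Pi\<^sub>M {..<n} (\<lambda>_. lborel))"
        by measurable
      have "S a \<in> borel_measurable (Pi\<^sub>M {..<n} (\<lambda>_. lborel))"
        unfolding S_def using a by (intro borel_measurable_sum) measurable
      then show "(\<lambda>y. \<psi> a (Complex (c a) (S a y))) \<in> borel_measurable (Pi\<^sub>M {..<n} (\<lambda>_. lborel))"
        using meas[of a] a unfolding c_def by (auto intro: measurable_compose)
    qed auto
    have "norm ((\<Prod>a<n. \<i> * kern (Complex (- \<epsilon>) (y a))) * (\<Prod>a<n. \<psi> a (Complex (c a) (S a y)))) \<le> (\<Prod>a<n. g a (y a))" for y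
    proof -
      have "norm ((\<Prod>a<n. \<i> * kern (Complex (- \<epsilon>) (y a))) * (\<Prod>a<n. \<psi> a (Complex (c a) (S a y)))) =
          (\<Prod>a<n. norm (kern (Complex (- \<epsilon>) (y a)))) * (\<Prod>a<n. norm (\<psi> a (Complex (c a) (S a y))))"
        unfolding prod_norm norm_mult prod.distrib by (simp add: norm_power)
      also have "\<dots> \<le> (\<Prod>a<n. K / (1 + exp (- (2 * pi * y a)))) * (\<Prod>a<n. \<bar>C a\<bar> * exp (- (\<delta> * S a y)))"
      proof (intro mult_mono prod_mono conjI)
        fix a assume a: "a \<in> {..<n}"
        show "norm (kern (Complex (- \<epsilon>) (y a))) \<le> K / (1 + exp (- (2 * pi * y a)))"
          using K(2)[of "Complex (- \<epsilon>) (y a)"] by simp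
        have "1 / (1 + exp (\<gamma> * S a y)) \<le> exp (- (\<delta> * S a y))"
        proof (cases "S a y \<ge> 0")
          case True
          have "1 / (1 + exp (\<gamma> * S a y)) \<le> exp (- (\<gamma> * S a y))"
            by (simp add: exp_minus field_simps add_pos_pos)
          also have "\<dots> \<le> exp (- (\<delta> * S a y))" using \<delta> True by (simp add: mult_right_mono)
          finally show ?thesis .
        next
          case False
          have "1 / (1 + exp (\<gamma> * S a y)) \<le> 1" by (simp add: divide_le_eq add_pos_pos)
          also have "\<dots> \<le> exp (- (\<delta> * S a y))" using \<delta> False by (simp add: mult_le_0_iff)
          finally show ?thesis .
        qed
        then have "\<bar>C a\<bar> * (1 / (1 + exp (\<gamma> * S a y))) \<le> \<bar>C a\<bar> * exp (- (\<delta> * S a y))"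
          by (intro mult_left_mono) auto
        moreover have "C a / (1 + exp (\<gamma> * S a y)) \<le> \<bar>C a\<bar> / (1 + exp (\<gamma> * S a y))"
          by (intro divide_right_mono) (auto intro: add_nonneg_nonneg)
        ultimately show "norm (\<psi> a (Complex (c a) (S a y))) \<le> \<bar>C a\<bar> * exp (- (\<delta> * S a y))"
          using bound[of a "S a y"] a unfolding c_def by simp
      qed (use K(1) in \<open>auto intro!: prod_nonneg divide_nonneg_nonneg add_nonneg_nonneg\<close>)
      also have "\<dots> = (\<Prod>a<n. \<bar>C a\<bar> * K * (1 / (1 + exp (- (2 * pi * y a))))) * exp (- (\<delta> * (\<Sum>a<n. S a y)))"
      proof -
        have E: "exp (- (\<delta> * (\<Sum>a<n. S a y))) = (\<Prod>a<n. exp (- (\<delta> * S a y)))"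
          by (simp add: sum_distrib_left exp_sum flip: sum_negf)
        show ?thesis unfolding E prod.distrib[symmetric] by (intro prod.cong) simp_all
      qed
      also have "exp (- (\<delta> * (\<Sum>a<n. S a y))) = (\<Prod>a<n. exp (- (\<delta> * real (n - a) * y a)))"
        unfolding S_def sum_partial_sums by (simp add: sum_distrib_left mult.assoc exp_sum flip: sum_negf)
      also have "(\<Prod>a<n. \<bar>C a\<bar> * K * (1 / (1 + exp (- (2 * pi * y a))))) * \<dots> =
          (\<Prod>a<n. \<bar>C a\<bar> * K * (1 / (1 + exp (- (2 * pi * y a))) * exp (- (\<delta> * real (n - a) * y a))))"
        by (simp add: mult.assoc flip: prod.distrib)
      also have "\<dots> \<le> (\<Prod>a<n. g a (y a))"
        unfolding g_def
      proof (intro prod_mono conjI mult_left_mono)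
        fix a assume a: "a \<in> {..<n}"
        define B where "B = \<delta> * real (n - a)"
        have B: "0 \<le> B" "B \<le> pi" using \<delta> \<delta>n by (auto simp: B_def)
        show "1 / (1 + exp (- (2 * pi * y a))) * exp (- (\<delta> * real (n - a) * y a)) \<le> exp (- (\<delta> * real (n - a) * \<bar>y a\<bar>))"
          unfolding B_def[symmetric]
        proof (cases "y a \<ge> 0")
          case True
          have "1 / (1 + exp (- (2 * pi * y a))) \<le> 1" by (simp add: divide_le_eq add_pos_pos)
          from mult_right_mono[OF this, of "exp (- (B * y a))"] True
          show "1 / (1 + exp (- (2 * pi * y a))) * exp (- (B * y a)) \<le> exp (- (B * \<bar>y a\<bar>))" by simp
        next
          case False
          have "1 / (1 + exp (- (2 * pi * y a))) \<le> exp (2 * pi * y a)"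
            by (simp add: exp_minus field_simps add_pos_pos)
          from mult_right_mono[OF this, of "exp (- (B * y a))"]
          have "1 / (1 + exp (- (2 * pi * y a))) * exp (- (B * y a)) \<le> exp (2 * (pi * y a) - B * y a)"
            by (simp add: exp_diff exp_minus field_simps)
          also have "pi * y a \<le> B * y a" using False B by (intro mult_right_mono_neg) auto
          then have "exp (2 * (pi * y a) - B * y a) \<le> exp (- (B * \<bar>y a\<bar>))" using False by simp
          finally show "1 / (1 + exp (- (2 * pi * y a))) * exp (- (B * y a)) \<le> exp (- (B * \<bar>y a\<bar>))" .
        qed
      qed (use K(1) in \<open>auto intro!: mult_nonneg_nonneg divide_nonneg_nonneg add_nonneg_nonneg\<close>)
      finally show ?thesis .
    qed
    then show "AE y in Pi\<^sub>M {..<n} (\<lambda>_. lborel).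
        norm ((\<Prod>a<n. \<i> * kern (Complex (- \<epsilon>) (y a))) * (\<Prod>a<n. \<psi> a (\<Sum>b\<le>a. Complex (- \<epsilon>) (y b))))
        \<le> norm (\<Prod>a<n. g a (y a))"
      unfolding S real_norm_def by (intro AE_I2) (rule order_trans[OF _ abs_ge_self])
  qed
qed

context omega
begin

text \<open>The two-sided decay of the weight is weakened to the one-sided form that
  \<open>integrable_iterated\<close> expects.\<close>

lemma weight_line:
  assumes c: "- 1 / \<omega> < c" "c < 0"
  shows "(\<lambda>y. weight (Complex c y)) \<in> borel_measurable borel"
    and "\<exists>C\<ge>0. \<forall>y. norm (weight (Complex c y)) \<le> C / (1 + exp (2 * pi * \<omega> * y))"
proof -
  show "(\<lambda>y. weight (Complex c y)) \<in> borel_measurable borel"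
    unfolding weight_def by measurable
  obtain C where C: "C \<ge> 0" "\<And>s. c \<le> Re s \<Longrightarrow> Re s \<le> c \<Longrightarrow> norm (weight s) \<le> C * exp (- (2 * pi * \<omega> * \<bar>Im s\<bar>))"
    using weight_bound[OF c] by blast
  have "norm (weight (Complex c y)) \<le> 2 * C / (1 + exp (2 * pi * \<omega> * y))" for y
  proof -
    define x where "x = 2 * pi * \<omega> * y"
    have "1 + exp x \<le> 2 * exp \<bar>x\<bar>"
    proof (cases "x \<ge> 0")
      case False
      then have "exp x \<le> 1" "1 \<le> exp \<bar>x\<bar>" by auto
      then show ?thesis by linarith
    qed simp
    then have "exp (- \<bar>x\<bar>) \<le> 2 / (1 + exp x)" by (simp add: exp_minus field_simps add_pos_pos)
    then have "C * exp (- \<bar>x\<bar>) \<le> C * (2 / (1 + exp x))" using C(1) by (rule mult_left_mono)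
    moreover have "\<bar>x\<bar> = 2 * pi * \<omega> * \<bar>y\<bar>" using \<omega>_pos by (simp add: x_def abs_mult)
    ultimately show ?thesis using C(2)[of "Complex c y"] by (simp add: x_def mult_ac)
  qed
  then show "\<exists>C\<ge>0. \<forall>y. norm (weight (Complex c y)) \<le> C / (1 + exp (2 * pi * \<omega> * y))"
    using C(1) by (intro exI[of _ "2 * C"]) auto
qed

text \<open>Integrating over the last variable turns weight times \<open>Zfun j\<close> into
  \<open>Zfun (Suc j)\<close> at the previous partial sum, by \<open>Zfun_Suc\<close>. The free
  index j carries the induction; the case of interest is j = 0.\<close>

lemma iterated_integral_Zfun:
  assumes "0 < \<epsilon>" "\<epsilon> < 1" "real n * \<epsilon> < 1 / \<omega>"
  shows "(LINT y | Pi\<^sub>M {..<n} (\<lambda>_. lborel). (\<Prod>a<n. \<i> * kern (Complex (- \<epsilon>) (y a))) *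
      (\<Prod>a<n. weight (\<Sum>b\<le>a. Complex (- \<epsilon>) (y b))) * Zfun j (\<Sum>b<n. Complex (- \<epsilon>) (y b))) = Zfun (j + n) 0"
  using assms(3)
proof (induction n arbitrary: j)
  case 0
  show ?case by (simp add: PiM_empty lebesgue_integral_count_space_finite )
next
  case (Suc n)
  interpret product_sigma_finite "\<lambda>_. lborel :: real measure" by standard
  \<comment> \<open>The factor \<open>Zfun j\<close> is merged into the last function, so that the
    integrand has the shape treated in \<open>integrable_iterated\<close>.\<close>
  define F where "F = (\<lambda>y. (\<Prod>a<Suc n. \<i> * kern (Complex (- \<epsilon>) (y a))) *
      (\<Prod>a<Suc n. (if a = n then (\<lambda>s. weight s * Zfun j s) else weight) (\<Sum>b\<le>a. Complex (- \<epsilon>) (y b))))"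
  have c: "- 1 / \<omega> < - (real (Suc a) * \<epsilon>)" "- (real (Suc a) * \<epsilon>) < 0" if "a \<le> n" for a
  proof -
    have "real (Suc a) * \<epsilon> \<le> real (Suc n) * \<epsilon>" using that assms(1) by (intro mult_right_mono) auto
    moreover have "real (Suc a) * \<epsilon> > 0" using assms(1) by simp
    ultimately show "- 1 / \<omega> < - (real (Suc a) * \<epsilon>)" "- (real (Suc a) * \<epsilon>) < 0"
      using Suc.prems by (simp_all only: minus_divide_left[symmetric] neg_less_iff_less neg_less_0_iff_less)
  qed
  define c' where "c' = - (real (Suc n) * \<epsilon>)"
  have c': "- 1 / \<omega> < c'" "c' < 1" using c[of n] by (auto simp: c'_def)
  obtain B where B': "B \<ge> 0" "\<And>s. c' \<le> Re s \<and> Re s \<le> c' \<Longrightarrow> norm (Zfun j s) \<le> B"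
    using Zfun_bound(1)[OF c', of j] by blast
  have B: "B \<ge> 0" "norm (Zfun j (Complex (- (real (Suc n) * \<epsilon>)) y)) \<le> B" for y
    using B'(1) B'(2)[of "Complex c' y"] by (simp_all add: c'_def)
  have "\<exists>C\<ge>0. \<forall>y. norm (weight (Complex (- (real (Suc a) * \<epsilon>)) y)) \<le> C / (1 + exp (2 * pi * \<omega> * y))"
    if "a \<le> n" for a
    using weight_line(2)[OF c[OF that]] .
  then obtain C where C: "\<And>a. a \<le> n \<Longrightarrow> C a \<ge> 0"
    "\<And>a y. a \<le> n \<Longrightarrow> norm (weight (Complex (- (real (Suc a) * \<epsilon>)) y)) \<le> C a / (1 + exp (2 * pi * \<omega> * y))"
    by metis
  have int: "integrable (Pi\<^sub>M {..<Suc n} (\<lambda>_. lborel)) F"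
    unfolding F_def
  proof (rule integrable_iterated[OF assms(1,2), of "2 * pi * \<omega>" _ _ "\<lambda>a. if a = n then C a * B else C a"])
    fix a assume a: "a < Suc n"
    show "(\<lambda>y. (if a = n then \<lambda>s. weight s * Zfun j s else weight) (Complex (- (real (Suc a) * \<epsilon>)) y))
        \<in> borel_measurable borel"
    proof (cases "a = n")
      case True
      show ?thesis
        using weight_line(1)[OF c[of n]] borel_measurable_vline[OF holomorphic_on_Zfun c', of j]
        unfolding c'_def True by (simp del: of_nat_Suc)
    next
      case False
      then show ?thesis using weight_line(1)[OF c[of a]] a by (simp del: of_nat_Suc)
    qed
    fix y
    have "norm (weight (Complex (- (real (Suc n) * \<epsilon>)) y) * Zfun j (Complex (- (real (Suc n) * \<epsilon>)) y)) \<le>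
        C n / (1 + exp (2 * pi * \<omega> * y)) * B"
      unfolding norm_mult using C[of n] B
      by (intro mult_mono) (auto intro!: divide_nonneg_nonneg add_nonneg_nonneg)
    then show "norm ((if a = n then \<lambda>s. weight s * Zfun j s else weight) (Complex (- (real (Suc a) * \<epsilon>)) y))
        \<le> (if a = n then C a * B else C a) / (1 + exp (2 * pi * \<omega> * y))"
      using C(2)[of a y] a by (simp del: of_nat_Suc)
  qed (use \<omega>_pos in simp)
  have F: "F y = (\<Prod>a<Suc n. \<i> * kern (Complex (- \<epsilon>) (y a))) *
      (\<Prod>a<Suc n. weight (\<Sum>b\<le>a. Complex (- \<epsilon>) (y b))) * Zfun j (\<Sum>b<Suc n. Complex (- \<epsilon>) (y b))" for y
  proof -
    have "(\<Prod>a<n. (if a = n then \<lambda>s. weight s * Zfun j s else weight) (\<Sum>b\<le>a. Complex (- \<epsilon>) (y b))) =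
        (\<Prod>a<n. weight (\<Sum>b\<le>a. Complex (- \<epsilon>) (y b)))"
      by (intro prod.cong) auto
    then show ?thesis
      unfolding F_def prod.lessThan_Suc
      by (simp only: refl if_True lessThan_Suc_atMost mult.assoc)
  qed
  have "(LINT y | Pi\<^sub>M {..<Suc n} (\<lambda>_. lborel). (\<Prod>a<Suc n. \<i> * kern (Complex (- \<epsilon>) (y a))) *
      (\<Prod>a<Suc n. weight (\<Sum>b\<le>a. Complex (- \<epsilon>) (y b))) * Zfun j (\<Sum>b<Suc n. Complex (- \<epsilon>) (y b))) =
      (LINT y | Pi\<^sub>M (insert n {..<n}) (\<lambda>_. lborel). F y)"
    unfolding F lessThan_Suc[symmetric] ..
  \<comment> \<open>Fubini: the last variable is integrated first, with all earlier ones
    fixed.\<close>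
  also have "\<dots> = (LINT x | Pi\<^sub>M {..<n} (\<lambda>_. lborel). (LINT t | lborel. F (x(n := t))))"
    using int by (intro product_integral_insert) (simp_all add: lessThan_Suc)
  also have "\<dots> = (LINT x | Pi\<^sub>M {..<n} (\<lambda>_. lborel). (\<Prod>a<n. \<i> * kern (Complex (- \<epsilon>) (x a))) *
      (\<Prod>a<n. weight (\<Sum>b\<le>a. Complex (- \<epsilon>) (x b))) * Zfun (Suc j) (\<Sum>b<n. Complex (- \<epsilon>) (x b)))"
  proof (rule Bochner_Integration.integral_cong[OF refl])
    fix x :: "nat \<Rightarrow> real"
    define P where "P = (\<Prod>a<n. \<i> * kern (Complex (- \<epsilon>) (x a))) * (\<Prod>a<n. weight (\<Sum>b\<le>a. Complex (- \<epsilon>) (x b)))"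
    define s where "s = (\<Sum>b<n. Complex (- \<epsilon>) (x b))"
    have Re_s: "Re s = - (real n * \<epsilon>)" by (simp add: s_def sum_Complex_const)
    define c where "c = - (real (Suc n) * \<epsilon>)"
    define H where "H = (\<lambda>z. weight z * Zfun j z * kern (z - s))"
    have upd: "(\<Sum>b\<le>a. Complex (- \<epsilon>) ((x(n := t)) b)) = (\<Sum>b\<le>a. Complex (- \<epsilon>) (x b))" if "a < n" for a t
      using that by (intro sum.cong) auto
    have "F (x(n := t)) = P * (\<i> * H (s + Complex (- \<epsilon>) t))" for t
    proof -
      have 1: "(\<Prod>a<n. \<i> * kern (Complex (- \<epsilon>) ((x(n := t)) a))) = (\<Prod>a<n. \<i> * kern (Complex (- \<epsilon>) (x a)))"
        by (intro prod.cong) auto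
      have 2: "(\<Prod>a<n. weight (\<Sum>b\<le>a. Complex (- \<epsilon>) ((x(n := t)) b))) =
          (\<Prod>a<n. weight (\<Sum>b\<le>a. Complex (- \<epsilon>) (x b)))"
        by (intro prod.cong refl arg_cong[of _ _ weight] upd) auto
      have 3: "(\<Sum>b<Suc n. Complex (- \<epsilon>) ((x(n := t)) b)) = s + Complex (- \<epsilon>) t"
      proof -
        have "(\<Sum>b<n. Complex (- \<epsilon>) ((x(n := t)) b)) = s"
          unfolding s_def by (intro sum.cong) auto
        then show ?thesis by (simp only: sum.lessThan_Suc fun_upd_same)
      qed
      have 4: "(\<Sum>b\<le>n. Complex (- \<epsilon>) ((x(n := t)) b)) = s + Complex (- \<epsilon>) t"
        using 3 unfolding lessThan_Suc_atMost .
      show ?thesis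
        unfolding F prod.lessThan_Suc 1 2 3 4 fun_upd_same P_def H_def add_diff_cancel_left'
        by (simp only: mult_ac)
    qed
    then have "(LINT t | lborel. F (x(n := t))) = P * (\<i> * (LINT t | lborel. H (s + Complex (- \<epsilon>) t)))"
      by simp
    also have "(LINT t | lborel. H (s + Complex (- \<epsilon>) t)) = (LINT t | lborel. H (Complex c (Im s + t)))"
    proof -
      have "s + Complex (- \<epsilon>) t = Complex c (Im s + t)" for t
        using Re_s by (simp add: complex_eq_iff c_def algebra_simps)
      then show ?thesis by simp
    qed
    \<comment> \<open>Translation by \<open>Im s\<close>: with t, the last partial sum runs through
      the whole line Re = c.\<close>
    also have "\<dots> = (LINT y | lborel. H (Complex c y))"
      using lborel_integral_real_affine[of 1 "\<lambda>y. H (Complex c y)" "Im s"] by simp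
    also have "\<i> * \<dots> = Zfun (Suc j) s"
    proof -
      have "c < Re s" "Re s < c + 1" using assms(1,2) by (simp_all add: Re_s c_def algebra_simps)
      with Zfun_Suc[of c s j] c[OF order_refl] show ?thesis by (simp only: vint_def H_def c_def)
    qed
    finally show "(LINT t | lborel. F (x(n := t))) = P * Zfun (Suc j) s" .
  qed
  also have "\<dots> = Zfun (Suc j + n) 0"
  proof (rule Suc.IH)
    have "real n * \<epsilon> \<le> real (Suc n) * \<epsilon>" using assms(1) by (intro mult_right_mono) auto
    then show "real n * \<epsilon> < 1 / \<omega>" using Suc.prems by linarith
  qed
  finally show ?case by simp
qed

end

section \<open>From powers of e_2 to iterated integrals of the weight\<close>

lemma cscale_mult_left: "cscale c x * y = cscale c (x * y)"
  by (simp add: cscale_def mult.assoc)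

text \<open>Coefficients sit at the empty word and are therefore central.\<close>

lemma cscale_mult_right: "x * cscale c y = cscale c (x * y)"
proof -
  have "Poly_Mapping.single 0 c * x = x * Poly_Mapping.single 0 c"
    by (induction x rule: poly_mapping_induct)
      (simp_all add: mult_single distrib_left distrib_right mult.commute)
  then show ?thesis by (simp add: cscale_def flip: mult.assoc)
qed

lemma e_elt_2: "e_elt 2 = g_elt 2 + cscale hbar (g_elt 1)"
  by (simp add: e_elt_def)

lemma hval_hbar: "hval \<omega> hbar = 2 * pi * \<i> * \<omega>"
  by (simp add: hbar_def hval_single)

lemma g_elt_in_alphabet: "k \<ge> 1 \<Longrightarrow> g_elt k \<in> alphabet"
  by (auto simp: alphabet_def)

text \<open>Prefixing a letter keeps the last letter of a nonempty word; for the empty word the last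
  letter becomes g_k, which differs from e_1 - g_1.\<close>

lemma g_elt_mult_H0_hat:
  assumes "k \<ge> 1" "x \<in> H0_hat"
  shows "g_elt k * x \<in> H0_hat"
proof -
  interpret module cscale by (rule module_cscale)
  show ?thesis
    using assms(2) unfolding H0_hat_def
  proof (induction rule: span_induct_alt)
    case (step c b y)
    then obtain us where us: "b = prod_list us" "us \<in> lists alphabet"
      "us \<noteq> [] \<longrightarrow> last us \<noteq> e_elt 1 - g_elt 1" by blast
    have "g_elt k * b \<in> {prod_list us | us. us \<in> lists alphabet \<and>
        (us \<noteq> [] \<longrightarrow> last us \<noteq> e_elt 1 - g_elt 1)}"
      using us assms(1) gvar_diff_neq[of "k - 1"] g_elt_in_alphabet[of k]
      by (intro CollectI exI[of _ "g_elt k # us"]) (auto simp: g_elt_def e_elt_def)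
    then show ?case
      using step by (simp add: distrib_left cscale_mult_right span_add span_scale span_base)
  qed (simp add: span_zero)
qed

text \<open>Required because \<open>Z_map\<close> is determined on \<open>H0_hat\<close>
  only.\<close>

lemma e_elt_2_power_in_H0_hat: "e_elt 2 ^ r \<in> H0_hat"
proof (induction r)
  case 0
  interpret module cscale by (rule module_cscale)
  show ?case unfolding H0_hat_def by (intro span_base) (auto intro!: exI[of _ "[]"])
next
  case (Suc r)
  interpret module cscale by (rule module_cscale)
  have "g_elt 2 * e_elt 2 ^ r \<in> H0_hat" "g_elt 1 * e_elt 2 ^ r \<in> H0_hat"
    using Suc by (auto intro: g_elt_mult_H0_hat)
  then show ?case
    unfolding power_Suc e_elt_2 distrib_right cscale_mult_left
    unfolding H0_hat_def by (intro span_add span_scale)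
qed

lemma lift_words_e_elt_2:
  assumes "\<omega> \<noteq> 0"
  shows "lift_words \<omega> F (e_elt 2 * x) = lift_words \<omega> (\<lambda>us. F (g_elt 2 # us)) x +
    2 * pi * \<i> * \<omega> * lift_words \<omega> (\<lambda>us. F (g_elt 1 # us)) x"
  using assms
  by (simp add: e_elt_2 distrib_right cscale_mult_left lift_words_add lift_words_cscale hval_hbar
      g_elt_def lift_words_gvar_G)

lemma lift_words_1: "lift_words \<omega> F 1 = F []"
  using lift_words_prod_list[of "[]" \<omega> F] by simp

text \<open>Every word in the expansion of the r-th power has r letters. This allows
  \<open>\<epsilon> (length us)\<close> to be replaced by the constant
  \<open>\<epsilon> r\<close>.\<close>

lemma lift_words_e_elt_2_power_cong:
  assumes "\<omega> \<noteq> 0" "\<And>us. length us = r \<Longrightarrow> F us = F' us"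
  shows "lift_words \<omega> F (e_elt 2 ^ r) = lift_words \<omega> F' (e_elt 2 ^ r)"
  using assms(2)
proof (induction r arbitrary: F F')
  case (Suc r)
  have "lift_words \<omega> (\<lambda>us. F (u # us)) (e_elt 2 ^ r) = lift_words \<omega> (\<lambda>us. F' (u # us)) (e_elt 2 ^ r)" for u
    by (rule Suc.IH) (simp add: Suc.prems)
  then show ?case using assms(1) by (simp add: lift_words_e_elt_2)
qed (simp add: lift_words_1)

text \<open>Takes arbitrary functions in place of letters, since the weight is not the value of
  \<open>J_map\<close> at a letter but a combination of two such values.\<close>

definition iterated_integral :: "real \<Rightarrow> (complex \<Rightarrow> complex) list \<Rightarrow> complex" where
  "iterated_integral \<epsilon> \<psi> = (LINT y | Pi\<^sub>M {..<length \<psi>} (\<lambda>_. lborel).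
     (\<Prod>a<length \<psi>. \<i> * kern (Complex (- \<epsilon>) (y a))) * (\<Prod>a<length \<psi>. (\<psi> ! a) (\<Sum>b\<le>a. Complex (- \<epsilon>) (y b))))"

lemma word_integral_eq: "word_integral \<omega> \<epsilon> us = iterated_integral \<epsilon> (map (J_map \<omega>) us)"
  unfolding word_integral_def iterated_integral_def
  by (intro Bochner_Integration.integral_cong arg_cong2[of _ _ _ _ "(*)"] prod.cong)
    (simp_all add: kern_def)

context omega
begin

text \<open>The requirements of \<open>integrable_iterated\<close>, on every line that a partial sum
  can run along. Only upward decay is imposed, as the functions J(g_k) have a nonzero limit at the
  lower end.\<close>

definition tame :: "(complex \<Rightarrow> complex) \<Rightarrow> bool" where
  "tame \<psi> \<longleftrightarrow> (\<forall>c. - 1 / \<omega> < c \<longrightarrow> c < 0 \<longrightarrow>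
     (\<lambda>y. \<psi> (Complex c y)) \<in> borel_measurable borel \<and>
     (\<exists>C. \<forall>y. norm (\<psi> (Complex c y)) \<le> C / (1 + exp (2 * pi * \<omega> * y))))"

lemma tame_weight: "tame weight"
  unfolding tame_def using weight_line by blast

lemma J_map_g_elt: "k \<ge> 1 \<Longrightarrow> J_map \<omega> (g_elt k) t = (2 * pi * \<i> * \<omega> * kern (- of_real \<omega> * t)) ^ k"
proof -
  assume "k \<ge> 1"
  then have 1: "J_map \<omega> (g_elt k) t =
      (2 * pi * \<i> * \<omega> * exp (2 * pi * \<i> * \<omega> * t) / (1 - exp (2 * pi * \<i> * \<omega> * t))) ^ k"
    using is_J_J_map[of \<omega>] \<omega>_pos by (auto simp: is_J_def)
  define q where "q = exp (2 * pi * \<i> * \<omega> * t)"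
  have q: "q \<noteq> 0" by (simp add: q_def)
  have "exp (2 * pi * \<i> * (- of_real \<omega> * t)) = 1 / q"
    by (simp add: q_def exp_minus field_simps)
  then have "kern (- of_real \<omega> * t) = 1 / (1 / q - 1)" by (simp only: kern_def)
  \<comment> \<open>At q = 1 both sides are 0 by the division convention, in agreement with the
    value of \<open>J_map\<close> at the poles.\<close>
  also have "\<dots> = q / (1 - q)" using q by (cases "q = 1") (simp_all add: field_simps)
  finally have "kern (- of_real \<omega> * t) = q / (1 - q)" .
  then show ?thesis using 1 by (simp add: q_def)
qed

lemma tame_J_map_g_elt:
  assumes "k \<ge> 1"
  shows "tame (J_map \<omega> (g_elt k))"
  unfolding tame_def J_map_g_elt[OF assms]
proof (intro allI impI conjI)
  fix c assume c: "- 1 / \<omega> < c" "c < 0"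
  show "(\<lambda>y. (2 * pi * \<i> * \<omega> * kern (- of_real \<omega> * Complex c y)) ^ k) \<in> borel_measurable borel"
    by measurable
  have "\<omega> * c \<notin> \<int>" using c \<omega>_pos by (intro not_Ints_\<omega>_mult) (auto intro: less_trans[of _ 0])
  then have "- \<omega> * c \<notin> \<int>" using minus_in_Ints_iff[of "\<omega> * c"] by simp
  then obtain K where K: "K > 0" "\<And>t. - \<omega> * c \<le> Re t \<Longrightarrow> Re t \<le> - \<omega> * c \<Longrightarrow>
      norm (kern t) \<le> K / (1 + exp (- (2 * pi * Im t)))"
    using kern_bound[of "- \<omega> * c" "- \<omega> * c"] by (metis order_antisym)
  have "norm ((2 * pi * \<i> * \<omega> * kern (- of_real \<omega> * Complex c y)) ^ k) \<le>
      (2 * pi * \<omega> * K) ^ k / (1 + exp (2 * pi * \<omega> * y))" for y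
  proof -
    have E: "1 + exp (2 * pi * \<omega> * y) \<ge> 1" by simp
    have "norm (2 * pi * \<i> * \<omega> * kern (- of_real \<omega> * Complex c y)) =
        2 * pi * \<omega> * norm (kern (- of_real \<omega> * Complex c y))"
      using \<omega>_pos by (simp add: norm_mult)
    also have "\<dots> \<le> 2 * pi * \<omega> * (K / (1 + exp (2 * pi * \<omega> * y)))"
      using K(2)[of "- of_real \<omega> * Complex c y"] \<omega>_pos by (intro mult_left_mono) (auto simp: mult.assoc)
    finally have "norm ((2 * pi * \<i> * \<omega> * kern (- of_real \<omega> * Complex c y)) ^ k) \<le>
        (2 * pi * \<omega> * K / (1 + exp (2 * pi * \<omega> * y))) ^ k"
      unfolding norm_power by (intro power_mono) auto
    also have "\<dots> = (2 * pi * \<omega> * K) ^ k / (1 + exp (2 * pi * \<omega> * y)) ^ k"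
      by (simp add: power_divide)
    also have "\<dots> \<le> (2 * pi * \<omega> * K) ^ k / (1 + exp (2 * pi * \<omega> * y))"
      using K(1) \<omega>_pos E assms self_le_power[OF E, of k]
      by (intro divide_left_mono) (auto intro!: mult_pos_pos add_pos_pos zero_less_power)
    finally show ?thesis .
  qed
  then show "\<exists>C. \<forall>y. norm ((2 * pi * \<i> * \<omega> * kern (- of_real \<omega> * Complex c y)) ^ k) \<le>
      C / (1 + exp (2 * pi * \<omega> * y))" by blast
qed

text \<open>For a = kern(\<omega> t) and b = kern(-\<omega> t) = -1 - a one has a b = -b^2 - b.
  Multiplied by (2 pi \<omega>)^2, the two summands are J(g_2) and hbar J(g_1).\<close>

lemma weight_eq_J_map:
  "weight t = J_map \<omega> (g_elt 2) t + 2 * pi * \<i> * \<omega> * J_map \<omega> (g_elt 1) t"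
proof (cases "of_real \<omega> * t \<in> \<int>")
  case True
  \<comment> \<open>At the poles both sides are 0 by the division convention.\<close>
  then have "- (of_real \<omega> * t) \<in> \<int>" by simp
  then have "kern (- of_real \<omega> * t) = 0"
    using exp_2pi_i_eq_1_iff[of "- (of_real \<omega> * t)"] by (simp add: kern_def)
  then show ?thesis by (simp add: weight_def J_map_g_elt)
next
  case False
  define a b where "a = kern (of_real \<omega> * t)" and "b = kern (- of_real \<omega> * t)"
  have b: "b = - 1 - a" using kern_uminus[OF False] by (simp add: a_def b_def)
  have "weight t = of_real ((2 * pi * \<omega>)\<^sup>2) * (a * b)" by (simp only: weight_def a_def b_def)
  also have "\<dots> = (2 * pi * \<i> * \<omega> * b)\<^sup>2 + 2 * pi * \<i> * \<omega> * (2 * pi * \<i> * \<omega> * b)"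
    by (simp add: b power2_eq_square algebra_simps)
  finally show ?thesis
    unfolding J_map_g_elt[OF one_le_numeral] J_map_g_elt[OF order_refl] b_def by simp
qed

text \<open>The integrand is linear in each slot; tameness makes both summands integrable, so that
  the integral splits.\<close>

lemma iterated_integral_linear:
  fixes xs ys :: "(complex \<Rightarrow> complex) list"
  assumes \<epsilon>: "0 < \<epsilon>" "\<epsilon> < 1" "real (Suc (length xs + length ys)) * \<epsilon> < 1 / \<omega>"
    and tame: "\<And>\<psi>. \<psi> \<in> set xs \<union> set ys \<union> {f, g} \<Longrightarrow> tame \<psi>"
    and w: "\<And>t. w t = f t + h * g t"
  shows "iterated_integral \<epsilon> (xs @ w # ys) =
    iterated_integral \<epsilon> (xs @ f # ys) + h * iterated_integral \<epsilon> (xs @ g # ys)"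
proof -
  define n where "n = Suc (length xs + length ys)"
  define I where "I = (\<lambda>\<psi> y. (\<Prod>a<n. \<i> * kern (Complex (- \<epsilon>) (y a))) *
      (\<Prod>a<n. ((xs @ \<psi> # ys) ! a) (\<Sum>b\<le>a. Complex (- \<epsilon>) (y b))))"
  have eq: "iterated_integral \<epsilon> (xs @ \<psi> # ys) = (LINT y | Pi\<^sub>M {..<n} (\<lambda>_. lborel). I \<psi> y)" for \<psi>
    by (simp add: iterated_integral_def I_def n_def)
  have int: "integrable (Pi\<^sub>M {..<n} (\<lambda>_. lborel)) (I \<psi>)" if \<psi>: "\<psi> \<in> {f, g}" for \<psi>
  proof -
    have tm: "tame ((xs @ \<psi> # ys) ! a)" if "a < n" for a
    proof -
      have "(xs @ \<psi> # ys) ! a \<in> set (xs @ \<psi> # ys)" using that by (intro nth_mem) (simp add: n_def)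
      then show ?thesis using tame \<psi> by auto
    qed
    have c: "- 1 / \<omega> < - (real (Suc a) * \<epsilon>)" "- (real (Suc a) * \<epsilon>) < 0" if "a < n" for a
    proof -
      have "real (Suc a) * \<epsilon> \<le> real n * \<epsilon>" using that \<epsilon>(1) by (intro mult_right_mono) auto
      moreover have "real (Suc a) * \<epsilon> > 0" using \<epsilon>(1) by simp
      ultimately show "- 1 / \<omega> < - (real (Suc a) * \<epsilon>)" "- (real (Suc a) * \<epsilon>) < 0"
        using \<epsilon>(3) unfolding n_def
        by (simp_all only: minus_divide_left[symmetric] neg_less_iff_less neg_less_0_iff_less)
    qed
    have "\<exists>C. \<forall>y. norm (((xs @ \<psi> # ys) ! a) (Complex (- (real (Suc a) * \<epsilon>)) y)) \<le> C / (1 + exp (2 * pi * \<omega> * y))"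
      if "a < n" for a
      using tm[OF that] c[OF that] unfolding tame_def by blast
    then obtain C where C: "\<And>a y. a < n \<Longrightarrow> norm (((xs @ \<psi> # ys) ! a) (Complex (- (real (Suc a) * \<epsilon>)) y)) \<le>
        C a / (1 + exp (2 * pi * \<omega> * y))" by metis
    show ?thesis
      unfolding I_def
      by (rule integrable_iterated[OF \<epsilon>(1,2), of "2 * pi * \<omega>" n _ C])
        (use \<omega>_pos tm c C in \<open>auto simp: tame_def simp del: of_nat_Suc\<close>)
  qed
  have "I w y = I f y + h * I g y" for y
  proof -
    define k where "k = length xs"
    have k: "k \<in> {..<n}" by (simp add: k_def n_def)
    define R where "R = (\<Prod>a\<in>{..<n} - {k}. ((xs @ w # ys) ! a) (\<Sum>b\<le>a. Complex (- \<epsilon>) (y b)))"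
    have "(\<Prod>a<n. ((xs @ \<psi> # ys) ! a) (\<Sum>b\<le>a. Complex (- \<epsilon>) (y b))) = \<psi> (\<Sum>b\<le>k. Complex (- \<epsilon>) (y b)) * R" for \<psi>
    proof -
      have "(\<Prod>a\<in>{..<n} - {k}. ((xs @ \<psi> # ys) ! a) (\<Sum>b\<le>a. Complex (- \<epsilon>) (y b))) = R"
        unfolding R_def by (intro prod.cong) (auto simp: nth_append nth_Cons' k_def)
      then show ?thesis
        using prod.remove[OF _ k, of "\<lambda>a. ((xs @ \<psi> # ys) ! a) (\<Sum>b\<le>a. Complex (- \<epsilon>) (y b))"]
        by (simp add: k_def)
    qed
    then show ?thesis unfolding I_def by (simp only: w algebra_simps)
  qed
  then have "I w = (\<lambda>y. I f y + h * I g y)" by (rule ext)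
  then show ?thesis using int unfolding eq by simp
qed

text \<open>The expansion of e_2^r is undone letter by letter: in the slot behind the prefix
  \<open>xs\<close>, the contributions of g_2 and hbar g_1 combine to the weight. The prefix is
  general because the induction appends the chosen letter to it.\<close>

lemma lift_words_iterated_integral:
  assumes \<epsilon>: "0 < \<epsilon>" "\<epsilon> < 1" "real (length xs + r) * \<epsilon> < 1 / \<omega>"
    and tame: "\<And>\<psi>. \<psi> \<in> set xs \<Longrightarrow> tame \<psi>"
  shows "lift_words \<omega> (\<lambda>us. iterated_integral \<epsilon> (xs @ map (J_map \<omega>) us)) (e_elt 2 ^ r) =
    iterated_integral \<epsilon> (xs @ replicate r weight)"
  using \<epsilon>(3) tame
proof (induction r arbitrary: xs)
  case (Suc r)
  have IH: "lift_words \<omega> (\<lambda>us. iterated_integral \<epsilon> (xs @ J_map \<omega> (g_elt k) # map (J_map \<omega>) us)) (e_elt 2 ^ r) =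
      iterated_integral \<epsilon> (xs @ J_map \<omega> (g_elt k) # replicate r weight)" if "k \<ge> 1" for k
    using Suc.IH[of "xs @ [J_map \<omega> (g_elt k)]"] Suc.prems tame_J_map_g_elt[OF that] by force
  have "iterated_integral \<epsilon> (xs @ weight # replicate r weight) =
      iterated_integral \<epsilon> (xs @ J_map \<omega> (g_elt 2) # replicate r weight) +
      2 * pi * \<i> * \<omega> * iterated_integral \<epsilon> (xs @ J_map \<omega> (g_elt 1) # replicate r weight)"
    using \<epsilon> Suc.prems weight_eq_J_map
    by (intro iterated_integral_linear) (auto simp: tame_weight tame_J_map_g_elt)
  then show ?case using \<omega>_pos by (simp add: lift_words_e_elt_2 IH)
qed (simp add: lift_words_1)

text \<open>\<open>Z_map\<close> is only some map with the property \<open>is_Z\<close>; uniqueness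
  on \<open>H0_hat\<close> replaces it by the explicit functional \<open>lift_words\<close>.\<close>

lemma Z_map_e_elt_2_power:
  assumes "r \<ge> 1" "0 < \<epsilon> r" "\<epsilon> r < 1" "real r * \<epsilon> r < 1 / \<omega>"
  shows "Z_map \<omega> \<epsilon> (e_elt 2 ^ r) = Zfun r 0"
proof -
  define F where "F = (\<lambda>us. if us = [] then 1 else word_integral \<omega> (\<epsilon> (length us)) us)"
  have "is_Z \<omega> \<epsilon> (lift_words \<omega> F)"
    unfolding is_Z_def using \<omega>_pos
    by (auto simp: C_linear_on_lift_words lift_words_prod_list lift_words_1 F_def)
  from is_Z_unique[OF is_Z_Z_map this e_elt_2_power_in_H0_hat]
  have "Z_map \<omega> \<epsilon> (e_elt 2 ^ r) = lift_words \<omega> F (e_elt 2 ^ r)"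
    using \<omega>_pos by simp
  also have "\<dots> = lift_words \<omega> (\<lambda>us. iterated_integral (\<epsilon> r) ([] @ map (J_map \<omega>) us)) (e_elt 2 ^ r)"
    using assms(1) \<omega>_pos by (intro lift_words_e_elt_2_power_cong) (auto simp: F_def word_integral_eq)
  also have "\<dots> = iterated_integral (\<epsilon> r) ([] @ replicate r weight)"
    using assms by (intro lift_words_iterated_integral) auto
  also have "\<dots> = (LINT y | Pi\<^sub>M {..<r} (\<lambda>_. lborel). (\<Prod>a<r. \<i> * kern (Complex (- \<epsilon> r) (y a))) *
      (\<Prod>a<r. weight (\<Sum>b\<le>a. Complex (- \<epsilon> r) (y b))) * Zfun 0 (\<Sum>b<r. Complex (- \<epsilon> r) (y b)))"
    by (simp add: iterated_integral_def)
  also have "\<dots> = Zfun r 0"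
    using iterated_integral_Zfun[of "\<epsilon> r" r 0] assms by simp
  finally show ?thesis .
qed

end

section \<open>The closed form as a formal power series\<close>

lemma has_fps_expansion_Arcsin: "Arcsin has_fps_expansion fps_Arcsin"
proof -
  have "Arcsin holomorphic_on ball 0 1"
  proof (rule holomorphic_on_Arcsin)
    fix z :: complex assume "z \<in> ball 0 1"
    then show "\<bar>Re z\<bar> < 1" using abs_Re_le_cmod[of z] by simp
  qed
  then show ?thesis
    unfolding fps_Arcsin_def by (intro has_fps_expansion_fps_expansion) auto
qed

lemma fps_Arcsin_nth_0 [simp]: "fps_Arcsin $ 0 = 0"
  using has_fps_expansion_imp_0_eq_fps_nth_0[OF has_fps_expansion_Arcsin] by simp

lemma fps_sin_oo_Arcsin: "fps_sin 1 oo fps_Arcsin = fps_X"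
proof -
  have "(sin \<circ> Arcsin) has_fps_expansion (fps_sin 1 oo fps_Arcsin)"
    by (intro has_fps_expansion_compose has_fps_expansion_sin' has_fps_expansion_Arcsin) simp
  then have "(\<lambda>z::complex. z) has_fps_expansion (fps_sin 1 oo fps_Arcsin)"
    by (simp add: o_def)
  then show ?thesis
    using fps_expansion_unique_complex has_fps_expansion_fps_X by blast
qed

lemma fps_Arcsin_oo_sin: "fps_Arcsin oo fps_sin 1 = fps_X"
proof -
  have "(Arcsin \<circ> sin) has_fps_expansion (fps_Arcsin oo fps_sin 1)"
    by (intro has_fps_expansion_compose has_fps_expansion_sin' has_fps_expansion_Arcsin) simp
  note expansion = this
  have ev: "eventually (\<lambda>z. (Arcsin \<circ> sin) z = z) (nhds (0::complex))"
  proof -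
    have "eventually (\<lambda>z::complex. z \<in> ball 0 1) (nhds 0)"
      by (intro eventually_nhds_in_open) auto
    then show ?thesis
    proof eventually_elim
      case (elim z)
      then have "\<bar>Re z\<bar> < pi / 2" using abs_Re_le_cmod[of z] pi_gt3 by simp
      then show ?case by (simp add: Arcsin_sin)
    qed
  qed
  have "(\<lambda>z::complex. z) has_fps_expansion (fps_Arcsin oo fps_sin 1)"
    by (rule iffD1[OF has_fps_expansion_cong[OF ev refl] expansion])
  then show ?thesis
    using fps_expansion_unique_complex has_fps_expansion_fps_X by blast
qed

lemma fps_sin_oo_linear: "fps_sin (1::complex) oo (fps_const c * fps_X) = fps_sin c"
  by (rule fps_ext) (simp add: fps_nth_compose_linear fps_sin_def)

lemma fps_cos_oo_linear: "fps_cos (1::complex) oo (fps_const c * fps_X) = fps_cos c"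
  by (rule fps_ext) (simp add: fps_nth_compose_linear fps_cos_def)

lemma fps_uminus_eq_compose: "F $ 0 = 0 \<Longrightarrow> - F = (fps_const (- 1) * fps_X) oo (F :: complex fps)"
  by (simp add: fps_compose_mult_distrib fps_X_fps_compose_startby0 del: fps_const_neg) (simp add: fps_eq_iff)

lemma fps_sin_oo_uminus:
  assumes "F $ 0 = 0"
  shows "fps_sin (1::complex) oo (- F) = - (fps_sin 1 oo F)"
proof -
  have "fps_sin 1 oo (- F) = fps_sin 1 oo ((fps_const (- 1) * fps_X) oo F)"
    by (rule arg_cong[OF fps_uminus_eq_compose[OF assms]])
  also have "\<dots> = fps_sin (- 1) oo F"
    using assms by (subst fps_compose_assoc) (simp_all add: fps_sin_oo_linear del: fps_const_neg)
  also have "fps_sin (- 1 :: complex) = - fps_sin 1"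
    by (rule fps_ext) (auto simp: fps_sin_def)
  finally show ?thesis by (simp add: fps_compose_uminus)
qed

lemma fps_cos_oo_uminus:
  assumes "F $ 0 = 0"
  shows "fps_cos (1::complex) oo (- F) = fps_cos 1 oo F"
proof -
  have "fps_cos 1 oo (- F) = fps_cos 1 oo ((fps_const (- 1) * fps_X) oo F)"
    by (rule arg_cong[OF fps_uminus_eq_compose[OF assms]])
  also have "\<dots> = fps_cos (- 1) oo F"
    using assms by (subst fps_compose_assoc) (simp_all add: fps_cos_oo_linear del: fps_const_neg)
  also have "fps_cos (- 1 :: complex) = fps_cos 1"
    by (rule fps_ext) (auto simp: fps_cos_def)
  finally show ?thesis .
qed

text \<open>Residues are invariant under a formal change of variable: apart from \<open>P'/P\<close>, the terms
  \<open>P\<^sup>m P'\<close> are derivatives.\<close>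

lemma fls_residue_compose:
  fixes M P :: "complex fps"
  assumes P: "P $ 0 = 0" "P $ 1 \<noteq> 0"
  shows "fls_residue (fps_to_fls (M oo P) * fps_to_fls (fps_deriv P) * inverse (fps_to_fls P) ^ Suc n) = M $ n"
proof -
  define p where "p = fps_to_fls P"
  define q where "q = inverse p"
  have p: "p \<noteq> 0" using P by (auto simp: p_def)
  have pq: "p * q = 1" using p by (simp add: q_def)
  have deriv: "fls_deriv p = fps_to_fls (fps_deriv P)" by (simp add: p_def fls_deriv_fps_to_fls)
  have sub: "fls_subdegree p = 1"
  proof -
    have "subdegree P = 1" using P by (intro subdegreeI) auto
    then show ?thesis by (simp add: p_def fls_subdegree_fls_to_fps)
  qed
  have res: "fls_residue (p ^ j * fls_deriv p * q ^ Suc n) = (if j = n then 1 else 0)" if "j \<le> n" for j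
  proof (cases "j = n")
    case True
    have "p ^ n * fls_deriv p * q ^ Suc n = fls_deriv p * q * (p * q) ^ n"
      by (simp add: power_mult_distrib mult_ac)
    also have "\<dots> = fls_deriv p * q" by (simp only: pq power_one mult_1_right)
    finally have 1: "p ^ n * fls_deriv p * q ^ Suc n = fls_deriv p * q" .
    have "fls_residue (fls_deriv p * q) = 1"
      using fls_residue_deriv_times_inverse_eq_subdegree(1)[of p] sub
      by (simp add: q_def del: fls_residue_def)
    then show ?thesis by (simp only: True 1 if_True refl)
  next
    case False
    with that obtain m where m: "n = j + Suc m" using less_imp_Suc_add[of j n] by auto
    have "p ^ j * fls_deriv p * q ^ Suc n = fls_deriv p * q ^ Suc (Suc m) * (p * q) ^ j"
      by (simp add: m power_add power_mult_distrib mult_ac)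
    also have "\<dots> = fls_deriv p * q ^ Suc (Suc m)" by (simp add: pq)
    finally have 1: "p ^ j * fls_deriv p * q ^ Suc n = fls_deriv p * q ^ Suc (Suc m)" .
    have "fls_deriv (q ^ Suc m) = of_nat (Suc m) * q ^ m * (- fls_deriv p * q\<^sup>2)"
      by (simp add: fls_deriv_power q_def fls_inverse_deriv del: power_Suc of_nat_Suc)
    also have "\<dots> = - (of_nat (Suc m) * (fls_deriv p * q ^ Suc (Suc m)))"
      by (simp add: power2_eq_square mult_ac del: of_nat_Suc)
    finally have "fls_residue (of_nat (Suc m) * (fls_deriv p * q ^ Suc (Suc m))) = 0"
      using fls_residue_deriv[of "q ^ Suc m"] by simp
    moreover have "of_nat (Suc m) * (fls_deriv p * q ^ Suc (Suc m)) =
        fls_const (of_nat (Suc m)) * (fls_deriv p * q ^ Suc (Suc m))"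
      by (simp add: fls_of_nat)
    ultimately have "fls_residue (fls_deriv p * q ^ Suc (Suc m)) = 0"
      by (simp only: fls_residue_fls_const_times) (simp del: of_nat_Suc)
    then show ?thesis by (simp only: 1 False if_False)
  qed
  \<comment> \<open>Taylor remainder: the polynomial part contributes the coefficient of index n,
    the tail a power series without residue.\<close>
  define T where "T = fps_shift (Suc n) M"
  have M: "M = (\<Sum>j\<le>n. fps_const (M $ j) * fps_X ^ j) + fps_X ^ Suc n * T"
  proof (rule fps_ext)
    fix i
    show "M $ i = ((\<Sum>j\<le>n. fps_const (M $ j) * fps_X ^ j) + fps_X ^ Suc n * T) $ i"
      by (auto simp: T_def fps_sum_nth fps_X_power_mult_nth if_distrib[of "(*) _"] cong: if_cong simp del: power_Suc)
  qed
  have "M oo P = (\<Sum>j\<le>n. fps_const (M $ j) * P ^ j) + P ^ Suc n * (T oo P)"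
    using P by (subst M) (simp add: fps_compose_add_distrib fps_compose_sum_distrib
      fps_compose_mult_distrib fps_X_fps_compose_startby0 flip: fps_compose_power del: power_Suc)
  moreover have "fps_to_fls (\<Sum>j\<le>n. f j) = (\<Sum>j\<le>n. fps_to_fls (f j))" for f :: "nat \<Rightarrow> complex fps"
    by (induction n) auto
  ultimately have "fps_to_fls (M oo P) = (\<Sum>j\<le>n. fls_const (M $ j) * p ^ j) + p ^ Suc n * fps_to_fls (T oo P)"
    by (simp add: p_def fls_times_fps_to_fls fps_to_fls_power del: power_Suc)
  then have "fps_to_fls (M oo P) * fls_deriv p * q ^ Suc n =
      (\<Sum>j\<le>n. fls_const (M $ j) * (p ^ j * fls_deriv p * q ^ Suc n)) +
      (p * q) ^ Suc n * (fps_to_fls (T oo P) * fls_deriv p)"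
    by (simp only: distrib_left distrib_right sum_distrib_left sum_distrib_right power_mult_distrib mult_ac)
  also have "fls_residue \<dots> = (\<Sum>j\<le>n. M $ j * fls_residue (p ^ j * fls_deriv p * q ^ Suc n)) +
      fls_residue (fps_to_fls (T oo P) * fls_deriv p)"
  proof -
    have "fls_residue (\<Sum>j\<le>n. fls_const (M $ j) * A j) = (\<Sum>j\<le>n. M $ j * fls_residue (A j))" for A
      by (induction n) auto
    then show ?thesis by (simp only: fls_residue_add pq power_one mult_1)
  qed
  also have "fls_residue (fps_to_fls (T oo P) * fls_deriv p) = 0"
    unfolding deriv by (simp flip: fls_times_fps_to_fls)
  also have "(\<Sum>j\<le>n. M $ j * fls_residue (p ^ j * fls_deriv p * q ^ Suc n)) = M $ n"
    using res by (simp add: if_distrib[of "(*) _"] del: fls_residue_def power_Suc cong: if_cong)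
  finally show ?thesis unfolding deriv by (simp add: p_def q_def)
qed

text \<open>The equation is shared by \<theta>' (with c = 0) and \<theta> \<theta>' (with c = K^2),
  see \<open>\<theta>_ode\<close>. The recursion yields the parity of both series and the
  coefficients of \<open>V\<close>.\<close>

lemma fps_ode_arcsin_nth:
  fixes F :: "complex fps"
  assumes "(1 - fps_const (K\<^sup>2) * fps_X\<^sup>2) * fps_deriv F = fps_const c + fps_const (K\<^sup>2) * fps_X * F"
  shows "F $ 1 = c" "of_nat (n + 2) * F $ (n + 2) = K\<^sup>2 * of_nat (n + 1) * F $ n"
proof -
  have eq: "fps_deriv F = fps_const c + fps_const (K\<^sup>2) * (fps_X * F) + fps_const (K\<^sup>2) * (fps_X * (fps_X * fps_deriv F))"
    using assms by (simp add: algebra_simps power2_eq_square)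
  show "F $ 1 = c" using arg_cong[OF eq, of "\<lambda>f. f $ 0"] by simp
  have "fps_deriv F $ Suc n = K\<^sup>2 * F $ n + K\<^sup>2 * (of_nat n * F $ n)"
    by (subst eq) (cases n; simp add: fps_X_mult_nth)
  then show "of_nat (n + 2) * F $ (n + 2) = K\<^sup>2 * of_nat (n + 1) * F $ n"
    by (simp add: algebra_simps)
qed

section \<open>The arcsine series and the logarithmic derivative of the closed form\<close>

context omega
begin

text \<open>In the variable \<open>X\<close> of the theorem, \<open>\<theta> = arcsin (\<pi>\<i>\<omega>X)\<close>, and \<open>P\<close> is the inverse series of \<open>\<theta> / (\<pi>\<omega>)\<close>.
  The logarithmic derivative of the closed form is \<open>N - 1 - V\<close>, where \<open>N\<close> collects the residues
  and \<open>V\<close> the integrals of the powers of the weight.\<close>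

definition K :: complex where "K = pi * \<i> * \<omega>"

definition \<theta> :: "complex fps" where "\<theta> = fps_Arcsin oo (fps_const K * fps_X)"

definition P :: "complex fps" where "P = fps_const (1 / K) * fps_sin (pi * \<omega>)"

definition \<phi> :: "complex fps" where "\<phi> = fps_const (1 / of_real \<omega>) * \<theta>"

abbreviation Sn :: "complex fps" where "Sn \<equiv> fps_sin 1 oo \<phi>"

abbreviation Cs :: "complex fps" where "Cs \<equiv> fps_cos 1 oo \<phi>"

definition N :: "complex fps" where "N = (fps_const (1 / of_real \<omega>) * fps_X * fps_deriv \<theta> * Cs) / Sn"

definition V :: "complex fps" where "V = fps_const (2 / K) * fps_X * (\<theta> * fps_deriv \<theta>)"

lemma K_nonzero [simp]: "K \<noteq> 0" using \<omega>_pos by (simp add: K_def)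

lemma \<theta>_nth_0 [simp]: "\<theta> $ 0 = 0" by (simp add: \<theta>_def)

lemma \<phi>_nth_0 [simp]: "\<phi> $ 0 = 0" by (simp add: \<phi>_def)

lemma deriv_\<phi>: "fps_deriv \<phi> = fps_const (1 / of_real \<omega>) * fps_deriv \<theta>" by (simp add: \<phi>_def)

lemma sin_\<theta>: "fps_sin 1 oo \<theta> = fps_const K * fps_X"
  unfolding \<theta>_def
  by (subst fps_compose_assoc) (simp_all add: fps_sin_oo_Arcsin fps_X_fps_compose_startby0)

lemma cos_\<theta>: "(fps_cos 1 oo \<theta>) * fps_deriv \<theta> = fps_const K"
    "(fps_cos 1 oo \<theta>)\<^sup>2 = 1 - fps_const (K\<^sup>2) * fps_X\<^sup>2"
proof -
  show "(fps_cos 1 oo \<theta>) * fps_deriv \<theta> = fps_const K"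
    using arg_cong[OF sin_\<theta>, of fps_deriv] by (simp add: fps_compose_deriv fps_sin_deriv)
  have "(fps_cos 1 oo \<theta>)\<^sup>2 + (fps_sin 1 oo \<theta>)\<^sup>2 = ((fps_cos 1)\<^sup>2 + (fps_sin 1)\<^sup>2) oo \<theta>"
    by (simp add: fps_compose_add_distrib fps_compose_power)
  then show "(fps_cos 1 oo \<theta>)\<^sup>2 = 1 - fps_const (K\<^sup>2) * fps_X\<^sup>2"
    unfolding fps_sin_cos_sum_of_squares sin_\<theta>
    by (simp add: power_mult_distrib eq_diff_eq fps_const_power)
qed

lemma \<theta>_nth_1: "\<theta> $ 1 = K"
  using arg_cong[OF cos_\<theta>(1), of "\<lambda>f. f $ 0"] by simp

text \<open>Differentiate cos \<theta> \<cdot> \<theta>' = K and multiply by cos \<theta>; then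
  cos^2 \<theta> = 1 - K^2 X^2 eliminates the cosine.\<close>

lemma \<theta>_ode:
  "(1 - fps_const (K\<^sup>2) * fps_X\<^sup>2) * fps_deriv (fps_deriv \<theta>) = fps_const 0 + fps_const (K\<^sup>2) * fps_X * fps_deriv \<theta>"
  "(1 - fps_const (K\<^sup>2) * fps_X\<^sup>2) * fps_deriv (\<theta> * fps_deriv \<theta>) =
    fps_const (K\<^sup>2) + fps_const (K\<^sup>2) * fps_X * (\<theta> * fps_deriv \<theta>)"
proof -
  define C t where "C = fps_cos 1 oo \<theta>" and "t = fps_deriv \<theta>"
  note cos = cos_\<theta>[folded C_def t_def]
  have "fps_deriv C = - (fps_const K * fps_X * t)"
    unfolding C_def t_def
    by (simp add: fps_compose_deriv fps_cos_deriv fps_compose_mult_distrib sin_\<theta> fps_compose_uminus flip: fps_const_neg)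
  then have "C * fps_deriv t = fps_const K * fps_X * t * t"
    using arg_cong[OF cos(1), of fps_deriv] by (simp add: add_eq_0_iff)
  then have "C\<^sup>2 * fps_deriv t = fps_const K * fps_X * t * (C * t)"
    by (simp add: power2_eq_square mult_ac)
  then have C2: "C\<^sup>2 * fps_deriv t = fps_const (K\<^sup>2) * fps_X * t"
    unfolding cos(1) by (simp add: power2_eq_square mult_ac flip: fps_const_mult)
  then show "(1 - fps_const (K\<^sup>2) * fps_X\<^sup>2) * fps_deriv (fps_deriv \<theta>) = fps_const 0 + fps_const (K\<^sup>2) * fps_X * fps_deriv \<theta>"
    unfolding cos(2) t_def by simp
  have "C\<^sup>2 * fps_deriv (\<theta> * t) = (C * t)\<^sup>2 + \<theta> * (C\<^sup>2 * fps_deriv t)"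
    by (simp add: t_def power2_eq_square algebra_simps)
  also have "\<dots> = fps_const (K\<^sup>2) + \<theta> * (fps_const (K\<^sup>2) * fps_X * t)"
    by (simp only: C2 cos(1) fps_const_power)
  finally show "(1 - fps_const (K\<^sup>2) * fps_X\<^sup>2) * fps_deriv (\<theta> * fps_deriv \<theta>) =
      fps_const (K\<^sup>2) + fps_const (K\<^sup>2) * fps_X * (\<theta> * fps_deriv \<theta>)"
    by (simp only: cos(2) t_def mult_ac)
qed

text \<open>The recursion for \<theta>' starts its odd coefficients at c = 0, so \<theta>' is even
  and \<theta>, which has no constant term, is odd.\<close>

lemma \<theta>_uminus: "\<theta> oo (- fps_X) = - \<theta>"
proof -
  have odd: "fps_deriv \<theta> $ (2 * n + 1) = 0" for n
  proof (induction n)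
    case 0
    then show ?case using fps_ode_arcsin_nth(1)[OF \<theta>_ode(1)] by simp
  next
    case (Suc n)
    have "of_nat (2 * n + 1 + 2) * fps_deriv \<theta> $ (2 * n + 1 + 2) = 0"
      unfolding fps_ode_arcsin_nth(2)[OF \<theta>_ode(1)] Suc.IH by simp
    then have "fps_deriv \<theta> $ (2 * n + 1 + 2) = 0"
      unfolding mult_eq_0_iff of_nat_eq_0_iff by simp
    then show ?case by (simp add: numeral_eq_Suc)
  qed
  have even: "\<theta> $ n = 0" if "even n" for n
  proof (cases n)
    case (Suc m)
    with that obtain k where "m = 2 * k + 1" by (metis even_Suc oddE)
    then show ?thesis using odd[of k] Suc by (simp del: of_nat_Suc add: fps_deriv_nth)
  qed simp
  have "- fps_X = fps_const (- 1) * (fps_X :: complex fps)" by simp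
  then have "\<theta> oo (- fps_X) = \<theta> oo (fps_const (- 1) * fps_X)" by (rule arg_cong)
  also have "\<dots> = - \<theta>"
  proof (rule fps_ext)
    fix n show "(\<theta> oo (fps_const (- 1) * fps_X)) $ n = (- \<theta>) $ n"
      unfolding fps_nth_compose_linear using even[of n] by (cases "even n") auto
  qed
  finally show ?thesis .
qed

lemma Sn_nth: "Sn $ 0 = 0" "Sn $ 1 = K / \<omega>"
proof -
  show "Sn $ 0 = 0" by simp
  have "fps_deriv Sn $ 0 = K / \<omega>"
    using \<theta>_nth_1 by (simp add: fps_compose_deriv fps_sin_deriv deriv_\<phi>)
  then show "Sn $ 1 = K / \<omega>" by simp
qed

lemma Sn_nonzero: "Sn \<noteq> 0"
  using Sn_nth(2) \<omega>_pos by auto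

text \<open>The quotient defining \<open>N\<close> is exact: \<open>Sn\<close> vanishes to first
  order at 0, and the numerator contains a factor X.\<close>

lemma N_mult_Sn: "N * Sn = fps_const (1 / of_real \<omega>) * fps_X * fps_deriv \<theta> * Cs"
proof -
  have "subdegree Sn = 1" using Sn_nth \<omega>_pos by (intro subdegreeI) auto
  moreover have "1 \<le> subdegree (fps_const (1 / of_real \<omega>) * fps_X * fps_deriv \<theta> * Cs)"
    if "fps_const (1 / of_real \<omega>) * fps_X * fps_deriv \<theta> * Cs \<noteq> 0"
    using that by (intro subdegree_geI) auto
  ultimately have "Sn dvd fps_const (1 / of_real \<omega>) * fps_X * fps_deriv \<theta> * Cs"
    using Sn_nonzero by (cases "fps_const (1 / of_real \<omega>) * fps_X * fps_deriv \<theta> * Cs = 0") (auto simp: fps_dvd_iff)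
  then show ?thesis by (simp add: N_def)
qed

lemma N_nth_0: "N $ 0 = 1"
proof -
  have "(N * Sn) $ 1 = N $ 0 * (K / \<omega>)"
    using Sn_nth by (simp add: fps_mult_nth)
  moreover have "(fps_const (1 / of_real \<omega>) * fps_X * fps_deriv \<theta> * Cs) $ 1 = K / \<omega>"
    using \<theta>_nth_1 by (simp add: mult.assoc)
  ultimately show ?thesis unfolding N_mult_Sn using \<omega>_pos by simp
qed

text \<open>Under X \<mapsto> -X both \<open>Sn\<close> and X change sign while \<open>Cs\<close>
  and \<theta>' are preserved.\<close>

lemma N_nth_odd: "odd n \<Longrightarrow> N $ n = 0"
proof -
  assume "odd n"
  define m :: "complex fps" where "m = - fps_X"
  have m0: "m $ 0 = 0" by (simp add: m_def)
  have sc: "\<phi> oo m = - \<phi>"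
    using \<theta>_uminus by (simp add: \<phi>_def fps_compose_mult_distrib m_def)
  have S: "Sn oo m = - Sn"
    using fps_sin_oo_uminus[of \<phi>] by (simp add: m0 sc flip: fps_compose_assoc)
  have C: "Cs oo m = Cs"
    using fps_cos_oo_uminus[of \<phi>] by (simp add: m0 sc flip: fps_compose_assoc)
  have "fps_deriv (\<theta> oo m) = - fps_deriv \<theta>" using \<theta>_uminus by (simp add: m_def)
  then have D: "fps_deriv \<theta> oo m = fps_deriv \<theta>" by (simp add: fps_compose_deriv m0) (simp add: m_def)
  have "(N oo m) * (- Sn) = (N * Sn) oo m" by (simp add: fps_compose_mult_distrib m0 S)
  also have "\<dots> = - (N * Sn)"
    unfolding N_mult_Sn by (simp add: fps_compose_mult_distrib m0 C D fps_X_fps_compose_startby0) (simp add: m_def)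
  finally have "(N oo m) * Sn = N * Sn" by simp
  then have "N oo m = N" using Sn_nonzero by simp
  moreover have "m = fps_const (- 1) * fps_X" by (simp add: m_def)
  ultimately have "(N oo (fps_const (- 1) * fps_X)) $ n = N $ n" by (simp only:)
  then show ?thesis unfolding fps_nth_compose_linear using \<open>odd n\<close> by simp
qed

lemma V_nth_0: "V $ 0 = 0" by (simp add: V_def)

lemma V_nth_odd: "odd n \<Longrightarrow> V $ n = 0"
proof -
  have even: "(\<theta> * fps_deriv \<theta>) $ (2 * k) = 0" for k
  proof (induction k)
    case (Suc k)
    have "of_nat (2 * k + 2) * (\<theta> * fps_deriv \<theta>) $ (2 * k + 2) = 0"
      unfolding fps_ode_arcsin_nth(2)[OF \<theta>_ode(2)] Suc.IH by simp
    then have "(\<theta> * fps_deriv \<theta>) $ (2 * k + 2) = 0"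
      unfolding mult_eq_0_iff of_nat_eq_0_iff by simp
    then show ?case by simp
  qed simp
  assume "odd n"
  then obtain k where "n = 2 * k + 1" by (rule oddE)
  then show ?thesis using even[of k] by (simp add: V_def mult.assoc fps_X_mult_nth)
qed

text \<open>Matches, up to alternating signs, the reduction formula for the integrals of powers of
  the weight in \<open>vint_weight_power\<close>.\<close>

lemma V_nth_even:
  "V $ 2 = 2 * K" "V $ (2 * k + 4) = K\<^sup>2 * (of_nat (2 * k + 2) / of_nat (2 * k + 3)) * V $ (2 * k + 2)"
proof -
  define U where "U = \<theta> * fps_deriv \<theta>"
  have V: "V $ Suc n = 2 / K * U $ n" for n by (simp add: V_def U_def mult.assoc)
  note rec = fps_ode_arcsin_nth[OF \<theta>_ode(2), folded U_def]
  show "V $ 2 = 2 * K" using V[of 1] rec(1) by (simp add: numeral_2_eq_2 power2_eq_square)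
  have "of_nat (2 * k + 3) * U $ (2 * k + 3) = K\<^sup>2 * of_nat (2 * k + 2) * U $ (2 * k + 1)"
    using rec(2)[of "2 * k + 1"] by (simp add: numeral_eq_Suc)
  then have "U $ (2 * k + 3) = K\<^sup>2 * (of_nat (2 * k + 2) / of_nat (2 * k + 3)) * U $ (2 * k + 1)"
    by (simp add: field_simps del: of_nat_add of_nat_mult)
  moreover have "V $ (2 * k + 4) = 2 / K * U $ (2 * k + 3)" "V $ (2 * k + 2) = 2 / K * U $ (2 * k + 1)"
    using V[of "2 * k + 3"] V[of "2 * k + 1"] by (simp_all add: numeral_eq_Suc)
  ultimately show "V $ (2 * k + 4) = K\<^sup>2 * (of_nat (2 * k + 2) / of_nat (2 * k + 3)) * V $ (2 * k + 2)"
    by (simp only: mult_ac)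
qed

lemma P_nth: "P $ 0 = 0" "P $ 1 \<noteq> 0"
  using \<omega>_pos by (simp_all add: P_def)

lemma \<theta>_oo_P: "\<theta> oo P = fps_const (pi * \<omega>) * fps_X"
proof -
  have "\<theta> oo P = fps_Arcsin oo (fps_sin (pi * \<omega>))"
    unfolding \<theta>_def using P_nth
    by (subst fps_compose_assoc[symmetric])
      (simp_all add: fps_compose_mult_distrib fps_X_fps_compose_startby0, simp add: P_def flip: mult.assoc)
  also have "\<dots> = fps_X oo (fps_const (pi * \<omega>) * fps_X)"
    unfolding fps_sin_oo_linear[of "of_real (pi * \<omega>)", symmetric]
    by (subst fps_compose_assoc) (simp_all add: fps_Arcsin_oo_sin)
  finally show ?thesis by (simp add: fps_X_fps_compose_startby0)
qed

text \<open>Cleared of denominators, this says (N \<circ> P) P'/P = pi cot (pi s), which is 2 pi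
  \<i> times the odd part kern(s) + 1/2 of the kernel.\<close>

lemma N_oo_P: "(N oo P) * fps_deriv P * fps_sin pi = fps_const pi * P * fps_cos pi"
proof -
  have sc: "\<phi> oo P = fps_const pi * fps_X"
    using \<omega>_pos P_nth(1) by (simp add: \<phi>_def fps_compose_mult_distrib \<theta>_oo_P flip: mult.assoc)
  have S: "Sn oo P = fps_sin pi" "Cs oo P = fps_cos pi"
    using P_nth(1) by (simp_all add: sc fps_sin_oo_linear fps_cos_oo_linear flip: fps_compose_assoc)
  have D: "(fps_deriv \<theta> oo P) * fps_deriv P = fps_const (pi * \<omega>)"
    using arg_cong[OF \<theta>_oo_P, of fps_deriv] P_nth(1) by (simp add: fps_compose_deriv)
  have "(N oo P) * fps_deriv P * fps_sin pi = ((N * Sn) oo P) * fps_deriv P"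
    using P_nth(1) by (simp add: fps_compose_mult_distrib S mult_ac)
  also have "\<dots> = fps_const (1 / of_real \<omega>) * P * ((fps_deriv \<theta> oo P) * fps_deriv P) * fps_cos pi"
    unfolding N_mult_Sn using P_nth(1)
    by (simp add: fps_compose_mult_distrib fps_X_fps_compose_startby0 S mult_ac)
  also have "\<dots> = fps_const (1 / of_real \<omega> * (pi * \<omega>)) * P * fps_cos pi"
    unfolding D by (simp add: mult_ac flip: fps_const_mult)
  finally show ?thesis using \<omega>_pos by simp
qed

definition closed_form :: "complex fps" where
  "closed_form = Sn / (fps_const (pi * \<i>) * fps_X) * (fps_exp 1 oo (- (\<theta>\<^sup>2 / fps_const K)))"

text \<open>One summand of the logarithmic derivative for each factor: \<open>N\<close> from
  \<open>Sn\<close>, -1 from the division by X, and -V from the exponential of -\<theta>^2 /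
  K.\<close>

lemma closed_form_ode:
  "fps_X * fps_deriv closed_form = closed_form * (N - 1 - V)" "closed_form $ 0 = 1"
proof -
  define E where "E = fps_exp 1 oo (- (\<theta>\<^sup>2 / fps_const K))"
  have E0: "(- (\<theta>\<^sup>2 / fps_const K)) $ 0 = 0" by (simp add: power2_eq_square)
  have E': "fps_deriv E = - (fps_const (2 / K) * \<theta> * fps_deriv \<theta> * E)"
  proof -
    have "fps_deriv (\<theta>\<^sup>2 / fps_const K) = fps_const (2 / K) * \<theta> * fps_deriv \<theta>"
    proof -
      have "\<theta>\<^sup>2 / fps_const K = fps_const (1 / K) * \<theta>\<^sup>2"
        by (simp add: fps_divide_unit fps_const_inverse inverse_eq_divide mult.commute)
      then have "fps_deriv (\<theta>\<^sup>2 / fps_const K) = fps_const (1 / K) * (2 * \<theta> * fps_deriv \<theta>)"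
        by (simp add: power2_eq_square)
      also have "\<dots> = (fps_const (1 / K) * 2) * \<theta> * fps_deriv \<theta>" by (simp only: mult_ac)
      also have "fps_const (1 / K) * 2 = fps_const (2 / K)"
        by (simp add: numeral_fps_const)
      finally show ?thesis .
    qed
    then show ?thesis
      unfolding E_def using E0 by (simp add: fps_compose_deriv mult_ac)
  qed
  have dvd: "fps_const (pi * \<i>) * fps_X dvd Sn"
  proof -
    have "subdegree (fps_const (pi * \<i>) * fps_X) = 1" by simp
    moreover have "subdegree Sn = 1" using Sn_nth \<omega>_pos by (intro subdegreeI) auto
    ultimately show ?thesis using Sn_nonzero by (simp add: fps_dvd_iff)
  qed
  have R: "closed_form * (fps_const (pi * \<i>) * fps_X) = Sn * E"
  proof -
    have "closed_form * (fps_const (pi * \<i>) * fps_X) =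
        (Sn / (fps_const (pi * \<i>) * fps_X) * (fps_const (pi * \<i>) * fps_X)) * E"
      by (simp only: closed_form_def E_def mult_ac)
    then show ?thesis unfolding dvd_div_mult_self[OF dvd] .
  qed
  have S': "fps_deriv Sn = fps_const (1 / of_real \<omega>) * Cs * fps_deriv \<theta>"
    by (simp add: fps_compose_deriv fps_sin_deriv deriv_\<phi> mult_ac)
  have "fps_const (pi * \<i>) * fps_X * (closed_form + fps_X * fps_deriv closed_form) =
      fps_X * fps_deriv (closed_form * (fps_const (pi * \<i>) * fps_X))"
    by (simp add: algebra_simps)
  also have "\<dots> = (fps_const (1 / of_real \<omega>) * fps_X * fps_deriv \<theta> * Cs) * E - V * (Sn * E)"
    unfolding R by (simp add: S' E' V_def algebra_simps)
  also have "\<dots> = (N - V) * (closed_form * (fps_const (pi * \<i>) * fps_X))"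
    unfolding N_mult_Sn[symmetric] R by (simp only: left_diff_distrib mult.assoc)
  also have "\<dots> = (fps_const (pi * \<i>) * fps_X) * ((N - V) * closed_form)"
    by (simp only: mult_ac)
  finally have "closed_form + fps_X * fps_deriv closed_form = (N - V) * closed_form"
    by simp
  then show "fps_X * fps_deriv closed_form = closed_form * (N - 1 - V)"
    by (simp add: algebra_simps)
  have "closed_form $ 0 * (pi * \<i>) = (closed_form * (fps_const (pi * \<i>) * fps_X)) $ 1"
    by (simp add: fps_mult_nth)
  also have "\<dots> = K / \<omega>" unfolding R using Sn_nth by (simp add: fps_mult_nth E_def)
  finally show "closed_form $ 0 = 1" using \<omega>_pos by (simp add: K_def)
qed

end

section \<open>The integrals of the powers of the weight\<close>

text \<open>Fundamental theorem on [-N, N]: the chain rule for y \<mapsto> c + \<i> y produces the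
  factor \<i> of \<open>vint\<close>, and the limits at both ends give the boundary terms.\<close>

lemma vint_derivative:
  assumes deriv: "\<And>y. (f has_field_derivative g (Complex c y)) (at (Complex c y))"
    and int: "vintegrable c g"
    and lim: "((\<lambda>y. f (Complex c y)) \<longlongrightarrow> A) at_top" "((\<lambda>y. f (Complex c y)) \<longlongrightarrow> B) at_bot"
  shows "vint c g = A - B"
proof -
  have vec: "((\<lambda>y. f (Complex c y)) has_vector_derivative (\<i> * g (Complex c y))) (at y within S)" for y S
  proof -
    have "(Complex c has_vector_derivative \<i>) (at y within S)"
      unfolding Complex_eq by (auto intro!: derivative_eq_intros simp: has_vector_derivative_def scaleR_conv_of_real)
    from field_vector_diff_chain_within[OF this DERIV_subset[OF deriv[of y]]]
    show ?thesis by (simp add: o_def)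
  qed
  have *: "((\<lambda>y. \<i> * g (Complex c y)) has_integral (f (Complex c N) - f (Complex c (- N)))) {-N..N}" if "N \<ge> 0" for N
    using vec that by (intro fundamental_theorem_of_calculus) auto
  have eq: "integral {-N..N} (\<lambda>y. \<i> * g (Complex c y)) = f (Complex c N) - f (Complex c (- N))" if "N \<ge> 0" for N
    using integral_unique[OF *[OF that]] .
  have "integrable lborel (\<lambda>y. \<i> * g (Complex c y))"
    using int by (simp add: vintegrable_def)
  from tendsto_integral_symmetric_interval[OF this]
  have "((\<lambda>N. integral {-N..N} (\<lambda>y. \<i> * g (Complex c y))) \<longlongrightarrow> vint c g) at_top"
    by (simp add: vint_def)
  moreover have "eventually (\<lambda>N. integral {-N..N} (\<lambda>y. \<i> * g (Complex c y)) = f (Complex c N) - f (Complex c (- N))) at_top"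
    using eventually_ge_at_top[of 0] by eventually_elim (rule eq)
  ultimately have "((\<lambda>N. f (Complex c N) - f (Complex c (- N))) \<longlongrightarrow> vint c g) at_top"
    by (simp add: tendsto_cong)
  moreover have "((\<lambda>N. f (Complex c N) - f (Complex c (- N))) \<longlongrightarrow> A - B) at_top"
    by (intro tendsto_diff lim(1) filterlim_compose[OF lim(2)] filterlim_uminus_at_bot_at_top)
  ultimately show ?thesis by (rule tendsto_unique[rotated]) simp
qed

lemma kern_half_eq_cot:
  fixes s :: complex
  assumes "s \<notin> \<int>"
  shows "kern s + 1 / 2 = cos (of_real pi * s) / (2 * \<i> * sin (of_real pi * s))"
proof -
  define x where "x = exp (\<i> * (of_real pi * s))"
  have x: "x \<noteq> 0" by (simp add: x_def)
  have "exp (2 * pi * \<i> * s) = x * x" by (simp add: x_def algebra_simps flip: exp_add)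
  then have kern: "kern s = 1 / (x * x - 1)" and x1: "x * x \<noteq> 1"
    using exp_2pi_i_eq_1_iff[of s] assms by (auto simp: kern_def)
  have inv: "exp (- (\<i> * (of_real pi * s))) = 1 / x" by (simp add: x_def exp_minus inverse_eq_divide)
  have "cos (of_real pi * s) / (2 * \<i> * sin (of_real pi * s)) = ((x + 1 / x) / 2) / (x - 1 / x)"
    unfolding sin_exp_eq cos_exp_eq inv x_def[symmetric] by simp
  also have "\<dots> = (x * x + 1) / (2 * (x * x - 1))" using x x1 by (simp add: field_simps)
  also have "\<dots> = 1 / (x * x - 1) + 1 / 2" using x1 by (simp add: field_simps)
  finally show ?thesis by (simp add: kern)
qed

context omega
begin

lemma weight_uminus: "weight (- s) = weight s"
  by (simp add: weight_def mult.commute)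

lemma weight_eq_sin: "weight s = of_real ((pi * \<omega>)\<^sup>2) / (sin (of_real (pi * \<omega>) * s))\<^sup>2"
proof -
  define x where "x = exp (\<i> * (of_real (pi * \<omega>) * s))"
  have x: "x \<noteq> 0" by (simp add: x_def)
  have e: "exp (2 * pi * \<i> * (of_real \<omega> * s)) = x * x" by (simp add: x_def algebra_simps flip: exp_add)
  have e': "exp (2 * pi * \<i> * (- of_real \<omega> * s)) = 1 / (x * x)"
    using e by (simp add: exp_minus inverse_eq_divide)
  have inv: "exp (- (\<i> * (of_real (pi * \<omega>) * s))) = 1 / x" by (simp add: x_def exp_minus inverse_eq_divide)
  have sin: "(sin (of_real (pi * \<omega>) * s))\<^sup>2 = - (x - 1 / x)\<^sup>2 / 4"
    unfolding sin_exp_eq inv x_def[symmetric] by (simp add: power_divide power_mult_distrib)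
  have "kern (of_real \<omega> * s) * kern (- of_real \<omega> * s) = 1 / (x * x - 1) * (1 / (1 / (x * x) - 1))"
    unfolding kern_def e e' ..
  also have "\<dots> = - 1 / (x - 1 / x)\<^sup>2"
  proof (cases "x * x = 1")
    case True
    then have "x - 1 / x = 0" using x by (simp add: field_simps)
    then show ?thesis using True by simp
  next
    case False
    define u where "u = x * x - 1"
    have u: "u \<noteq> 0" using False by (simp add: u_def)
    have "(x - 1 / x)\<^sup>2 = u\<^sup>2 / (x * x)" "1 / (x * x) - 1 = - (u / (x * x))"
      using x by (simp_all add: u_def field_simps power2_eq_square)
    then show ?thesis using u unfolding u_def[symmetric] by (simp add: power2_eq_square)
  qed
  finally show ?thesis unfolding weight_def sin by (simp add: power_mult_distrib)
qed

text \<open>Complements \<open>weight_bound\<close> for the strip around the pole at 0: here the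
  real part is arbitrary, but the point is far from the real axis.\<close>

lemma weight_bound_far:
  assumes "\<bar>\<omega> * Im s\<bar> \<ge> 1"
  shows "norm (weight s) \<le> 4 * (2 * pi * \<omega>)\<^sup>2 * exp (- (2 * pi * \<omega> * \<bar>Im s\<bar>))"
proof -
  define x where "x = 2 * pi * \<omega> * Im s"
  have 1: "norm (kern (of_real \<omega> * s)) \<le> 2 / (1 + exp (- x))"
    using norm_kern_le_far[of "of_real \<omega> * s"] assms by (simp add: x_def mult.assoc)
  have 2: "norm (kern (- of_real \<omega> * s)) \<le> 2 / (1 + exp x)"
    using norm_kern_le_far[of "- of_real \<omega> * s"] assms by (simp add: x_def mult.assoc)
  note 3 = inverse_one_plus_exp_mult_le[of x]
  have "norm (weight s) = (2 * pi * \<omega>)\<^sup>2 * (norm (kern (of_real \<omega> * s)) * norm (kern (- of_real \<omega> * s)))"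
    using \<omega>_pos by (simp add: weight_def norm_mult norm_power)
  also have "\<dots> \<le> (2 * pi * \<omega>)\<^sup>2 * (2 / (1 + exp (- x)) * (2 / (1 + exp x)))"
    by (intro mult_left_mono mult_mono 1 2) (auto intro!: divide_nonneg_nonneg add_nonneg_nonneg)
  also have "\<dots> = 4 * (2 * pi * \<omega>)\<^sup>2 * (1 / (1 + exp (- x)) * (1 / (1 + exp x)))"
    by simp
  also have "\<dots> \<le> 4 * (2 * pi * \<omega>)\<^sup>2 * exp (- \<bar>x\<bar>)"
    by (intro mult_left_mono 3) auto
  also have "\<bar>x\<bar> = 2 * pi * \<omega> * \<bar>Im s\<bar>" using \<omega>_pos by (simp add: x_def abs_mult)
  finally show ?thesis .
qed

lemma vintegrable_weight_power:
  assumes "- 1 / \<omega> < c" "c < 0" "k \<ge> 1"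
  shows "vintegrable c (\<lambda>z. weight z ^ k)"
proof -
  interpret cauchy_transform "1 / \<omega>" "2 * pi * \<omega>" "\<lambda>s. weight s ^ k"
    using assms(3) by (rule cauchy_transform_weight)
  have c: "- (1 / \<omega>) < c" using assms(1) by simp
  obtain C where C: "\<And>s. c \<le> Re s \<Longrightarrow> Re s \<le> c \<Longrightarrow> norm (weight s ^ k) \<le> C * exp (- (2 * pi * \<omega> * \<bar>Im s\<bar>))"
    using bound_u'[OF c assms(2)] by blast
  show ?thesis
    unfolding vintegrable_def
  proof (rule integrable_exp_bound[of "2 * pi * \<omega>"])
    show "(\<lambda>y. weight (Complex c y) ^ k) \<in> borel_measurable borel"
      using weight_line(1)[OF assms(1,2)] by measurable
    show "norm (weight (Complex c y) ^ k) \<le> C * exp (- (2 * pi * \<omega> * \<bar>y\<bar>))" for y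
      using C[of "Complex c y"] by simp
  qed (use \<omega>_pos in simp)
qed

text \<open>Boundary values for the antiderivatives in \<open>vint_weight_power\<close>. The upper
  limit is reduced to a decay estimate by kern(-t) = -1 - kern(t).\<close>

lemma kern_line_limits:
  assumes c: "- 1 / \<omega> < c" "c < 0"
  shows "((\<lambda>y. kern (of_real \<omega> * Complex c y)) \<longlongrightarrow> 0) at_bot"
    and "((\<lambda>y. kern (of_real \<omega> * Complex c y)) \<longlongrightarrow> - 1) at_top"
proof -
  have notint: "\<omega> * c \<notin> \<int>" using c \<omega>_pos by (intro not_Ints_\<omega>_mult) (auto intro: less_trans[of _ 0])
  have lim: "((\<lambda>y. C / (1 + exp (- (2 * pi * (\<omega> * y))))) \<longlongrightarrow> 0) at_bot"
    "((\<lambda>y. C / (1 + exp (2 * pi * (\<omega> * y)))) \<longlongrightarrow> 0) at_top" for C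
    using \<omega>_pos by real_asymp+
  have "norm (kern (of_real \<omega> * Complex c y)) \<le> 1 / \<bar>sin (pi * (\<omega> * c))\<bar> / (1 + exp (- (2 * pi * (\<omega> * y))))" for y
    using norm_kern_le_sin[of "of_real \<omega> * Complex c y"] notint by simp
  then show "((\<lambda>y. kern (of_real \<omega> * Complex c y)) \<longlongrightarrow> 0) at_bot"
    by (intro Lim_null_comparison[OF always_eventually lim(1)]) blast
  have "- \<omega> * c \<notin> \<int>" using notint minus_in_Ints_iff[of "\<omega> * c"] by simp
  then have "norm (kern (- (of_real \<omega> * Complex c y))) \<le> 1 / \<bar>sin (pi * (- \<omega> * c))\<bar> / (1 + exp (2 * pi * (\<omega> * y)))" for y
    using norm_kern_le_sin[of "- (of_real \<omega> * Complex c y)"] by simp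
  then have "((\<lambda>y. kern (- (of_real \<omega> * Complex c y))) \<longlongrightarrow> 0) at_top"
    by (intro Lim_null_comparison[OF always_eventually lim(2)]) blast
  then have "((\<lambda>y. - 1 - kern (- (of_real \<omega> * Complex c y))) \<longlongrightarrow> - 1 - 0) at_top"
    by (intro tendsto_intros)
  moreover have "- 1 - kern (- (of_real \<omega> * Complex c y)) = kern (of_real \<omega> * Complex c y)" for y
  proof -
    have "of_real \<omega> * Complex c y \<notin> \<int>" using notint by (intro not_Ints_if_Re) simp
    then show ?thesis by (simp add: kern_uminus)
  qed
  ultimately show "((\<lambda>y. kern (of_real \<omega> * Complex c y)) \<longlongrightarrow> - 1) at_top" by simp
qed

text \<open>For k = kern(\<omega> s) one has k' = -2K k (1 + k) and w = 4 K^2 k (1 + k), so f_n = 2K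
  (k + 1/2) w^n satisfies f_n' = -(2n + 1) w^(n+1) - 2n K^2 w^n, the reduction formula for powers of
  the cosecant. For n \<ge> 1 the boundary values vanish; for n = 0 they are -K at the upper and K
  at the lower end.\<close>

lemma vint_weight_power:
  assumes c: "- 1 / \<omega> < c" "c < 0"
  shows "vint c weight = 2 * K"
    and "n \<ge> 1 \<Longrightarrow> of_nat (2 * n + 1) * vint c (\<lambda>z. weight z ^ Suc n) =
      - (of_nat (2 * n) * K\<^sup>2 * vint c (\<lambda>z. weight z ^ n))"
proof -
  define k where "k = (\<lambda>s. kern (of_real \<omega> * s))"
  define W where "W = (\<lambda>s. 4 * K\<^sup>2 * (k s * (1 + k s)))"
  \<comment> \<open>Off the poles, the factor \<open>2 * K * (k s + 1 / 2)\<close> is pi \<omega>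
    cot (pi \<omega> s).\<close>
  define f where "f = (\<lambda>n s. 2 * K * (k s + 1 / 2) * W s ^ n)"
  have K2: "K\<^sup>2 = - of_real ((pi * \<omega>)\<^sup>2)" by (simp add: K_def power_mult_distrib)
  have notint: "of_real \<omega> * Complex c y \<notin> \<int>" for y
  proof -
    have "\<omega> * c \<notin> \<int>" using c \<omega>_pos by (intro not_Ints_\<omega>_mult) (auto intro: less_trans[of _ 0])
    then show ?thesis by (intro not_Ints_if_Re) simp
  qed
  have W: "weight (Complex c y) = W (Complex c y)" for y
  proof -
    define a b where "a = k (Complex c y)" and "b = kern (- of_real \<omega> * Complex c y)"
    have b: "b = - 1 - a" using kern_uminus[OF notint[of y]] by (simp add: a_def b_def k_def)
    have "weight (Complex c y) = of_real ((2 * pi * \<omega>)\<^sup>2) * (a * b)"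
      by (simp only: weight_def a_def b_def k_def)
    also have "\<dots> = 4 * K\<^sup>2 * (a * (1 + a))"
      by (simp add: b K2 power_mult_distrib algebra_simps)
    finally show ?thesis by (simp only: W_def a_def)
  qed
  have dk: "(k has_field_derivative - (2 * K * (k (Complex c y) * (1 + k (Complex c y))))) (at (Complex c y))" for y
  proof -
    define e where "e = exp (2 * pi * \<i> * (of_real \<omega> * Complex c y))"
    have e: "e \<noteq> 1" using exp_2pi_i_eq_1_iff notint by (simp add: e_def)
    have "(k has_field_derivative (- (2 * pi * \<i> * e) / (e - 1)\<^sup>2) * of_real \<omega>) (at (Complex c y))"
      unfolding k_def e_def using notint
      by (intro DERIV_chain2[OF DERIV_kern]) (auto intro!: derivative_eq_intros)
    moreover have "(- (2 * pi * \<i> * e) / (e - 1)\<^sup>2) * of_real \<omega> = - (2 * K * (1 / (e - 1) * (1 + 1 / (e - 1))))"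
      using e by (simp add: K_def field_simps power2_eq_square)
    ultimately show ?thesis by (simp only: k_def kern_def e_def)
  qed
  have df: "(f n has_field_derivative
      - (of_nat (2 * n + 1) * weight (Complex c y) ^ Suc n) - of_nat (2 * n) * K\<^sup>2 * weight (Complex c y) ^ n)
      (at (Complex c y))" for n y
  proof -
    define a where "a = k (Complex c y)"
    define w where "w = 4 * K\<^sup>2 * (a * (1 + a))"
    define a' where "a' = - (2 * K * (a * (1 + a)))"
    have dk': "(k has_field_derivative a') (at (Complex c y))" using dk by (simp add: a_def a'_def)
    have dW: "(W has_field_derivative 4 * K\<^sup>2 * (a' * (1 + 2 * a))) (at (Complex c y))"
      unfolding W_def by (rule derivative_eq_intros dk' refl)+ (simp add: a_def algebra_simps)
    have "(f n has_field_derivative 2 * K * a' * w ^ n + of_nat n * w ^ (n - 1) * (4 * K\<^sup>2 * (a' * (1 + 2 * a))) * (2 * K * (a + 1 / 2)))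
        (at (Complex c y))"
      unfolding f_def
      by (rule derivative_eq_intros dk' dW refl)+ (simp add: W_def a_def w_def algebra_simps)
    moreover have "2 * K * a' * w ^ n + of_nat n * w ^ (n - 1) * (4 * K\<^sup>2 * (a' * (1 + 2 * a))) * (2 * K * (a + 1 / 2)) =
        - w * w ^ n - of_nat (2 * n) * (w + K\<^sup>2) * w ^ n"
    proof -
      have e1: "2 * K * a' = - w" by (simp add: a'_def w_def power2_eq_square)
      have e2: "4 * K\<^sup>2 * (a' * (1 + 2 * a)) * (2 * K * (a + 1 / 2)) = - (2 * (w + K\<^sup>2)) * w"
        by (simp add: a'_def w_def power2_eq_square algebra_simps)
      have e3: "of_nat n * w ^ (n - 1) * (- (2 * (w + K\<^sup>2)) * w) = - (of_nat (2 * n) * (w + K\<^sup>2) * w ^ n)"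
        by (cases n) (simp_all add: algebra_simps)
      show ?thesis
        unfolding mult.assoc[of "of_nat n * w ^ (n - 1)"] e1 e2 e3 by simp
    qed
    ultimately have "(f n has_field_derivative - w * w ^ n - of_nat (2 * n) * (w + K\<^sup>2) * w ^ n) (at (Complex c y))"
      by (simp only:)
    then show ?thesis
      unfolding W W_def a_def[symmetric] w_def[symmetric] by (simp add: algebra_simps)
  qed
  have int: "vintegrable c (\<lambda>z. weight z ^ n)" if "n \<ge> 1" for n
    by (rule vintegrable_weight_power[OF c that])
  have lim_k: "((\<lambda>y. k (Complex c y)) \<longlongrightarrow> 0) at_bot" "((\<lambda>y. k (Complex c y)) \<longlongrightarrow> - 1) at_top"
    unfolding k_def by (rule kern_line_limits[OF c])+
  have top: "((\<lambda>y. f n (Complex c y)) \<longlongrightarrow> 2 * K * (- 1 + 1 / 2) * (4 * K\<^sup>2 * (- 1 * (1 + - 1))) ^ n) at_top" for n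
    unfolding f_def W_def by (intro tendsto_intros lim_k)
  have bot: "((\<lambda>y. f n (Complex c y)) \<longlongrightarrow> 2 * K * (0 + 1 / 2) * (4 * K\<^sup>2 * (0 * (1 + 0))) ^ n) at_bot" for n
    unfolding f_def W_def by (intro tendsto_intros lim_k)
  have "vint c (\<lambda>z. - (of_nat (2 * 0 + 1) * weight z ^ Suc 0) - of_nat (2 * 0) * K\<^sup>2 * weight z ^ 0) = - K - K"
    using top[of 0] bot[of 0] int[of 1]
    by (intro vint_derivative[OF df]) (simp_all add: vintegrable_def)
  then show "vint c weight = 2 * K"
    by (simp add: vint_def)
  assume n: "n \<ge> 1"
  have i1: "integrable lborel (\<lambda>y. weight (Complex c y) ^ Suc n)" and i2: "integrable lborel (\<lambda>y. weight (Complex c y) ^ n)"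
    using int[of "Suc n"] int[OF n] by (simp_all add: vintegrable_def)
  have "vint c (\<lambda>z. - (of_nat (2 * n + 1) * weight z ^ Suc n) - of_nat (2 * n) * K\<^sup>2 * weight z ^ n) = 0 - 0"
    using top[of n] bot[of n] n i1 i2
    by (intro vint_derivative[OF df]) (simp_all add: vintegrable_def power_0_left del: power_Suc of_nat_Suc of_nat_mult of_nat_add)
  moreover have "vint c (\<lambda>z. - (of_nat (2 * n + 1) * weight z ^ Suc n) - of_nat (2 * n) * K\<^sup>2 * weight z ^ n) =
      - (of_nat (2 * n + 1) * vint c (\<lambda>z. weight z ^ Suc n)) - of_nat (2 * n) * K\<^sup>2 * vint c (\<lambda>z. weight z ^ n)"
    unfolding vint_def using i1 i2
    by (simp add: Bochner_Integration.integral_diff right_diff_distrib mult.left_commute[of \<i>] del: power_Suc of_nat_Suc of_nat_mult of_nat_add)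
  ultimately show "of_nat (2 * n + 1) * vint c (\<lambda>z. weight z ^ Suc n) =
      - (of_nat (2 * n) * K\<^sup>2 * vint c (\<lambda>z. weight z ^ n))"
    by (simp add: algebra_simps eq_neg_iff_add_eq_0 del: power_Suc)
qed

lemma V_nth_eq_vint:
  assumes c: "- 1 / \<omega> < c" "c < 0"
  shows "V $ (2 * n + 2) = (- 1) ^ n * vint c (\<lambda>z. weight z ^ Suc n)"
proof (induction n)
  case 0
  then show ?case using V_nth_even(1) vint_weight_power(1)[OF c] by (simp add: numeral_2_eq_2)
next
  case (Suc n)
  define A where "A = vint c (\<lambda>z. weight z ^ Suc n)"
  define A' where "A' = vint c (\<lambda>z. weight z ^ Suc (Suc n))"
  have "of_nat (2 * n + 3) * A' = - (of_nat (2 * n + 2) * K\<^sup>2 * A)"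
    using vint_weight_power(2)[OF c, of "Suc n"] by (simp add: A_def A'_def numeral_eq_Suc del: power_Suc)
  moreover have "of_nat (2 * n + 3) \<noteq> (0 :: complex)" unfolding of_nat_eq_0_iff by simp
  ultimately have A': "A' = - (K\<^sup>2 * (of_nat (2 * n + 2) / of_nat (2 * n + 3)) * A)"
    by (simp add: field_simps del: of_nat_add of_nat_mult)
  have "V $ (2 * Suc n + 2) = K\<^sup>2 * (of_nat (2 * n + 2) / of_nat (2 * n + 3)) * V $ (2 * n + 2)"
    using V_nth_even(2)[of n] by (simp add: numeral_eq_Suc)
  also have "\<dots> = (- 1) ^ Suc n * A'"
    unfolding Suc.IH A' A_def[symmetric] by simp
  finally show ?case unfolding A'_def .
qed

text \<open>Near 0 the weight is -P^(-2), and kern + 1/2 is (N \<circ> P) P'/P divided by 2 pi \<i>.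
  Up to a constant the function is thus (N \<circ> P) P' / P^(2k+1), whose residue
  \<open>fls_residue_compose\<close> evaluates.\<close>

lemma residue_weight_power:
  "residue (\<lambda>s. weight s ^ k * (kern s + 1 / 2)) 0 = (- 1) ^ k / (2 * \<i> * pi) * N $ (2 * k)"
proof -
  define p where "p = fps_to_fls P"
  define h where "h = (\<lambda>s. (- 1) ^ k / (2 * \<i>) * (inverse (1 / K * sin (of_real (pi * \<omega>) * s)) ^ (2 * k) *
    (cos (of_real pi * s) * inverse (sin (of_real pi * s)))))"
  have "(\<lambda>s. 1 / K * sin (of_real (pi * \<omega>) * s)) has_fps_expansion P"
    unfolding P_def by (intro fps_expansion_intros)
  then have "(\<lambda>s. 1 / K * sin (of_real (pi * \<omega>) * s)) has_laurent_expansion p"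
    unfolding p_def by (rule has_laurent_expansion_fps)
  then have h: "h has_laurent_expansion fls_const ((- 1) ^ k / (2 * \<i>)) * (inverse p ^ (2 * k) *
      (fps_to_fls (fps_cos pi) * inverse (fps_to_fls (fps_sin pi))))"
    unfolding h_def by (intro laurent_expansion_intros)
  have p0: "p \<noteq> 0" using P_nth(2) by (auto simp: p_def)
  have s0: "fps_to_fls (fps_sin (of_real pi :: complex)) \<noteq> 0"
  proof -
    have "fps_sin (of_real pi :: complex) $ 1 \<noteq> 0" by simp
    then show ?thesis by (metis fps_to_fls_eq_0_iff fps_zero_nth)
  qed
  have "fps_to_fls ((N oo P) * fps_deriv P * fps_sin pi) = fps_to_fls (fps_const (of_real pi) * P * fps_cos pi)"
    using N_oo_P by simp
  then have eq: "fps_to_fls (N oo P) * fps_to_fls (fps_deriv P) * fps_to_fls (fps_sin pi) =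
      fls_const (of_real pi) * p * fps_to_fls (fps_cos pi)"
    by (simp add: fls_times_fps_to_fls p_def)
  have "fps_to_fls (fps_cos pi) * inverse (fps_to_fls (fps_sin pi)) =
      fls_const (1 / of_real pi) * (fps_to_fls (N oo P) * fps_to_fls (fps_deriv P) * inverse p)"
  proof -
    define A C S where "A = fps_to_fls (N oo P) * fps_to_fls (fps_deriv P)"
      and "C = fps_to_fls (fps_cos (of_real pi :: complex))" and "S = fps_to_fls (fps_sin (of_real pi :: complex))"
    have \<pi>: "fls_const (1 / of_real pi) * fls_const (of_real pi) = (1 :: complex fls)"
      by (simp add: fls_const_mult_const)
    have "C * inverse S = (fls_const (1 / of_real pi) * fls_const (of_real pi)) * (p * inverse p) * (C * inverse S)"
      unfolding \<pi> using p0 by simp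
    also have "\<dots> = fls_const (1 / of_real pi) * (fls_const (of_real pi) * p * C) * inverse p * inverse S"
      by (simp only: mult_ac)
    also have "fls_const (of_real pi) * p * C = A * S" using eq by (simp only: A_def C_def S_def)
    also have "fls_const (1 / of_real pi) * (A * S) * inverse p * inverse S =
        fls_const (1 / of_real pi) * (A * inverse p) * (S * inverse S)"
      by (simp only: mult_ac)
    finally show ?thesis using s0 by (simp add: A_def C_def S_def)
  qed
  then have "fls_const ((- 1) ^ k / (2 * \<i>)) * (inverse p ^ (2 * k) *
      (fps_to_fls (fps_cos pi) * inverse (fps_to_fls (fps_sin pi)))) =
      (fls_const ((- 1) ^ k / (2 * \<i>)) * fls_const (1 / of_real pi)) *
      (fps_to_fls (N oo P) * fps_to_fls (fps_deriv P) * inverse p ^ Suc (2 * k))"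
    by (simp only: power_Suc mult_ac)
  also have "fls_const ((- 1) ^ k / (2 * \<i>)) * fls_const (1 / of_real pi) =
      fls_const ((- 1) ^ k / (2 * \<i>) * (1 / of_real pi))"
    by (rule fls_const_mult_const)
  finally have "residue h 0 = (- 1) ^ k / (2 * \<i>) * (1 / of_real pi) * N $ (2 * k)"
    unfolding has_laurent_expansion_residue_0[OF h]
    using fls_residue_compose[OF P_nth, of N "2 * k"]
    by (simp only: fls_residue_fls_const_times p_def)
  moreover have "residue (\<lambda>s. weight s ^ k * (kern s + 1 / 2)) 0 = residue h 0"
  proof (rule residue_cong)
    have "eventually (\<lambda>s::complex. s \<in> ball 0 1 - {0}) (at 0)"
      by (intro eventually_at_in_open) auto
    then show "eventually (\<lambda>s. weight s ^ k * (kern s + 1 / 2) = h s) (at 0)"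
    proof eventually_elim
      case (elim s)
      have nonint: "s \<notin> \<int>"
      proof
        assume "s \<in> \<int>"
        then obtain n :: int where "s = of_int n" by (auto elim: Ints_cases)
        then have "\<bar>real_of_int n\<bar> < 1" "n \<noteq> 0" using elim by auto
        then show False by linarith
      qed
      have 1: "kern s + 1 / 2 = 1 / (2 * \<i>) * (cos (of_real pi * s) * inverse (sin (of_real pi * s)))"
        unfolding kern_half_eq_cot[OF nonint] by (simp only: divide_inverse inverse_mult_distrib mult_1_left mult_ac)
      have K2: "K\<^sup>2 = - of_real ((pi * \<omega>)\<^sup>2)" by (simp add: K_def power_mult_distrib)
      have "weight s = - (inverse (1 / K * sin (of_real (pi * \<omega>) * s)))\<^sup>2"
        unfolding weight_eq_sin
        by (simp add: power_mult_distrib K2 power_inverse power_divide divide_inverse)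
      then have 2: "weight s ^ k = (- 1) ^ k * inverse (1 / K * sin (of_real (pi * \<omega>) * s)) ^ (2 * k)"
        by (simp only: power_minus[of "_\<^sup>2"] power_mult)
      show ?case unfolding 1 2 h_def by (simp only: mult_ac divide_inverse mult_1_left mult_1_right)
    qed
  qed simp
  ultimately show ?thesis by (simp only: times_divide_times_eq mult_1_right)
qed

text \<open>The product F of the even function w^k and the odd function kern + 1/2 is odd, so its
  integrals along Re = c and Re = -c are opposite, and the residue at 0 determines both. The leading
  factor 2 anticipates the chain rule for X^2.\<close>

lemma pow_transform_0:
  assumes "k \<ge> 1"
  shows "2 * ((- 1) ^ (k + 1) * pow_transform k 0) = N $ (2 * k) - V $ (2 * k)"
proof -
  \<comment> \<open>For |Re s| < m neither the kernel nor the weight has a pole other than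
    0.\<close>
  define m where "m = min 1 (1 / \<omega>)"
  define c where "c = - m / 2"
  have m: "m > 0" "m \<le> 1" "m \<le> 1 / \<omega>" using \<omega>_pos by (auto simp: m_def)
  have c: "- 1 / \<omega> < c" "c < 0" "- 1 < c" "c < 1"
  proof -
    have "m / 2 < 1 / \<omega>" using m by linarith
    then show "- 1 / \<omega> < c" by (simp add: c_def)
  qed (use m in \<open>auto simp: c_def\<close>)
  define F where "F = (\<lambda>s. weight s ^ k * (kern s + 1 / 2))"
  interpret cauchy_transform "1 / \<omega>" "2 * pi * \<omega>" "\<lambda>s. weight s ^ k"
    using assms by (rule cauchy_transform_weight)
  have i1: "vintegrable c (\<lambda>z. weight z ^ k * kern z)"
    using vintegrable_u_kern[of c 0] c not_Ints_between[of "- 1" c] by simp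
  have i2: "vintegrable c (\<lambda>z. weight z ^ k)" using c assms by (intro vintegrable_weight_power)
  have iF: "integrable lborel (\<lambda>y. F (Complex c y))"
    using i1 i2 by (simp add: vintegrable_def F_def distrib_left)
  have T: "pow_transform k 0 = vint c F - vint c (\<lambda>z. weight z ^ k) / 2"
  proof -
    have "pow_transform k 0 = vint c (\<lambda>z. weight z ^ k * kern z)"
      using pow_transform(4)[OF assms, of c 0] c by simp
    also have "\<dots> = vint c F - vint c (\<lambda>z. weight z ^ k) / 2"
      using i1 i2 by (simp add: vint_def vintegrable_def F_def distrib_left)
    finally show ?thesis .
  qed
  have odd: "F (Complex (- c) y) = - F (Complex c (- y))" for y
  proof -
    define z where "z = Complex c (- y)"
    have z: "Complex (- c) y = - z" by (simp add: z_def complex_eq_iff)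
    have "z \<notin> \<int>" using c not_Ints_between[of "- 1" c] by (intro not_Ints_if_Re) (simp add: z_def)
    then have "kern (- z) + 1 / 2 = - (kern z + 1 / 2)" by (simp add: kern_uminus)
    then show ?thesis unfolding z z_def[symmetric] F_def weight_uminus by (simp only: mult_minus_right)
  qed
  have iF': "integrable lborel (\<lambda>y. F (Complex c (- y)))"
    using lborel_integrable_real_affine[OF iF, of "- 1" 0] by simp
  \<comment> \<open>The substitution y \<mapsto> -y preserves Lebesgue measure, so the sign comes
    from the oddness of \<open>F\<close> alone.\<close>
  have refl: "vint (- c) F = - vint c F"
    using lborel_integral_real_affine[of "- 1" "\<lambda>y. F (Complex c y)" 0] by (simp add: vint_def odd)
  have "vint (- c) F - vint c F = 2 * pi * \<i> * (\<Sum>p\<in>{0}. residue F p)"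
  proof (rule vint_diff_eq_residues[of "- m" c "- c" m])
    show "F holomorphic_on {s. - m < Re s \<and> Re s < m} - {0}"
      unfolding F_def weight_def
    proof (intro holomorphic_intros)
      have nonint: "t \<notin> \<int>" if "\<bar>Re t\<bar> < 1" "t \<noteq> 0" for t
        using that by (auto elim!: Ints_cases)
      fix s assume s: "s \<in> {s. - m < Re s \<and> Re s < m} - {0}"
      then have "\<bar>Re s\<bar> < 1" "\<bar>Re s\<bar> < 1 / \<omega>" "s \<noteq> 0" using m by auto
      moreover from this have "\<bar>\<omega> * Re s\<bar> < 1" using \<omega>_pos by (simp add: abs_mult field_simps)
      ultimately show "s \<notin> \<int>" "of_real \<omega> * s \<notin> \<int>" "- of_real \<omega> * s \<notin> \<int>"
        using \<omega>_pos nonint[of s] nonint[of "of_real \<omega> * s"] nonint[of "- of_real \<omega> * s"] by simp_all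
    qed
    show "vintegrable c F" "vintegrable (- c) F"
      using iF iF' by (simp_all add: vintegrable_def odd)
    fix e :: real assume "e > 0"
    show "\<exists>N. \<forall>s. c \<le> Re s \<and> Re s \<le> - c \<and> N \<le> \<bar>Im s\<bar> \<longrightarrow> norm (F s) \<le> e"
    proof -
      define B where "B = (4 * (2 * pi * \<omega>)\<^sup>2) ^ k * 3"
      obtain N0 where N0: "\<And>y. \<bar>y\<bar> \<ge> N0 \<Longrightarrow> B * exp (- (2 * pi * \<omega> * \<bar>y\<bar>)) \<le> e"
        using small_exp_bound[of "2 * pi * \<omega>" e B] \<omega>_pos \<open>e > 0\<close> by auto
      \<comment> \<open>From this height on the far bounds for both the kernel and the weight
        apply.\<close>
      have "norm (F s) \<le> e" if s: "\<bar>Im s\<bar> \<ge> max N0 (max 1 (1 / \<omega>))" for s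
      proof -
        have "\<bar>\<omega> * Im s\<bar> \<ge> 1" using s \<omega>_pos by (simp add: abs_mult field_simps)
        then have "norm (weight s) ^ k \<le> (4 * (2 * pi * \<omega>)\<^sup>2 * exp (- (2 * pi * \<omega> * \<bar>Im s\<bar>))) ^ k"
          by (intro power_mono weight_bound_far) auto
        also have "\<dots> = (4 * (2 * pi * \<omega>)\<^sup>2) ^ k * exp (- (2 * pi * \<omega> * \<bar>Im s\<bar>)) ^ k"
          by (rule power_mult_distrib)
        also have "\<dots> \<le> (4 * (2 * pi * \<omega>)\<^sup>2) ^ k * exp (- (2 * pi * \<omega> * \<bar>Im s\<bar>)) ^ 1"
          using assms \<omega>_pos by (intro mult_left_mono power_decreasing) auto
        finally have w: "norm (weight s) ^ k \<le> (4 * (2 * pi * \<omega>)\<^sup>2) ^ k * exp (- (2 * pi * \<omega> * \<bar>Im s\<bar>))"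
          by simp
        have "norm (kern s) \<le> 2 / (1 + exp (- (2 * pi * Im s)))"
          using s by (intro norm_kern_le_far) auto
        also have "\<dots> \<le> 2" by (rule divide_one_plus_exp_le) simp
        finally have "norm (kern s + 1 / 2) \<le> 3"
          using norm_triangle_ineq[of "kern s" "1 / 2"] by simp
        with w have "norm (F s) \<le> (4 * (2 * pi * \<omega>)\<^sup>2) ^ k * exp (- (2 * pi * \<omega> * \<bar>Im s\<bar>)) * 3"
          unfolding F_def norm_mult norm_power by (intro mult_mono) auto
        also have "\<dots> \<le> e" using N0[of "Im s"] s by (simp add: B_def mult_ac)
        finally show ?thesis .
      qed
      then show ?thesis by blast
    qed
  qed (use m in \<open>auto simp: c_def\<close>)
  then have "- vint c F = pi * \<i> * residue F 0" by (simp add: refl)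
  then have "vint c F = - (pi * \<i>) * residue F 0" by (metis minus_minus mult_minus_left)
  also have "residue F 0 = (- 1) ^ k / (2 * \<i> * pi) * N $ (2 * k)"
    unfolding F_def by (rule residue_weight_power)
  finally have "vint c F = - ((- 1) ^ k * N $ (2 * k)) / 2" by simp
  moreover have "vint c (\<lambda>z. weight z ^ k) = - ((- 1) ^ k * V $ (2 * k))"
  proof -
    obtain n where n: "k = Suc n" using assms by (cases k) auto
    show ?thesis using V_nth_eq_vint[OF c(1,2), of n] by (simp add: n flip: power_add mult.assoc)
  qed
  ultimately have "pow_transform k 0 = - ((- 1) ^ k * (N $ (2 * k) - V $ (2 * k))) / 2"
    unfolding T by (simp add: algebra_simps)
  then show ?thesis by (simp add: diff_divide_distrib flip: power_add mult.assoc)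
qed

text \<open>Both sides have the same constant term and the Euler logarithmic derivative N - 1 - V:
  even coefficients agree by \<open>pow_transform_0\<close>, odd ones vanish. The factor 2 is the
  chain rule for X^2.\<close>

lemma solution_eq_closed_form:
  "fps_exp_solution (log_coeffs 0) oo fps_X ^ 2 = closed_form"
proof (rule fps_ode_unique)
  define D where "D = log_coeffs 0"
  define E where "E = fps_exp_solution D"
  have D0: "D $ 0 = 0" by (simp add: D_def log_coeffs_def)
  have D: "fps_const 2 * (D oo fps_X ^ 2) = N - 1 - V"
  proof (rule fps_ext)
    fix n
    show "(fps_const 2 * (D oo fps_X ^ 2)) $ n = (N - 1 - V) $ n"
    proof (cases "even n")
      case False
      then have "n \<noteq> 0" by (cases n) auto
      then show ?thesis using False N_nth_odd V_nth_odd by (simp add: fps_nth_compose_X_power)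
    next
      case True
      then obtain k where k: "n = 2 * k" by (elim evenE)
      show ?thesis
      proof (cases "k = 0")
        case True
        then show ?thesis using k N_nth_0 V_nth_0 D0 by simp
      next
        case False
        then show ?thesis using k pow_transform_0[of k]
          by (simp add: fps_nth_compose_X_power D_def log_coeffs_def)
      qed
    qed
  qed
  have X0: "(fps_X ^ 2 :: complex fps) $ 0 = 0" by simp
  have "fps_X * fps_deriv (E oo fps_X ^ 2) = fps_const 2 * ((fps_X * fps_deriv E) oo fps_X ^ 2)"
  proof -
    have "fps_deriv (fps_X ^ 2 :: complex fps) = fps_const 2 * fps_X"
      by (simp add: power2_eq_square numeral_fps_const[symmetric])
    then have "fps_X * fps_deriv (E oo fps_X ^ 2) = fps_X * ((fps_deriv E oo fps_X ^ 2) * (fps_const 2 * fps_X))"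
      by (simp only: fps_compose_deriv[OF X0])
    also have "\<dots> = fps_const 2 * (fps_X ^ 2 * (fps_deriv E oo fps_X ^ 2))"
      by (simp only: power2_eq_square mult_ac)
    also have "fps_X ^ 2 * (fps_deriv E oo fps_X ^ 2) = (fps_X * fps_deriv E) oo fps_X ^ 2"
      by (simp only: fps_compose_mult_distrib[OF X0] fps_X_fps_compose_startby0[OF X0])
    finally show ?thesis .
  qed
  also have "\<dots> = (E oo fps_X ^ 2) * (N - 1 - V)"
    unfolding D[symmetric] E_def fps_exp_solution(1)[OF D0]
    by (simp only: fps_compose_mult_distrib[OF X0] mult_ac)
  finally show "fps_X * fps_deriv (fps_exp_solution (log_coeffs 0) oo fps_X ^ 2) =
      (fps_exp_solution (log_coeffs 0) oo fps_X ^ 2) * (N - 1 - V)"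
    by (simp only: E_def D_def)
  show "(fps_exp_solution (log_coeffs 0) oo fps_X ^ 2) $ 0 = closed_form $ 0"
    using closed_form_ode(2) fps_exp_solution(2)[OF D0] by (simp add: D_def)
qed (use closed_form_ode(1) N_nth_0 V_nth_0 in auto)

end

theorem corollary5p12:
  fixes \<omega> :: real and \<epsilon> :: "nat \<Rightarrow> real"
  assumes "\<omega> > 0"
    and "\<And>r. r \<ge> 1 \<Longrightarrow> 0 < \<epsilon> r \<and> \<epsilon> r < min 1 (1 / (real r * \<omega>))"
  shows
    "1 + (Abs_fps (\<lambda>r. if r \<ge> 1 then Z_map \<omega> \<epsilon> (e_elt 2 ^ r) else 0) oo fps_X ^ 2) =
     (fps_sin 1 oo (fps_const (1 / \<omega>) * (fps_Arcsin oo (fps_const (pi * \<i> * \<omega>) * fps_X)))) /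
       (fps_const (pi * \<i>) * fps_X) *
     (fps_exp 1 oo
       (- ((fps_Arcsin oo (fps_const (pi * \<i> * \<omega>) * fps_X)) ^ 2 / fps_const (pi * \<i> * \<omega>))))"
proof -
  interpret omega \<omega> by standard fact
  define E where "E = fps_exp_solution (log_coeffs 0)"
  have Z: "Z_map \<omega> \<epsilon> (e_elt 2 ^ r) = E $ r" if "r \<ge> 1" for r
  proof -
    \<comment> \<open>The bound on \<epsilon> keeps even the last partial sum, on the line Re = -r
      \<epsilon>, to the right of the pole of the weight at -1/\<omega>.\<close>
    have "\<epsilon> r < 1 / (real r * \<omega>)" using assms(2)[OF that] by simp
    then have "real r * \<epsilon> r < 1 / \<omega>" using that assms(1) by (simp add: field_simps)
    then show ?thesis
      using Z_map_e_elt_2_power[OF that] assms(2)[OF that] by (simp add: Zfun_def E_def)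
  qed
  have "E $ 0 = 1" unfolding E_def by (rule fps_exp_solution(2)) (simp add: log_coeffs_def)
  then have E: "E = 1 + Abs_fps (\<lambda>r. if r \<ge> 1 then Z_map \<omega> \<epsilon> (e_elt 2 ^ r) else 0)"
    by (intro fps_ext) (auto simp: Z not_less_eq_eq)
  have "1 + (Abs_fps (\<lambda>r. if r \<ge> 1 then Z_map \<omega> \<epsilon> (e_elt 2 ^ r) else 0) oo fps_X ^ 2) = E oo fps_X ^ 2"
    unfolding E by (simp add: fps_compose_add_distrib)
  also have "\<dots> = closed_form" unfolding E_def by (rule solution_eq_closed_form)
  also have "\<dots> = (fps_sin 1 oo (fps_const (1 / \<omega>) * (fps_Arcsin oo (fps_const (pi * \<i> * \<omega>) * fps_X)))) /
       (fps_const (pi * \<i>) * fps_X) *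
     (fps_exp 1 oo
       (- ((fps_Arcsin oo (fps_const (pi * \<i> * \<omega>) * fps_X)) ^ 2 / fps_const (pi * \<i> * \<omega>))))"
    unfolding closed_form_def \<phi>_def \<theta>_def K_def of_real_divide of_real_1 ..
  finally show ?thesis .
qed

end
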